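(* Let $t>0$, let $l\ge1$ be an integer, $\alpha_1,\dots,\alpha_{l+1}>0$, $m\in\{0,1\}$, $n\ge0$ an integer, $v_0=\frac n2$, $v_1=n+1$, and suppose $v_m>\frac{\alpha_1}{2}-1$. Then, given $N(t)=n$, for $x\in\mathbb{R}$, $$P\left\{X_m(\mathcal{G}_l(t))\in dx\,|\,N(t)=n\right\}=\frac{dx}{\Gamma\left(\frac{\alpha_1+1}{2}\right)B\left(\frac{\alpha_1}{2},v_m-\frac{\alpha_1}{2}+1\right)}\int_{(0,\infty)^l}\left(\prod_{j=1}^{l}\frac{t_{j+1}^{\alpha_{j+1}}}{\Gamma(\alpha_{j+1})}t_j^{\alpha_{j+1}-1}e^{-t_{j+1}t_j}\right)H(t_1)\,dt_1\cdots dt_l,$$ where $t_{l+1}=t$ and $$H(t_1)=\int_0^1w^{\frac{\alpha_1}{2}-1}(1-w)^{v_m-\frac{\alpha_1}{2}}\,\frac{t_1}{\sqrt{\pi w}\,c}\left(\frac{t_1|x|}{2c\sqrt{w}}\right)^{\frac{\alpha_1}{2}}K_{-\frac{\alpha_1}{2}}\left(\frac{t_1|x|}{c\sqrt{w}}\right)dw.$$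
   Context: Fix $c>0$, $\lambda>0$. For $m\in\{0,1\}$ let $X_m(s)=c\sum_{j=1}^{N(s)+1}(s_j-s_{j-1})\cos\theta_j$, where $N$ is a homogeneous Poisson process of rate $\lambda$ with event times $s_1<s_2<\cdots$, $s_0=0$, $s_{N(s)+1}=s$, and the $\theta_j$ are i.i.d. (independent of $N$) with density $\frac{\Gamma(m+1)}{\sqrt\pi\,\Gamma(m+\frac12)}\sin^{2m}\theta$ on $(0,\pi)$. Let $p_n^m(x,s)$ be the density of $X_m(s)$ given $N(s)=n$; explicitly $p_n^m(x,s)=\frac{\Gamma(v_m)\Gamma(v_m+1)}{2\pi\Gamma(2v_m)}\left(\frac{2}{cs}\right)^{2v_m}(c^2s^2-x^2)^{v_m-\frac12}$ for $|x|<cs$ and $0$ otherwise, with $\Gamma(v)/\Gamma(2v)$ read as $2$ when $v=0$. For $\alpha>0$, $G_\alpha(t)$ has Gamma density $\frac{t^\alpha}{\Gamma(\alpha)}s^{\alpha-1}e^{-ts}$, $s>0$. The iterated Gamma process is $\mathcal{G}_l(t)=G_{\alpha_1}(G_{\alpha_2}(\cdots(G_{\alpha_{l+1}}(t))\cdots))$ with independent Gamma processes, independent of $X_m$ and $N$; its density at $s>0$ is $\int_{(0,\infty)^l}\frac{t_1^{\alpha_1}}{\Gamma(\alpha_1)}s^{\alpha_1-1}e^{-t_1s}\prod_{j=1}^{l}\frac{t_{j+1}^{\alpha_{j+1}}}{\Gamma(\alpha_{j+1})}t_j^{\alpha_{j+1}-1}e^{-t_{j+1}t_j}\,dt_1\cdots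 dt_l$ with $t_{l+1}=t$. For an independent positive random time $T$, the conditional law $P\{X_m(T)\in dx\,|\,N(t)=n\}$ means the law of $X_m$ at time $T$ when the number of Poisson events up to that time is fixed to be $n$, i.e. $dx\int_0^\infty p_n^m(x,s)\,P\{T\in ds\}$. $B(a,b)=\Gamma(a)\Gamma(b)/\Gamma(a+b)$ is the Beta function, and $K_\mu(x)=\frac12\left(\frac x2\right)^\mu\int_0^\infty e^{-z-\frac{x^2}{4z}}z^{-\mu-1}dz$ ($x>0$) is the modified Bessel function of the second kind. Equalities of laws are equalities of Lebesgue densities (a.e. $x$). *)

theory Defs
  imports "HOL-Probability.Probability"
begin

text \<open>The sigma-algebra on the space of M generated by the real-valued family \<open>(Y i)\<close>, \<open>i \<in> I\<close>.\<close>
definition process_sigma :: "'a measure \<Rightarrow> 'i set \<Rightarrow> ('i \<Rightarrow> 'a \<Rightarrow> real) \<Rightarrow> 'a measure" where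
  "process_sigma M I Y =
     vimage_algebra (space M) (\<lambda>\<omega>. \<lambda>i\<in>I. Y i \<omega>) (\<Pi>\<^sub>M i\<in>I. borel)"

text \<open>A homogeneous Poisson process of rate \<open>lam\<close> is given by its event times \<open>S 1, S 2, \<dots>\<close>:
  \<open>S 0 = 0\<close> and the inter-arrival times are i.i.d. exponential with parameter \<open>lam\<close>.\<close>
definition poisson_event_times :: "'a measure \<Rightarrow> real \<Rightarrow> (nat \<Rightarrow> 'a \<Rightarrow> real) \<Rightarrow> bool" where
  "poisson_event_times M lam S \<longleftrightarrow>
     (\<forall>\<omega>\<in>space M. S 0 \<omega> = 0) \<and>
     prob_space.indep_vars M (\<lambda>_. borel) (\<lambda>j \<omega>. S (Suc j) \<omega> - S j \<omega>) UNIV \<and>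
     (\<forall>j. distributed M lborel (\<lambda>\<omega>. S (Suc j) \<omega> - S j \<omega>) (exponential_density lam))"

text \<open>The number of events up to time s.  (It is 0 by convention of \<open>card\<close> on the null set where
  infinitely many events occur before s.)\<close>
definition event_count :: "(nat \<Rightarrow> 'a \<Rightarrow> real) \<Rightarrow> real \<Rightarrow> 'a \<Rightarrow> nat" where
  "event_count S s \<omega> = card {j. 1 \<le> j \<and> S j \<omega> \<le> s}"

definition angle_density :: "nat \<Rightarrow> real \<Rightarrow> real" where
  "angle_density m x =
     (if 0 < x \<and> x < pi
      then Gamma (real m + 1) / (sqrt pi * Gamma (real m + 1/2)) * sin x ^ (2 * m) else 0)"

text \<open>The directions \<open>\<theta> 1, \<theta> 2, \<dots>\<close>; the value \<open>\<theta> 0\<close> is never used.\<close>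
definition iid_angles :: "'a measure \<Rightarrow> nat \<Rightarrow> (nat \<Rightarrow> 'a \<Rightarrow> real) \<Rightarrow> bool" where
  "iid_angles M m \<theta> \<longleftrightarrow>
     prob_space.indep_vars M (\<lambda>_. borel) \<theta> {1..} \<and>
     (\<forall>j\<ge>1. distributed M lborel (\<theta> j) (angle_density m))"

definition flight :: "real \<Rightarrow> (nat \<Rightarrow> 'a \<Rightarrow> real) \<Rightarrow> (nat \<Rightarrow> 'a \<Rightarrow> real) \<Rightarrow> real \<Rightarrow> 'a \<Rightarrow> real" where
  "flight c S \<theta> s \<omega> =
     (let N = event_count S s \<omega>; \<sigma> = (\<lambda>j. if j = N + 1 then s else S j \<omega>)
      in c * (\<Sum>j=1..N+1. (\<sigma> j - \<sigma> (j - 1)) * cos (\<theta> j \<omega>)))"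

text \<open>Note that the time parameter of the process is the rate of the Gamma law.\<close>
definition gamma_density :: "real \<Rightarrow> real \<Rightarrow> real \<Rightarrow> real" where
  "gamma_density a t s =
     (if 0 < s then t powr a / Gamma a * s powr (a - 1) * exp (- t * s) else 0)"

text \<open>A positive process \<open>(G t)\<close>, \<open>t > 0\<close>, with the prescribed one-dimensional laws.  For the
  composition of independent processes to be well behaved, the process is required to be jointly
  measurable with respect to the sigma-algebra it generates; this holds, for instance, if it has
  right-continuous paths.  (Joint measurability with respect to M would not be enough.)\<close>
definition gamma_process :: "'a measure \<Rightarrow> real \<Rightarrow> (real \<Rightarrow> 'a \<Rightarrow> real) \<Rightarrow> bool" where
  "gamma_process M a G \<longleftrightarrow>
     (\<forall>t>0. \<forall>\<omega>\<in>space M. 0 < G t \<omega>) \<and>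
     (\<forall>t>0. distributed M lborel (G t) (gamma_density a t)) \<and>
     (\<lambda>(t, \<omega>). G t \<omega>) \<in>
       borel_measurable (restrict_space borel {0<..} \<Otimes>\<^sub>M process_sigma M {0<..} G)"

text \<open>\<open>iterated G k t = G 1 (G 2 (\<dots> (G k t) \<dots>))\<close>.\<close>
primrec iterated :: "(nat \<Rightarrow> real \<Rightarrow> 'a \<Rightarrow> real) \<Rightarrow> nat \<Rightarrow> real \<Rightarrow> 'a \<Rightarrow> real" where
  "iterated G 0 t \<omega> = t"
| "iterated G (Suc k) t \<omega> = iterated G k (G (Suc k) t \<omega>) \<omega>"

text \<open>Independence of the angles from the Poisson process, and mutual independence of
  \<open>G 1, \<dots>, G k\<close> and the pair (Poisson process, angles), which carries the index 0.\<close>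
definition independent_model ::
  "'a measure \<Rightarrow> (nat \<Rightarrow> 'a \<Rightarrow> real) \<Rightarrow> (nat \<Rightarrow> 'a \<Rightarrow> real) \<Rightarrow> (nat \<Rightarrow> real \<Rightarrow> 'a \<Rightarrow> real) \<Rightarrow> nat \<Rightarrow> bool" where
  "independent_model M S \<theta> G k \<longleftrightarrow>
     prob_space.indep_set M (sets (process_sigma M UNIV S)) (sets (process_sigma M {1..} \<theta>)) \<and>
     prob_space.indep_sets M
       (\<lambda>i. if i = 0 then sets (process_sigma M (UNIV <+> {1..}) (case_sum S \<theta>))
            else sets (process_sigma M {0<..} (G i))) {0..k}"

text \<open>The conditional law of the flight at the random time T, the number of Poisson events up to
  that time being fixed to be n: the conditional law of the position at time s given n events up to
  time s, averaged over the (unconditional) law of T.\<close>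
definition flight_law_at ::
  "'a measure \<Rightarrow> real \<Rightarrow> (nat \<Rightarrow> 'a \<Rightarrow> real) \<Rightarrow> (nat \<Rightarrow> 'a \<Rightarrow> real) \<Rightarrow> nat \<Rightarrow> ('a \<Rightarrow> real) \<Rightarrow> real set \<Rightarrow> ennreal" where
  "flight_law_at M c S \<theta> n T A =
     (\<integral>\<^sup>+ s. ennreal (\<P>(\<omega> in M. flight c S \<theta> s \<omega> \<in> A \<bar> event_count S s \<omega> = n)) \<partial>distr M borel T)"

definition bessel_K :: "real \<Rightarrow> real \<Rightarrow> real" where
  "bessel_K \<mu> x =
     1/2 * (x/2) powr \<mu> * (LBINT z:{0<..}. exp (- z - x\<^sup>2 / (4 * z)) * z powr (- \<mu> - 1))"

definition v_param :: "nat \<Rightarrow> nat \<Rightarrow> real" where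
  "v_param m n = (if m = 0 then real n / 2 else real n + 1)"

definition H_fun :: "real \<Rightarrow> real \<Rightarrow> real \<Rightarrow> real \<Rightarrow> real \<Rightarrow> real" where
  "H_fun c a v x t1 =
     (LBINT w:{0<..<1}. w powr (a/2 - 1) * (1 - w) powr (v - a/2) *
        (t1 / (sqrt (pi * w) * c)) * (t1 * \<bar>x\<bar> / (2 * c * sqrt w)) powr (a/2) *
        bessel_K (- a/2) (t1 * \<bar>x\<bar> / (c * sqrt w)))"

text \<open>The integration variables \<open>t\<^sub>1, \<dots>, t\<^sub>l\<close> are the coordinates of \<open>\<tau>\<close>;
  \<open>u\<close> extends \<open>\<tau>\<close> by \<open>t\<^sub>l\<^sub>+\<^sub>1 = t\<close>.\<close>
definition iterated_flight_density ::
  "real \<Rightarrow> nat \<Rightarrow> (nat \<Rightarrow> real) \<Rightarrow> real \<Rightarrow> real \<Rightarrow> real \<Rightarrow> real" where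
  "iterated_flight_density c l \<alpha> t v x =
     1 / (Gamma ((\<alpha> 1 + 1) / 2) * Beta (\<alpha> 1 / 2) (v - \<alpha> 1 / 2 + 1)) *
     (LINT \<tau>:(\<Pi>\<^sub>E j\<in>{1..l}. {0<..})|(\<Pi>\<^sub>M j\<in>{1..l}. lborel).
        (let u = \<tau>(l + 1 := t) in
          (\<Prod>j=1..l. u (j+1) powr \<alpha> (j+1) / Gamma (\<alpha> (j+1)) *
             u j powr (\<alpha> (j+1) - 1) * exp (- u (j+1) * u j)) *
          H_fun c (\<alpha> 1) v x (u 1)))"

end

(* For almost every s, the law of the flight at time s given n events is c s Y, where Y has the
   ultraspherical density proportional to (1 - y^2)^(v - 1/2).  Averaging over s turns the flight at
   a fixed time into the endpoint (T, X) of n + 1 complete exponential steps.  In the coordinates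
   T + X and T - X the density of a step is, up to the exponential factor, a product of two Gamma
   densities (m = 0) or a mixture, over a power density, of products of two Levy densities (m = 1);
   both families are convolution semigroups, which gives the n-step density in closed form.
   The law of the iterated Gamma process is a chain of Gamma kernels, by independence.  It remains to
   mix the law of c s Y over a Gamma distributed s, which gives H_fun: this is Kummer's
   transformation U(a, b, z) = z^(1-b) U(1 + a - b, 2 - b, z) combined with the elementary form of
   the Bessel function of order 1/2. *)
theory Submission
  imports Defs
begin

section \<open>Integrals over the half-line\<close>

text \<open>The explicit conditional density is not assumed: it is derived from the event times and
  the angles. For m = 0 a single step has, in p = T + X and q = T - X and up to the exponential
  factor, a density proportional to 1 / sqrt (p q), already a product. For m = 1 it is a multiple of
  sqrt (p q) / (p + q)^2; the factor (p + q)^(-2) is what an integral over a scale r of products exp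
  (- r^2 / (4 p)) exp (- r^2 / (4 q)) with suitable powers produces, and this representation
  survives convolution because the scales of Levy densities add. Conditioning at a given time is
  resolved only up to a null set of times. That suffices, because the iterated Gamma time has a
  density. All computations use nonnegative integrals, where Tonelli and substitution ask for no
  integrability. The statement, however, contains Bochner integrals, whose value is 0 without
  integrability, so finiteness has to be recovered: by explicit bounds for \<open>bessel_K\<close>
  and \<open>H_fun\<close>, and for the integral over t_1, ..., t_l from the total mass being at
  most 1, hence only for almost every x.\<close>

lemma set_nn_integral_SUP:
  fixes f :: "'a \<Rightarrow> ennreal"
  assumes [measurable]: "f \<in> borel_measurable M" and K: "\<And>n. K n \<in> sets M" and "incseq K"
  shows "(\<integral>\<^sup>+x\<in>(\<Union>n::nat. K n). f x \<partial>M) = (SUP n. \<integral>\<^sup>+x\<in>K n. f x \<partial>M)"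
proof -
  have "(\<integral>\<^sup>+x\<in>A. f x \<partial>M) = emeasure (density M f) A" if "A \<in> sets M" for A
    using that by (simp add: emeasure_density)
  moreover have "(\<Union>n. K n) \<in> sets M" using K by auto
  ultimately show ?thesis
    using SUP_emeasure_incseq[of K "density M f"] K \<open>incseq K\<close> by (auto simp: image_subset_iff)
qed

text \<open>Monotone convergence extends the substitution rule for compact intervals: (0, infinity)
  is exhausted by \<open>{a n..b n}\<close>, and by the intermediate value theorem the images are
  again compact intervals, which exhaust \<open>J\<close>.\<close>

lemma nn_integral_subst_incr:
  fixes f :: "real \<Rightarrow> ennreal" and g g' :: "real \<Rightarrow> real"
  assumes [measurable]: "f \<in> borel_measurable borel" "g \<in> borel_measurable borel" "g' \<in> borel_measurable borel"
    and der: "\<And>x. 0 < x \<Longrightarrow> (g has_real_derivative g' x) (at x)"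
    and pos: "\<And>x. 0 < x \<Longrightarrow> 0 < g' x" and cont: "continuous_on {0<..} g'"
    and J: "g ` {0<..} = J"
  shows "(\<integral>\<^sup>+y\<in>J. f y \<partial>lborel) = (\<integral>\<^sup>+x\<in>{0<..}. f (g x) * ennreal (g' x) \<partial>lborel)"
proof -
  define a b where "a n = inverse (real (Suc n))" and "b n = real (Suc n)" for n
  have a0: "0 < a n" for n by (simp add: a_def)
  have ab: "a n \<le> b n" for n
    by (simp add: a_def b_def field_simps)
  have adec: "a m \<le> a n" and binc: "b n \<le> b m" if "n \<le> m" for n m
    using that by (auto simp: a_def b_def field_simps)
  have mono: "g x \<le> g y" if "0 < x" "x \<le> y" for x y
    by (rule DERIV_nonneg_imp_nondecreasing[OF that(2)])
       (meson that(1) der pos less_le_trans less_imp_le)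
  have strict: "g x < g y" if "0 < x" "x < y" for x y
    by (rule DERIV_pos_imp_increasing[OF that(2)]) (meson that(1) der pos less_le_trans)
  have ex: "\<exists>n. a n \<le> x \<and> x \<le> b n" if "0 < x" for x
  proof -
    obtain n where n: "max x (inverse x) < real n" using reals_Archimedean2 by blast
    have "inverse (real (Suc n)) \<le> x"
      using n that by (simp add: field_simps)
    then show ?thesis using n by (intro exI[of _ n]) (auto simp: a_def b_def)
  qed
  have U1: "(\<Union>n. {a n..b n}) = {0<..}"
    using ex a0 by (auto, meson less_le_trans)
  have cg: "isCont g x" if "0 < x" for x using der[OF that] DERIV_isCont by blast
  have img: "g ` {a n..b n} = {g (a n)..g (b n)}" for n
  proof (rule antisym)
    show "g ` {a n..b n} \<subseteq> {g (a n)..g (b n)}" using mono a0[of n] by auto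
    show "{g (a n)..g (b n)} \<subseteq> g ` {a n..b n}"
    proof
      fix y assume "y \<in> {g (a n)..g (b n)}"
      then obtain x where "a n \<le> x" "x \<le> b n" "g x = y"
        using IVT[of g "a n" y "b n"] cg a0[of n] ab[of n] by (force)
      then show "y \<in> g ` {a n..b n}" by auto
    qed
  qed
  have U2: "(\<Union>n. {g (a n)..g (b n)}) = J"
    unfolding img[symmetric] J[symmetric] U1[symmetric] by blast
  have inc1: "incseq (\<lambda>n. {a n..b n})"
    using adec binc by (auto simp: incseq_def dest: order_trans)
  then have inc2: "incseq (\<lambda>n. {g (a n)..g (b n)})"
    unfolding img[symmetric] incseq_def by (meson image_mono)
  have "(\<integral>\<^sup>+y\<in>J. f y \<partial>lborel) = (SUP n. \<integral>\<^sup>+y\<in>{g (a n)..g (b n)}. f y \<partial>lborel)"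
    unfolding U2[symmetric]
    by (rule set_nn_integral_SUP[OF _ _ inc2]) auto
  also have "\<dots> = (SUP n. \<integral>\<^sup>+x\<in>{a n..b n}. f (g x) * ennreal (g' x) \<partial>lborel)"
  proof (rule SUP_cong[OF refl])
    fix n
    show "(\<integral>\<^sup>+y\<in>{g (a n)..g (b n)}. f y \<partial>lborel) = (\<integral>\<^sup>+x\<in>{a n..b n}. f (g x) * ennreal (g' x) \<partial>lborel)"
    \<comment> \<open>For n = 0 both end points are 1, and both sides are integrals over a single
      point.\<close>
    proof (cases "a n = b n")
      case True
      then show ?thesis by (simp add: nn_integral_null_set)
    next
      case False
      with ab[of n] have "a n < b n" by simp
      moreover have "0 < x" if "x \<in> {a n..b n}" for x using that a0[of n] by simp
      ultimately show ?thesis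
        by (intro nn_integral_substitution_aux der less_imp_le[OF pos] continuous_on_subset[OF cont]) auto
    qed
  qed
  also have "\<dots> = (\<integral>\<^sup>+x\<in>{0<..}. f (g x) * ennreal (g' x) \<partial>lborel)"
    unfolding U1[symmetric]
    by (rule set_nn_integral_SUP[OF _ _ inc1, symmetric]) auto
  finally show ?thesis .
qed

lemma nn_integral_reflect:
  fixes f :: "real \<Rightarrow> ennreal"
  assumes [measurable]: "f \<in> borel_measurable borel"
  shows "(\<integral>\<^sup>+y. f (- y) \<partial>lborel) = (\<integral>\<^sup>+y. f y \<partial>lborel)"
  using nn_integral_real_affine[of f "-1" 0] by simp

text \<open>Reflecting the target axis reduces this to the increasing function \<open>- g\<close>.
  Here \<open>g'\<close> is the positive Jacobian, that is, minus the derivative of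
  \<open>g\<close>.\<close>

lemma nn_integral_subst_decr:
  fixes f :: "real \<Rightarrow> ennreal" and g g' :: "real \<Rightarrow> real"
  assumes [measurable]: "f \<in> borel_measurable borel" "g \<in> borel_measurable borel" "g' \<in> borel_measurable borel"
    and der: "\<And>x. 0 < x \<Longrightarrow> (g has_real_derivative - g' x) (at x)"
    and pos: "\<And>x. 0 < x \<Longrightarrow> 0 < g' x" and cont: "continuous_on {0<..} g'"
    and J: "g ` {0<..} = J" and [measurable]: "J \<in> sets borel"
  shows "(\<integral>\<^sup>+y\<in>J. f y \<partial>lborel) = (\<integral>\<^sup>+x\<in>{0<..}. f (g x) * ennreal (g' x) \<partial>lborel)"
proof -
  have "(\<integral>\<^sup>+y\<in>J. f y \<partial>lborel) = (\<integral>\<^sup>+y. f (- y) * indicator J (- y) \<partial>lborel)"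
    by (rule nn_integral_reflect[symmetric]) simp
  also have "\<dots> = (\<integral>\<^sup>+y\<in>uminus ` J. f (- y) \<partial>lborel)"
    by (rule nn_integral_cong) (auto simp: indicator_def, metis image_iff minus_minus)
  also have "\<dots> = (\<integral>\<^sup>+x\<in>{0<..}. f (- (- g x)) * ennreal (g' x) \<partial>lborel)"
    using der by (intro nn_integral_subst_incr) 
      (auto intro!: pos cont derivative_eq_intros simp: J[symmetric] image_image)
  finally show ?thesis by simp
qed

lemma set_nn_integral_swap:
  fixes f :: "real \<Rightarrow> real \<Rightarrow> ennreal"
  assumes [measurable]: "case_prod f \<in> borel_measurable (borel \<Otimes>\<^sub>M borel)" "A \<in> sets borel" "B \<in> sets borel"
  shows "(\<integral>\<^sup>+x\<in>A. (\<integral>\<^sup>+y\<in>B. f x y \<partial>lborel) \<partial>lborel) = (\<integral>\<^sup>+y\<in>B. (\<integral>\<^sup>+x\<in>A. f x y \<partial>lborel) \<partial>lborel)"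
proof -
  have "(\<integral>\<^sup>+x\<in>A. (\<integral>\<^sup>+y\<in>B. f x y \<partial>lborel) \<partial>lborel) = (\<integral>\<^sup>+x. (\<integral>\<^sup>+y. f x y * indicator B y * indicator A x \<partial>lborel) \<partial>lborel)"
    by (intro nn_integral_cong nn_integral_multc[symmetric]) simp
  also have "\<dots> = (\<integral>\<^sup>+y. (\<integral>\<^sup>+x. f x y * indicator B y * indicator A x \<partial>lborel) \<partial>lborel)"
    by (rule lborel_pair.Fubini') simp
  also have "\<dots> = (\<integral>\<^sup>+y\<in>B. (\<integral>\<^sup>+x\<in>A. f x y \<partial>lborel) \<partial>lborel)"
    by (subst nn_integral_multc[symmetric]) (auto intro!: nn_integral_cong simp: ac_simps)
  finally show ?thesis .
qed

lemma set_nn_integral_cmult: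
  fixes f :: "'a \<Rightarrow> ennreal"
  assumes [measurable]: "f \<in> borel_measurable M" "A \<in> sets M"
  shows "(\<integral>\<^sup>+x\<in>A. c * f x \<partial>M) = c * (\<integral>\<^sup>+x\<in>A. f x \<partial>M)"
  by (subst nn_integral_cmult[symmetric]) (auto simp: mult.assoc)

lemma nn_integral_pos_cong:
  fixes f g :: "real \<Rightarrow> ennreal"
  assumes "\<And>z. 0 < z \<Longrightarrow> f z = g z"
  shows "(\<integral>\<^sup>+z\<in>{0<..}. f z \<partial>lborel) = (\<integral>\<^sup>+z\<in>{0<..}. g z \<partial>lborel)"
  by (rule set_nn_integral_cong) (auto simp: assms)

lemma image_square: "(\<lambda>u::real. u\<^sup>2) ` {0<..} = {0<..}"
proof -
  have "y \<in> (\<lambda>u. u\<^sup>2) ` {0<..}" if "0 < y" for y :: real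
    using that by (intro image_eqI[of _ _ "sqrt y"]) auto
  then show ?thesis by auto
qed

lemma nn_integral_scale:
  fixes f :: "real \<Rightarrow> ennreal"
  assumes [measurable]: "f \<in> borel_measurable borel" and b: "0 < b"
  shows "(\<integral>\<^sup>+x\<in>{0<..}. f x \<partial>lborel) = ennreal b * (\<integral>\<^sup>+x\<in>{0<..}. f (b * x) \<partial>lborel)"
  using b nn_integral_real_affine[of "\<lambda>x. f x * indicator {0<..} x" b 0]
  by (simp add: indicator_def zero_less_mult_iff cong: if_cong)

lemma nn_integral_Gamma:
  fixes a b :: real
  assumes "0 < a" "0 < b"
  shows "(\<integral>\<^sup>+t\<in>{0<..}. ennreal (t powr (a - 1) * exp (- (b * t))) \<partial>lborel) = ennreal (Gamma a / b powr a)"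
proof -
  let ?I = "\<integral>\<^sup>+t\<in>{0<..}. ennreal (t powr (a - 1) * exp (- (b * t))) \<partial>lborel"
  have AE0: "AE t in lborel. t \<noteq> (0::real)" by (rule AE_lborel_singleton)
  have *: "(\<integral>\<^sup>+t\<in>{0<..}. ennreal (t powr (a - 1) * exp (- t)) \<partial>lborel) = ennreal (Gamma a)"
    unfolding Gamma_conv_nn_integral_real[OF \<open>0 < a\<close>]
    using AE0 by (intro nn_integral_cong_AE) (auto elim!: eventually_mono simp: indicator_def exp_minus field_simps)
  have "ennreal (Gamma a) = ennreal b * (\<integral>\<^sup>+t\<in>{0<..}. ennreal ((b * t) powr (a - 1) * exp (- (b * t))) \<partial>lborel)"
    using * nn_integral_scale[of "\<lambda>t. ennreal (t powr (a - 1) * exp (- t))" b] assms by simp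
  also have "(\<integral>\<^sup>+t\<in>{0<..}. ennreal ((b * t) powr (a - 1) * exp (- (b * t))) \<partial>lborel)
     = (\<integral>\<^sup>+t\<in>{0<..}. ennreal (b powr (a - 1)) * ennreal (t powr (a - 1) * exp (- (b * t))) \<partial>lborel)"
    using assms by (intro set_nn_integral_cong) (auto simp: powr_mult ennreal_mult'[symmetric] ac_simps)
  also have "\<dots> = ennreal (b powr (a - 1)) * ?I"
    by (rule set_nn_integral_cmult) auto
  finally have "ennreal (Gamma a) = ennreal (b powr a) * ?I"
    using assms by (simp add: mult.assoc[symmetric] ennreal_mult'[symmetric] powr_mult_base)
  then have "ennreal (1 / b powr a) * ennreal (Gamma a) = ennreal (1 / b powr a * b powr a) * ?I"
    by (simp add: mult.assoc[symmetric] ennreal_mult'[symmetric])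
  then show ?thesis using assms by (simp add: ennreal_mult'[symmetric])
qed

section \<open>Gaussian, Cauchy-Schloemilch and Kummer integrals\<close>

lemma nn_integral_gaussian: "(\<integral>\<^sup>+x. ennreal (exp (- (x::real)\<^sup>2)) \<partial>lborel) = ennreal (sqrt pi)"
proof -
  have "has_bochner_integral lborel (\<lambda>x::real. exp (- x\<^sup>2)) (2 *\<^sub>R (sqrt pi / 2))"
    by (rule has_bochner_integral_even_function[OF gaussian_moment_0]) simp
  then show ?thesis
    by (simp add: has_bochner_integral_iff nn_integral_eq_integral)
qed

text \<open>The Cauchy--Schloemilch substitution \<open>y = A u - B / u\<close>, with \<open>z = u\<^sup>2\<close>.\<close>
lemma nn_integral_cauchy_schloemilch:
  fixes A B :: real
  assumes A: "0 < A" and B: "0 < B"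
  shows "(\<integral>\<^sup>+z\<in>{0<..}. ennreal (z powr (-1/2) * exp (- (A\<^sup>2 * z) - B\<^sup>2 / z)) \<partial>lborel)
    = ennreal (sqrt pi / A * exp (- 2 * A * B))"
proof -
  define g where "g u = exp (- (A * u - B / u)\<^sup>2)" for u
  have [measurable]: "g \<in> borel_measurable borel" unfolding g_def by measurable
  have g0: "0 \<le> g u" for u by (simp add: g_def)
  define I where "I = (\<integral>\<^sup>+u\<in>{0<..}. ennreal (A * g u) \<partial>lborel)"
  \<comment> \<open>The involution \<open>u -> B / (A * u)\<close> exchanges \<open>A * u\<close>
    and \<open>B / u\<close>, so it preserves \<open>g\<close>. Adding the two forms of
    \<open>I\<close> gives the weight \<open>A + B / u^2\<close>, which is the derivative of
    \<open>A * u - B / u\<close>, and what remains is the Gaussian integral over the whole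
    line.\<close>
  have I': "I = (\<integral>\<^sup>+u\<in>{0<..}. ennreal (B / u\<^sup>2 * g u) \<partial>lborel)"
  proof -
    have img: "(\<lambda>u. B / (A * u)) ` {0<..} = {0<..}"
    proof -
      have "y \<in> (\<lambda>u. B / (A * u)) ` {0<..}" if "0 < y" for y
        using A B that by (intro image_eqI[of _ _ "B / (A * y)"]) auto
      then show ?thesis using A B by auto
    qed
    have "I = (\<integral>\<^sup>+u\<in>{0<..}. ennreal (A * g (B / (A * u))) * ennreal (B / (A * u\<^sup>2)) \<partial>lborel)"
      unfolding I_def
      by (rule nn_integral_subst_decr[OF _ _ _ _ _ _ img])
         (use A B in \<open>auto intro!: derivative_eq_intros continuous_intros simp: power2_eq_square field_simps\<close>)
    also have "\<dots> = (\<integral>\<^sup>+u\<in>{0<..}. ennreal (B / u\<^sup>2 * g u) \<partial>lborel)"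
    proof (rule nn_integral_pos_cong)
      fix u :: real assume u: "0 < u"
      have "(A * (B / (A * u)) - B / (B / (A * u)))\<^sup>2 = (A * u - B / u)\<^sup>2"
        using u A B by (subst power2_commute) simp
      then have "g (B / (A * u)) = g u" by (simp add: g_def)
      then show "ennreal (A * g (B / (A * u))) * ennreal (B / (A * u\<^sup>2)) = ennreal (B / u\<^sup>2 * g u)"
        using A B u g0[of u] by (simp add: ennreal_mult'[symmetric])
    qed
    finally show ?thesis .
  qed
  have "2 * I = (\<integral>\<^sup>+u\<in>{0<..}. ennreal (A * g u) + ennreal (B / u\<^sup>2 * g u) \<partial>lborel)"
    by (simp only: distrib_right) (subst nn_integral_add, measurable, simp only: I_def[symmetric] I'[symmetric] mult_2)
  also have "\<dots> = (\<integral>\<^sup>+u\<in>{0<..}. ennreal (exp (- (A * u - B / u)\<^sup>2)) * ennreal (A + B / u\<^sup>2) \<partial>lborel)"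
    using A B by (intro set_nn_integral_cong) (auto simp: g_def ennreal_mult'[symmetric] ennreal_plus[symmetric] algebra_simps simp del: ennreal_plus)
  also have "\<dots> = (\<integral>\<^sup>+y\<in>UNIV. ennreal (exp (- y\<^sup>2)) \<partial>lborel)"
  proof (rule nn_integral_subst_incr[symmetric])
    show "(\<lambda>u. A * u - B / u) ` {0<..} = UNIV"
    proof -
      have "y \<in> (\<lambda>u. A * u - B / u) ` {0<..}" for y
      proof (rule image_eqI)
        \<comment> \<open>The preimage of y is the positive root of
          \<open>A * u^2 - y * u - B = 0\<close>.\<close>
        define D where "D = sqrt (y\<^sup>2 + 4 * A * B)"
        have "\<bar>y\<bar> < D" unfolding D_def using A B by (intro real_less_rsqrt) (auto)
        then have D: "0 < y + D" by linarith
        have D2: "D * D = y * y + 4 * A * B" using A B by (simp add: D_def power2_eq_square)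
        show "(y + D) / (2 * A) \<in> {0<..}" using D A by simp
        define E where "E = y + D"
        have E: "0 < E" "E * E = 2 * y * E + 4 * A * B" using D D2 by (auto simp: E_def algebra_simps)
        have "A * (E / (2 * A)) = E / 2" "B / (E / (2 * A)) = 2 * A * B / E" using A by simp_all
        then have "A * (E / (2 * A)) - B / (E / (2 * A)) = (E * E - 4 * A * B) / (2 * E)"
          using E(1) by (simp only:) (simp add: diff_divide_distrib)
        also have "\<dots> = y" using E by simp
        finally show "y = A * ((y + D) / (2 * A)) - B / ((y + D) / (2 * A))" by (simp add: E_def)
      qed
      then show ?thesis by auto
    qed
  qed (use A B in \<open>auto intro!: derivative_eq_intros continuous_intros add_pos_pos simp: power2_eq_square field_simps\<close>)
  finally have 2: "2 * I = ennreal (sqrt pi)" by (simp add: nn_integral_gaussian)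
  have I: "I = ennreal (sqrt pi / 2)"
  proof (cases I)
    case (real i)
    then have "ennreal (2 * i) = ennreal (sqrt pi)" using 2 by (simp add: ennreal_mult')
    with real show ?thesis by simp
  qed (use 2 in \<open>simp add: ennreal_mult_top\<close>)
  have "(\<integral>\<^sup>+z\<in>{0<..}. ennreal (z powr (-1/2) * exp (- (A\<^sup>2 * z) - B\<^sup>2 / z)) \<partial>lborel)
    = (\<integral>\<^sup>+u\<in>{0<..}. ennreal ((u\<^sup>2) powr (-1/2) * exp (- (A\<^sup>2 * u\<^sup>2) - B\<^sup>2 / u\<^sup>2)) * ennreal (2 * u) \<partial>lborel)"
    by (rule nn_integral_subst_incr[OF _ _ _ _ _ _ image_square])
       (auto intro!: derivative_eq_intros continuous_intros)
  also have "\<dots> = (\<integral>\<^sup>+u\<in>{0<..}. ennreal (2 / A * exp (- 2 * A * B)) * ennreal (A * g u) \<partial>lborel)"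
  proof (rule nn_integral_pos_cong)
    fix u :: real assume u: "0 < u"
    have 1: "(u\<^sup>2) powr (-1/2) = 1 / u"
      using u by (simp add: powr_powr powr_minus_divide flip: powr_numeral)
    have 2: "exp (- (A\<^sup>2 * u\<^sup>2) - B\<^sup>2 / u\<^sup>2) = exp (- 2 * A * B) * g u"
      using u unfolding g_def mult_exp_exp by (simp add: power2_diff power_mult_distrib power_divide)
    show "ennreal ((u\<^sup>2) powr (-1/2) * exp (- (A\<^sup>2 * u\<^sup>2) - B\<^sup>2 / u\<^sup>2)) * ennreal (2 * u)
       = ennreal (2 / A * exp (- 2 * A * B)) * ennreal (A * g u)"
      unfolding 1 2 using u A g0[of u] by (simp add: ennreal_mult'[symmetric] field_simps)
  qed
  also have "\<dots> = ennreal (2 / A * exp (- 2 * A * B)) * I"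
    unfolding I_def by (rule set_nn_integral_cmult) auto
  finally show ?thesis using A by (simp add: I ennreal_mult'[symmetric] field_simps)
qed

text \<open>The integrals on the two sides are
  \<open>Gamma A * U(A, A - \<gamma> + 1, \<beta>)\<close> and
  \<open>Gamma \<gamma> * U(\<gamma>, \<gamma> - A + 1, \<beta>)\<close>, with U the confluent
  hypergeometric function of the second kind. Writing
  \<open>Gamma \<gamma> * (1 + r) powr (- \<gamma>)\<close> as a Gamma integral over z and
  integrating out r first exchanges the roles of the two exponents; the power of
  \<open>\<beta>\<close> comes from the final rescaling of z by \<open>\<beta>\<close>.\<close>

lemma nn_integral_kummer:
  fixes A \<gamma> \<beta> :: real
  assumes A: "0 < A" and g: "0 < \<gamma>" and b: "0 < \<beta>"
  shows "ennreal (Gamma \<gamma>) * (\<integral>\<^sup>+r\<in>{0<..}. ennreal (r powr (A - 1) * (1 + r) powr (- \<gamma>) * exp (- (\<beta> * r))) \<partial>lborel)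
     = ennreal (Gamma A * \<beta> powr (\<gamma> - A)) * (\<integral>\<^sup>+r\<in>{0<..}. ennreal (r powr (\<gamma> - 1) * (1 + r) powr (- A) * exp (- (\<beta> * r))) \<partial>lborel)"
proof -
  let ?K = "\<lambda>r z. ennreal (r powr (A - 1) * exp (- (\<beta> * r))) * ennreal (z powr (\<gamma> - 1) * exp (- ((1 + r) * z)))"
  let ?l = "\<lambda>r. ennreal (r powr (A - 1) * (1 + r) powr (- \<gamma>) * exp (- (\<beta> * r)))"
  have "ennreal (Gamma \<gamma>) * (\<integral>\<^sup>+r\<in>{0<..}. ?l r \<partial>lborel)
      = (\<integral>\<^sup>+r\<in>{0<..}. ennreal (Gamma \<gamma>) * ?l r \<partial>lborel)"
    by (rule set_nn_integral_cmult[symmetric]) auto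
  also have "\<dots> = (\<integral>\<^sup>+r\<in>{0<..}. (\<integral>\<^sup>+z\<in>{0<..}. ?K r z \<partial>lborel) \<partial>lborel)"
  proof (rule nn_integral_pos_cong)
    fix r :: real assume r: "0 < r"
    have "(\<integral>\<^sup>+z\<in>{0<..}. ?K r z \<partial>lborel)
      = ennreal (r powr (A - 1) * exp (- (\<beta> * r))) * ennreal (Gamma \<gamma> / (1 + r) powr \<gamma>)"
      using r g by (subst set_nn_integral_cmult) (auto simp: nn_integral_Gamma)
    then show "ennreal (Gamma \<gamma>) * ?l r
       = (\<integral>\<^sup>+z\<in>{0<..}. ?K r z \<partial>lborel)"
      using g r by (simp add: ennreal_mult'[symmetric] powr_minus_divide ac_simps)
  qed
  also have "\<dots> = (\<integral>\<^sup>+z\<in>{0<..}. (\<integral>\<^sup>+r\<in>{0<..}. ?K r z \<partial>lborel) \<partial>lborel)"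
    by (rule set_nn_integral_swap) auto
  also have "\<dots> = (\<integral>\<^sup>+z\<in>{0<..}. ennreal (Gamma A * (z powr (\<gamma> - 1) * (\<beta> + z) powr (- A) * exp (- z))) \<partial>lborel)"
  proof (rule nn_integral_pos_cong)
    fix z :: real assume z: "0 < z"
    have "(\<integral>\<^sup>+r\<in>{0<..}. ?K r z \<partial>lborel)
       = (\<integral>\<^sup>+r\<in>{0<..}. ennreal (z powr (\<gamma> - 1) * exp (- z)) * ennreal (r powr (A - 1) * exp (- ((\<beta> + z) * r))) \<partial>lborel)"
      by (rule set_nn_integral_cong) (auto simp: ennreal_mult'[symmetric] algebra_simps exp_diff exp_minus exp_add)
    also have "\<dots> = ennreal (z powr (\<gamma> - 1) * exp (- z)) * ennreal (Gamma A / (\<beta> + z) powr A)"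
      using z b A by (subst set_nn_integral_cmult) (auto simp: nn_integral_Gamma)
    also have "\<dots> = ennreal (Gamma A * (z powr (\<gamma> - 1) * (\<beta> + z) powr (- A) * exp (- z)))"
      using A b z by (simp add: ennreal_mult'[symmetric] powr_minus_divide ac_simps)
    finally show "(\<integral>\<^sup>+r\<in>{0<..}. ?K r z \<partial>lborel)
       = ennreal (Gamma A * (z powr (\<gamma> - 1) * (\<beta> + z) powr (- A) * exp (- z)))" .
  qed
  also have "\<dots> = ennreal \<beta> * (\<integral>\<^sup>+r\<in>{0<..}. ennreal (Gamma A * ((\<beta> * r) powr (\<gamma> - 1) * (\<beta> + \<beta> * r) powr (- A) * exp (- (\<beta> * r)))) \<partial>lborel)"
    by (rule nn_integral_scale) (use b in auto)
  also have "\<dots> = ennreal \<beta> * (\<integral>\<^sup>+r\<in>{0<..}. ennreal (Gamma A * \<beta> powr (\<gamma> - A - 1)) * ennreal (r powr (\<gamma> - 1) * (1 + r) powr (- A) * exp (- (\<beta> * r))) \<partial>lborel)"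
  proof -
    have "Gamma A * ((\<beta> * r) powr (\<gamma> - 1) * (\<beta> + \<beta> * r) powr (- A) * exp (- (\<beta> * r)))
       = Gamma A * \<beta> powr (\<gamma> - A - 1) * (r powr (\<gamma> - 1) * (1 + r) powr (- A) * exp (- (\<beta> * r)))" if "0 < r" for r
    proof -
      have "\<beta> + \<beta> * r = \<beta> * (1 + r)" by (simp add: algebra_simps)
      moreover have "\<beta> powr (\<gamma> - A - 1) = \<beta> powr (\<gamma> - 1) * \<beta> powr (- A)" by (simp add: algebra_simps flip: powr_add)
      ultimately show ?thesis using that b by (simp add: powr_mult ac_simps)
    qed
    then show ?thesis using A by (intro arg_cong[where f="\<lambda>x. ennreal \<beta> * x"] set_nn_integral_cong) (auto simp: ennreal_mult'[symmetric])
  qed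
  also have "\<dots> = ennreal (Gamma A * \<beta> powr (\<gamma> - A)) * (\<integral>\<^sup>+r\<in>{0<..}. ennreal (r powr (\<gamma> - 1) * (1 + r) powr (- A) * exp (- (\<beta> * r))) \<partial>lborel)"
  proof -
    have k: "\<beta> * Gamma A * \<beta> powr (\<gamma> - A - 1) = Gamma A * \<beta> powr (\<gamma> - A)"
      using b powr_mult_base[of \<beta> "\<gamma> - A - 1"] by (simp add: mult.commute mult.left_commute)
    then show ?thesis
      by (subst set_nn_integral_cmult, measurable)
         (simp only: mult.assoc[symmetric] ennreal_mult'[OF less_imp_le[OF b], symmetric] k)
  qed
  finally show ?thesis .
qed

section \<open>Mixing the ultraspherical law over a Gamma law\<close>

lemma nn_integral_kummer':
  fixes A \<gamma> \<beta> :: real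
  assumes A: "0 < A" and g: "0 < \<gamma>" and b: "0 < \<beta>"
  shows "(\<integral>\<^sup>+r\<in>{0<..}. ennreal (r powr (\<gamma> - 1) * (1 + r) powr (- A) * exp (- (\<beta> * r))) \<partial>lborel)
     = ennreal (Gamma \<gamma> / Gamma A * \<beta> powr (A - \<gamma>)) * (\<integral>\<^sup>+r\<in>{0<..}. ennreal (r powr (A - 1) * (1 + r) powr (- \<gamma>) * exp (- (\<beta> * r))) \<partial>lborel)"
    (is "?L = _ * ?R")
proof -
  have GA: "0 < Gamma A" "0 < Gamma \<gamma>" using A g by auto
  have "ennreal (1 / Gamma A) * (ennreal (Gamma A) * ?L) = ennreal (1 / Gamma A) * (ennreal (Gamma \<gamma> * \<beta> powr (A - \<gamma>)) * ?R)"
    using nn_integral_kummer[OF g A b] by simp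
  then show ?thesis
    using GA unfolding mult.assoc[symmetric] by (simp add: ennreal_mult'[symmetric])
qed

text \<open>With x = c s y, the conditional density at time s is
  \<open>ultraspherical v (x / (c * s)) / (c * s)\<close>. Legendre's duplication formula turns the
  usual constant, with Gamma v / Gamma (2 v), into the present one, which also makes sense at v = 0
  without a convention.\<close>

definition ultraspherical :: "real \<Rightarrow> real \<Rightarrow> real" where
  "ultraspherical v y =
     (if \<bar>y\<bar> < 1 then Gamma (v + 1) / (sqrt pi * Gamma (v + 1/2)) * (1 - y\<^sup>2) powr (v - 1/2) else 0)"

lemma ultraspherical_measurable[measurable]: "ultraspherical v \<in> borel_measurable borel"
  unfolding ultraspherical_def by measurable

lemma gamma_density_measurable[measurable]: "case_prod (gamma_density a) \<in> borel_measurable (borel \<Otimes>\<^sub>M borel)"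
  unfolding gamma_density_def by measurable

text \<open>Transferred from the complex Legendre formula. It settles every comparison of constants
  below: in the Gamma mixture, in the n-step density and in the normalisation.\<close>

lemma Gamma_duplication_real:
  fixes z :: real
  assumes "0 < z"
  shows "Gamma z * Gamma (z + 1/2) = 2 powr (1 - 2 * z) * sqrt pi * Gamma (2 * z)"
proof -
  have "complex_of_real z \<notin> \<int>\<^sub>\<le>\<^sub>0" "complex_of_real z + 1/2 \<notin> \<int>\<^sub>\<le>\<^sub>0"
    using assms by (auto elim!: nonpos_Ints_cases simp: complex_eq_iff)
  from Gamma_legendre_duplication[OF this]
  have "complex_of_real (Gamma z * Gamma (z + 1/2)) = complex_of_real (exp ((1 - 2 * z) * ln 2) * sqrt pi * Gamma (2 * z))"
    using Gamma_complex_of_real[of z] Gamma_complex_of_real[of "z + 1/2"] Gamma_complex_of_real[of "2 * z"]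
    by (simp add: exp_of_real[symmetric])
  then show ?thesis unfolding of_real_eq_iff by (simp add: powr_def)
qed

text \<open>The factor \<open>(X / 2) powr (a/2)\<close>, which also occurs in \<open>H_fun\<close>,
  cancels the power in the definition of the Bessel function of index - a/2 and leaves the bare
  integral.\<close>

lemma bessel_K_nn_integral:
  fixes a X :: real
  assumes "0 < a" "0 < X"
  shows "ennreal ((X / 2) powr (a/2) * bessel_K (- a/2) X)
    = (\<integral>\<^sup>+z\<in>{0<..}. ennreal (1/2 * (z powr (a/2 - 1) * exp (- z - X\<^sup>2 / (4 * z)))) \<partial>lborel)"
    and "0 \<le> bessel_K (- a/2) X"
proof -
  define f where "f z = z powr (a/2 - 1) * exp (- z - X\<^sup>2 / (4 * z))" for z
  let ?I = "\<integral>\<^sup>+z\<in>{0<..}. ennreal (f z) \<partial>lborel"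
  have [measurable]: "f \<in> borel_measurable borel" unfolding f_def by measurable
  have f0: "0 \<le> f z" for z by (simp add: f_def)
  have I: "(LBINT z:{0<..}. exp (- z - X\<^sup>2 / (4 * z)) * z powr (- (- a/2) - 1)) = enn2real ?I"
    unfolding set_lebesgue_integral_def
    by (subst integral_eq_nn_integral) (auto simp: f_def indicator_def ac_simps intro!: arg_cong[where f=enn2real] nn_integral_cong)
  \<comment> \<open>Dropping \<open>X^2 / (4 z)\<close> from the exponent bounds the integral by a
    Gamma integral, so \<open>enn2real\<close> does not lose its value.\<close>
  have "?I \<le> (\<integral>\<^sup>+z\<in>{0<..}. ennreal (z powr (a/2 - 1) * exp (- (1 * z))) \<partial>lborel)"
    by (intro nn_integral_mono) (auto simp: f_def indicator_def intro!: ennreal_leI)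
  also have "\<dots> < \<infinity>" using assms by (subst nn_integral_Gamma) auto
  finally have fin: "?I < \<infinity>" .
  have "(X / 2) powr (a/2) * bessel_K (- a/2) X = 1/2 * enn2real ?I"
    unfolding bessel_K_def I using assms by (simp add: powr_minus_divide)
  then have "ennreal ((X / 2) powr (a/2) * bessel_K (- a/2) X) = ennreal (1/2) * ?I"
    using fin by (simp only:) (subst ennreal_mult', auto)
  also have "\<dots> = (\<integral>\<^sup>+z\<in>{0<..}. ennreal (1/2) * ennreal (f z) \<partial>lborel)"
    by (rule set_nn_integral_cmult[symmetric]) auto
  finally show "ennreal ((X / 2) powr (a/2) * bessel_K (- a/2) X)
    = (\<integral>\<^sup>+z\<in>{0<..}. ennreal (1/2 * (z powr (a/2 - 1) * exp (- z - X\<^sup>2 / (4 * z)))) \<partial>lborel)"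
    by (simp only: ennreal_mult'[of "1/2", symmetric] f_def[symmetric] zero_le_divide_1_iff zero_le_numeral)
  show "0 \<le> bessel_K (- a/2) X" unfolding bessel_K_def I by simp
qed

lemma bessel_K_measurable[measurable]: "bessel_K \<mu> \<in> borel_measurable borel"
  unfolding bessel_K_def set_lebesgue_integral_def by measurable

lemma nn_integral_Beta_less_top:
  fixes a b :: real
  assumes "0 < a" "0 < b"
  shows "(\<integral>\<^sup>+w\<in>{0<..<1}. ennreal (w powr (a - 1) * (1 - w) powr (b - 1)) \<partial>lborel) < \<infinity>"
proof -
  have "(\<integral>\<^sup>+w\<in>{0<..<1}. ennreal (w powr (a - 1) * (1 - w) powr (b - 1)) \<partial>lborel)
     \<le> (\<integral>\<^sup>+w\<in>{0..1}. ennreal (w powr (a - 1) * (1 - w) powr (b - 1)) \<partial>lborel)"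
    by (intro nn_integral_mono) (auto simp: indicator_def)
  also have "\<dots> = ennreal (Beta a b)"
    by (rule nn_integral_has_integral_lebesgue'[OF _ has_integral_Beta_real[OF assms]]) auto
  finally show ?thesis using order_le_less_trans by fastforce
qed

text \<open>This is sqrt y <= exp y, inverted. Half a power is the right amount for the kernel
  below: it improves \<open>w powr ((a - 3) / 2)\<close> to \<open>w powr (a/2 - 1)\<close>, which
  is integrable at 0 for every positive a.\<close>

lemma exp_minus_le_powr:
  fixes y :: real
  assumes "0 < y"
  shows "exp (- y) \<le> y powr (-1/2)"
proof -
  have "y \<le> exp (2 * y)" using exp_ge_add_one_self[of "2 * y"] assms by linarith
  then have "y powr (1/2) \<le> exp (2 * y) powr (1/2)" using assms by (intro powr_mono2) auto
  also have "exp (2 * y) powr (1/2) = exp y" by (simp add: powr_def)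
  finally have "inverse (exp y) \<le> inverse (y powr (1/2))" using assms by (intro le_imp_inverse_le) auto
  then show ?thesis by (simp add: exp_minus powr_minus)
qed


lemma image_one_over_one_plus: "(\<lambda>r::real. 1 / (1 + r)) ` {0<..} = {0<..<1}"
proof -
  have "y \<in> (\<lambda>r. 1 / (1 + r)) ` {0<..}" if "0 < y" "y < 1" for y :: real
    using that by (intro image_eqI[of _ _ "1 / y - 1"]) auto
  then show ?thesis by auto
qed

lemma image_scale_sqrt:
  fixes d :: real
  assumes "0 < d"
  shows "(\<lambda>r. d * sqrt (1 + r)) ` {0<..} = {d<..}"
proof -
  have "y \<in> (\<lambda>r. d * sqrt (1 + r)) ` {0<..}" if "d < y" for y :: real
  proof (rule image_eqI)
    have y: "0 < y" using that assms by simp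
    show "y = d * sqrt (1 + ((y / d)\<^sup>2 - 1))" using assms y by (simp add: real_sqrt_divide)
    have "1 < (y / d)\<^sup>2" using that assms by (intro one_less_power) auto
    then show "(y / d)\<^sup>2 - 1 \<in> {0<..}" by simp
  qed
  then show ?thesis using assms by auto
qed

section \<open>Evaluation of \<open>H_fun\<close> as a mixture of ultraspherical laws\<close>

context
  fixes c a v x b :: real
  assumes c: "0 < c" and a: "0 < a" and v0: "0 \<le> v" and v: "a / 2 - 1 < v" and x: "x \<noteq> 0" and b: "0 < b"
begin

text \<open>Here b stands for the variable t_1, and \<open>rate / w\<close> is a quarter of the
  square of the Bessel argument in \<open>H_fun\<close>.\<close>

definition "rate = (b * x / (2 * c))\<^sup>2"
text \<open>This is the integrand of \<open>H_fun\<close> once the Bessel function is replaced by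
  its integral over z. The prefactor 1 / sqrt w lowers the exponent a/2 - 1 of w to (a -
  3)/2.\<close>

definition "H_kernel w z = b / (2 * c * sqrt pi) * (w powr ((a - 3) / 2) * (1 - w) powr (v - a/2) * (z powr (a/2 - 1) * exp (- z - rate / (w * z))))"
definition "H_integrand w = w powr (a/2 - 1) * (1 - w) powr (v - a/2) * (b / (sqrt (pi * w) * c)) *
   (b * \<bar>x\<bar> / (2 * c * sqrt w)) powr (a/2) * bessel_K (- a/2) (b * \<bar>x\<bar> / (c * sqrt w))"

lemma rate_pos: "0 < rate"
  using c x b by (simp add: rate_def)

lemma H_kernel_measurable[measurable]: "case_prod H_kernel \<in> borel_measurable (borel \<Otimes>\<^sub>M borel)"
  unfolding H_kernel_def by measurable

lemma H_integrand_nonneg: "0 < w \<Longrightarrow> w < 1 \<Longrightarrow> 0 \<le> H_integrand w"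
  using c x b bessel_K_nn_integral(2)[OF a, of "b * \<bar>x\<bar> / (c * sqrt w)"]
  by (simp add: H_integrand_def)

lemma H_integrand_eq:
  assumes w: "0 < w" "w < 1"
  shows "ennreal (H_integrand w) = (\<integral>\<^sup>+z\<in>{0<..}. ennreal (H_kernel w z) \<partial>lborel)"
proof -
  define C where "C = w powr (a/2 - 1) * (1 - w) powr (v - a/2) * (b / (sqrt (pi * w) * c))"
  have C0: "0 \<le> C" using w b c by (simp add: C_def)
  define X where "X = b * \<bar>x\<bar> / (c * sqrt w)"
  have X: "0 < X" using w b c x by (simp add: X_def)
  have X2: "b * \<bar>x\<bar> / (2 * c * sqrt w) = X / 2" by (simp add: X_def)
  have "ennreal (H_integrand w) = ennreal C * ennreal ((X / 2) powr (a/2) * bessel_K (- a/2) X)"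
    unfolding H_integrand_def X2 X_def[symmetric] C_def[symmetric] using C0 by (simp add: ennreal_mult'[symmetric] mult.assoc)
  also have "\<dots> = (\<integral>\<^sup>+z\<in>{0<..}. ennreal C * ennreal (1/2 * (z powr (a/2 - 1) * exp (- z - X\<^sup>2 / (4 * z)))) \<partial>lborel)"
    unfolding bessel_K_nn_integral(1)[OF a X] by (rule set_nn_integral_cmult[symmetric]) auto
  also have "\<dots> = (\<integral>\<^sup>+z\<in>{0<..}. ennreal (H_kernel w z) \<partial>lborel)"
  proof (rule nn_integral_pos_cong)
    fix z :: real assume z: "0 < z"
    have "X\<^sup>2 = 4 * rate / w" using w by (simp add: X_def rate_def power_divide power_mult_distrib)
    then have e: "X\<^sup>2 / (4 * z) = rate / (w * z)" by simp
    have "(a - 3) / 2 = (a/2 - 1) + -1/2" by (simp add: field_simps)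
    then have "w powr ((a - 3) / 2) = w powr (a/2 - 1) * w powr (-1/2)"
      by (metis powr_add)
    also have "w powr (-1/2) = 1 / sqrt w" using w by (simp add: powr_minus_divide powr_half_sqrt)
    finally have e2: "w powr (a/2 - 1) = w powr ((a - 3) / 2) * sqrt w" using w by simp
    have "C * (1/2 * (z powr (a/2 - 1) * exp (- z - rate / (w * z)))) = H_kernel w z"
      unfolding C_def H_kernel_def e2 using w c by (simp add: real_sqrt_mult field_simps)
    then show "ennreal C * ennreal (1/2 * (z powr (a/2 - 1) * exp (- z - X\<^sup>2 / (4 * z)))) = ennreal (H_kernel w z)"
      unfolding e ennreal_mult'[OF C0, symmetric] by simp
  qed
  finally show ?thesis .
qed

definition "H_mass = (\<integral>\<^sup>+w\<in>{0<..<1}. (\<integral>\<^sup>+z\<in>{0<..}. ennreal (H_kernel w z) \<partial>lborel) \<partial>lborel)"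

text \<open>For a <= 1 the power of w alone is not integrable at 0, so the exponential must help.
  The bound separates the variables into a Beta integral with parameters a/2 and v - a/2 + 1 and the
  Gamma integral for (a + 1)/2. The hypothesis \<open>a / 2 - 1 < v\<close> makes the second Beta
  parameter positive.\<close>

lemma H_mass_finite: "H_mass < \<infinity>"
proof -
  let ?p = "\<lambda>w. w powr (a/2 - 1) * (1 - w) powr (v - a/2 + 1 - 1)"
  let ?q = "\<lambda>z. z powr ((a + 1)/2 - 1) * exp (- (1 * z))"
  define K where "K = b / (2 * c * sqrt pi) * rate powr (-1/2)"
  have K: "0 \<le> K" using b c by (simp add: K_def)
  have *: "H_kernel w z \<le> K * ?p w * (?q z)"
    if "0 < w" "w < 1" "0 < z" for w z
  proof -
    have "exp (- z - rate / (w * z)) = exp (- z) * exp (- (rate / (w * z)))" by (simp add: exp_add[symmetric])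
    also have "\<dots> \<le> exp (- z) * (rate / (w * z)) powr (-1/2)"
      using that rate_pos by (intro mult_left_mono exp_minus_le_powr) auto
    also have "(rate / (w * z)) powr (-1/2) = rate powr (-1/2) * (w powr (1/2) * z powr (1/2))"
      using that rate_pos by (simp add: powr_divide powr_mult powr_minus_divide)
    finally have "H_kernel w z \<le> b / (2 * c * sqrt pi) * (w powr ((a - 3) / 2) * (1 - w) powr (v - a/2) * (z powr (a/2 - 1) * (exp (- z) * (rate powr (-1/2) * (w powr (1/2) * z powr (1/2))))))"
      unfolding H_kernel_def using b c by (intro mult_left_mono) auto
    also have "\<dots> = K * ((w powr ((a - 3) / 2) * w powr (1/2)) * (1 - w) powr (v - a/2)) * ((z powr (a/2 - 1) * z powr (1/2)) * exp (- z))"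
      by (simp add: K_def ac_simps)
    also have "w powr ((a - 3) / 2) * w powr (1/2) = w powr (a/2 - 1)"
      by (simp add: powr_add[symmetric] field_simps)
    also have "z powr (a/2 - 1) * z powr (1/2) = z powr ((a + 1)/2 - 1)"
      by (simp add: powr_add[symmetric] field_simps)
    finally show ?thesis by simp
  qed
  define Z where "Z = Gamma ((a + 1)/2)"
  have "H_mass \<le> (\<integral>\<^sup>+w\<in>{0<..<1}. (\<integral>\<^sup>+z\<in>{0<..}. ennreal (K * ?p w) * ennreal (?q z) \<partial>lborel) \<partial>lborel)"
    unfolding H_mass_def
  proof (intro nn_integral_mono)
    fix w :: real
    show "(\<integral>\<^sup>+z\<in>{0<..}. ennreal (H_kernel w z) \<partial>lborel) * indicator {0<..<1} w
       \<le> (\<integral>\<^sup>+z\<in>{0<..}. ennreal (K * ?p w) * ennreal (?q z) \<partial>lborel) * indicator {0<..<1} w"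
    proof (cases "0 < w \<and> w < 1")
      case True
      have "ennreal (H_kernel w z) \<le> ennreal (K * ?p w) * ennreal (?q z)" if "0 < z" for z
        using ennreal_leI[OF *[of w z]] True that K by (subst ennreal_mult'[symmetric]) auto
      then show ?thesis
        by (intro mult_right_mono, intro nn_integral_mono) (auto simp: indicator_def)
    qed auto
  qed
  also have "\<dots> = (\<integral>\<^sup>+w\<in>{0<..<1}. ennreal (Z * K) * ennreal (?p w) \<partial>lborel)"
  proof (rule set_nn_integral_cong[OF refl refl])
    fix w :: real
    have "(\<integral>\<^sup>+z\<in>{0<..}. ennreal (K * ?p w) * ennreal (?q z) \<partial>lborel)
       = ennreal (K * ?p w) * ennreal (Z / 1 powr ((a + 1)/2))"
      using a by (subst set_nn_integral_cmult, simp, simp, subst nn_integral_Gamma) (auto simp: Z_def)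
    also have "\<dots> = ennreal (Z * K) * ennreal (?p w)"
      using K a by (simp add: ennreal_mult'[symmetric] Z_def ac_simps)
    finally show "(\<integral>\<^sup>+z\<in>{0<..}. ennreal (K * ?p w) * ennreal (?q z) \<partial>lborel)
      = ennreal (Z * K) * ennreal (?p w)" .
  qed
  also have "\<dots> = ennreal (Z * K) * (\<integral>\<^sup>+w\<in>{0<..<1}. ennreal (?p w) \<partial>lborel)"
    by (rule set_nn_integral_cmult) auto
  also have "\<dots> < \<infinity>"
    using nn_integral_Beta_less_top[of "a/2" "v - a/2 + 1"] a v by (simp add: ennreal_mult_less_top)
  finally show ?thesis .
qed

text \<open>The integrand is nonnegative, so the Bochner integral is \<open>enn2real\<close> of the
  double integral, and finiteness of the latter makes this conversion faithful.\<close>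

lemma H_fun_eq_H_mass: "ennreal (H_fun c a v x b) = H_mass" and H_fun_nonneg: "0 \<le> H_fun c a v x b"
proof -
  have [measurable]: "H_integrand \<in> borel_measurable borel" unfolding H_integrand_def by measurable
  have H: "H_fun c a v x b = enn2real (\<integral>\<^sup>+w\<in>{0<..<1}. ennreal (H_integrand w) \<partial>lborel)"
    unfolding H_fun_def set_lebesgue_integral_def H_integrand_def[symmetric]
    by (subst integral_eq_nn_integral) (auto simp: indicator_def H_integrand_nonneg intro!: arg_cong[where f=enn2real] nn_integral_cong)
  have eq: "(\<integral>\<^sup>+w\<in>{0<..<1}. ennreal (H_integrand w) \<partial>lborel) = H_mass"
    unfolding H_mass_def by (rule set_nn_integral_cong[OF refl refl]) (auto simp: H_integrand_eq)
  show "ennreal (H_fun c a v x b) = H_mass" unfolding H eq using H_mass_finite by simp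
  show "0 \<le> H_fun c a v x b" unfolding H by simp
qed

text \<open>Integrating out \<open>w\<close> first (with \<open>w = 1 / (1 + r)\<close>), Kummer's transformation makes the
  \<open>z\<close>-integral a Cauchy--Schloemilch integral; the remaining \<open>r\<close>-integral is the one over
  \<open>s = \<bar>x\<bar> / c * sqrt (1 + r)\<close>.\<close>
lemma gamma_ultraspherical_mixture:
  "(\<integral>\<^sup>+s\<in>{0<..}. ennreal (gamma_density a b s * (ultraspherical v (x / (c * s)) / (c * s))) \<partial>lborel)
    = ennreal (1 / (Gamma ((a + 1)/2) * Beta (a/2) (v - a/2 + 1)) * H_fun c a v x b)"
proof -
  define A \<gamma> where "A = v + 1/2" and "\<gamma> = v - a/2 + 1"
  have A: "0 < A" and g: "0 < \<gamma>" using v v0 by (auto simp: A_def \<gamma>_def)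
  have GA: "0 < Gamma A" "0 < Gamma \<gamma>" using A g by auto
  define L where "L = b / (2 * c * sqrt pi) * (Gamma \<gamma> / Gamma A * rate powr ((a - 1)/2))"
  have L0: "0 \<le> L" using GA b c by (simp add: L_def)
  define R where "R r = r powr (A - 1) * (1 + r) powr (- \<gamma>)" for r :: real
  have [measurable]: "R \<in> borel_measurable borel" unfolding R_def by measurable
  have R0: "0 \<le> R r" for r by (simp add: R_def)
  let ?V = "\<lambda>z r. r powr (\<gamma> - 1) * (1 + r) powr (- A) * exp (- (rate / z * r))"
  let ?W = "\<lambda>z r. L * R r * (z powr (-1/2) * exp (- z - rate * (1 + r) / z))"
  let ?Q = "\<lambda>r. L * sqrt pi * (R r * exp (- (b * \<bar>x\<bar> / c * sqrt (1 + r))))"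
  have "H_mass = (\<integral>\<^sup>+z\<in>{0<..}. (\<integral>\<^sup>+w\<in>{0<..<1}. ennreal (H_kernel w z) \<partial>lborel) \<partial>lborel)"
    unfolding H_mass_def by (rule set_nn_integral_swap) auto
  also have "\<dots> = (\<integral>\<^sup>+z\<in>{0<..}. (\<integral>\<^sup>+r\<in>{0<..}. ennreal (?W z r) \<partial>lborel) \<partial>lborel)"
  proof (rule nn_integral_pos_cong)
    fix z :: real assume z: "0 < z"
    define D where "D = b / (2 * c * sqrt pi) * (z powr (a/2 - 1) * exp (- z - rate / z))"
    have D0: "0 \<le> D" using b c by (simp add: D_def)
    have "(\<integral>\<^sup>+w\<in>{0<..<1}. ennreal (H_kernel w z) \<partial>lborel) = (\<integral>\<^sup>+r\<in>{0<..}. ennreal (H_kernel (1 / (1 + r)) z) * ennreal (1 / (1 + r)\<^sup>2) \<partial>lborel)"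
      by (rule nn_integral_subst_decr[OF _ _ _ _ _ _ image_one_over_one_plus])
         (auto intro!: derivative_eq_intros continuous_intros simp: power2_eq_square)
    also have "\<dots> = (\<integral>\<^sup>+r\<in>{0<..}. ennreal D * ennreal (?V z r) \<partial>lborel)"
    proof (rule nn_integral_pos_cong)
      fix r :: real assume r: "0 < r"
      have 1: "1 - 1 / (1 + r) = r / (1 + r)" using r by (simp add: field_simps)
      have 2: "- z - rate / (1 / (1 + r) * z) = (- z - rate / z) + (- (rate / z * r))" using z r by (simp add: field_simps)
      have 3: "1 / (1 + r)\<^sup>2 = (1 + r) powr (-2)" using r by (simp add: powr_minus_divide)
      have 4: "(1 / (1 + r)) powr ((a - 3) / 2) = (1 + r) powr ((3 - a) / 2)"
        using r by (simp add: powr_divide powr_minus_divide[symmetric] minus_divide_left)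
      have 5: "(r / (1 + r)) powr (v - a/2) = r powr (\<gamma> - 1) * (1 + r) powr (a/2 - v)"
        using r by (simp add: powr_divide \<gamma>_def powr_minus_divide[of _ "v - a/2", simplified])
      have 6: "(1 + r) powr (- A) = (1 + r) powr ((3 - a) / 2) * (1 + r) powr (a/2 - v) * (1 + r) powr (-2)"
        unfolding powr_add[symmetric] by (rule arg_cong[where f="\<lambda>e. (1 + r) powr e"]) (simp add: A_def field_simps)
      have "H_kernel (1 / (1 + r)) z * (1 / (1 + r)\<^sup>2) = D * (?V z r)"
        unfolding H_kernel_def D_def 1 2 3 4 5 6 exp_add by (simp only: ac_simps)
      then show "ennreal (H_kernel (1 / (1 + r)) z) * ennreal (1 / (1 + r)\<^sup>2)
        = ennreal D * ennreal (?V z r)"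
        using D0 by (subst ennreal_mult''[symmetric], simp, subst ennreal_mult'[symmetric]) auto
    qed
    also have "\<dots> = ennreal D * (\<integral>\<^sup>+r\<in>{0<..}. ennreal (?V z r) \<partial>lborel)"
      by (rule set_nn_integral_cmult) auto
    \<comment> \<open>Kummer's transformation has the effect that matters on z: it releases
      \<open>z powr (- ((a - 1)/2))\<close>, so that the total power of z becomes -1/2 for every a.
      That is the exponent of the Cauchy-Schloemilch integral, hence the elementary Bessel
      case.\<close>
    also have "\<dots> = ennreal D * (ennreal (Gamma \<gamma> / Gamma A * (rate / z) powr (A - \<gamma>)) * (\<integral>\<^sup>+r\<in>{0<..}. ennreal (R r * exp (- (rate / z * r))) \<partial>lborel))"
      unfolding R_def using A g rate_pos z by (subst nn_integral_kummer') auto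
    also have "\<dots> = (\<integral>\<^sup>+r\<in>{0<..}. ennreal D * (ennreal (Gamma \<gamma> / Gamma A * (rate / z) powr (A - \<gamma>)) * ennreal (R r * exp (- (rate / z * r)))) \<partial>lborel)"
      by (subst set_nn_integral_cmult, measurable) (subst set_nn_integral_cmult, measurable)
    also have "\<dots> = (\<integral>\<^sup>+r\<in>{0<..}. ennreal (?W z r) \<partial>lborel)"
    proof (rule nn_integral_pos_cong)
      fix r :: real assume r: "0 < r"
      have 1: "(rate / z) powr (A - \<gamma>) = rate powr ((a - 1)/2) * z powr (- ((a - 1)/2))"
      proof -
        have e: "A - \<gamma> = (a - 1)/2" by (simp add: A_def \<gamma>_def field_simps)
        show ?thesis unfolding e using z rate_pos by (simp add: powr_divide powr_minus_divide)
      qed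
      have 2: "- z - rate * (1 + r) / z = (- z - rate / z) + (- (rate / z * r))" using z by (simp add: field_simps)
      have 3: "z powr (-1/2) = z powr (a/2 - 1) * z powr (- ((a - 1)/2))"
        unfolding powr_add[symmetric] by (rule arg_cong[where f="\<lambda>e. z powr e"]) (simp add: field_simps)
      have "D * (Gamma \<gamma> / Gamma A * (rate / z) powr (A - \<gamma>) * (R r * exp (- (rate / z * r))))
         = ?W z r"
        unfolding 1 2 3 D_def L_def exp_add by (simp only: ac_simps)
      then show "ennreal D * (ennreal (Gamma \<gamma> / Gamma A * (rate / z) powr (A - \<gamma>)) * ennreal (R r * exp (- (rate / z * r))))
         = ennreal (?W z r)"
        using D0 GA by (subst ennreal_mult'[symmetric], simp, subst ennreal_mult'[symmetric]) auto
    qed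
    finally show "(\<integral>\<^sup>+w\<in>{0<..<1}. ennreal (H_kernel w z) \<partial>lborel) = (\<integral>\<^sup>+r\<in>{0<..}. ennreal (?W z r) \<partial>lborel)" .
  qed
  also have "\<dots> = (\<integral>\<^sup>+r\<in>{0<..}. (\<integral>\<^sup>+z\<in>{0<..}. ennreal (?W z r) \<partial>lborel) \<partial>lborel)"
    by (rule set_nn_integral_swap) auto
  also have "\<dots> = (\<integral>\<^sup>+r\<in>{0<..}. ennreal (?Q r) \<partial>lborel)"
  proof (rule nn_integral_pos_cong)
    fix r :: real assume r: "0 < r"
    define q where "q = sqrt (rate * (1 + r))"
    have q: "0 < q" "q\<^sup>2 = rate * (1 + r)" using rate_pos r by (auto simp: q_def)
    \<comment> \<open>This is \<open>b * s\<close> for s = (abs x / c) sqrt (1 + r): the exponential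
      produced by the z-integral is the one in the Gamma density.\<close>
    have q2: "2 * q = b * \<bar>x\<bar> / c * sqrt (1 + r)"
      using b c by (simp add: q_def rate_def real_sqrt_mult abs_mult abs_divide)
    have LR: "0 \<le> L * R r" using L0 R0 by simp
    have "(\<integral>\<^sup>+z\<in>{0<..}. ennreal (?W z r) \<partial>lborel)
       = (\<integral>\<^sup>+z\<in>{0<..}. ennreal (L * R r) * ennreal (z powr (-1/2) * exp (- (1\<^sup>2 * z) - q\<^sup>2 / z)) \<partial>lborel)"
      unfolding ennreal_mult'[OF LR, symmetric] q(2) by simp
    also have "\<dots> = ennreal (L * R r) * ennreal (sqrt pi / 1 * exp (- 2 * 1 * q))"
      using q(1) by (subst set_nn_integral_cmult, simp, simp, subst nn_integral_cauchy_schloemilch) auto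
    also have "\<dots> = ennreal (L * sqrt pi * (R r * exp (- (2 * q))))"
      by (simp add: ennreal_mult'[OF LR, symmetric] ac_simps)
    finally show "(\<integral>\<^sup>+z\<in>{0<..}. ennreal (?W z r) \<partial>lborel)
       = ennreal (?Q r)"
      unfolding q2 .
  qed
  finally have H: "ennreal (H_fun c a v x b) = (\<integral>\<^sup>+r\<in>{0<..}. ennreal (?Q r) \<partial>lborel)"
    by (simp only: H_fun_eq_H_mass)
  define K where "K = Gamma (v + 1) / (sqrt pi * Gamma A)"
  define M where "M = 1 / (Gamma ((a + 1)/2) * Beta (a/2) (v - a/2 + 1))"
  have M0: "0 \<le> M" unfolding M_def Beta_def using a v v0 by simp
  define d where "d = \<bar>x\<bar> / c"
  have d: "0 < d" using x c by (simp add: d_def)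
  let ?J = "\<lambda>r. d * (1 / (2 * sqrt (1 + r)))"
  define f where "f s = gamma_density a b s * (ultraspherical v (x / (c * s)) / (c * s))" for s
  have [measurable]: "f \<in> borel_measurable borel" unfolding f_def by measurable
  \<comment> \<open>Before time \<open>d = \<bar>x\<bar> / c\<close> the point x cannot be reached,
    so the ultraspherical factor vanishes there.\<close>
  have "(\<integral>\<^sup>+s\<in>{0<..}. ennreal (f s) \<partial>lborel) = (\<integral>\<^sup>+s\<in>{d<..}. ennreal (f s) \<partial>lborel)"
  proof (rule nn_integral_cong)
    fix s :: real
    have "f s = 0" if "0 < s" "s \<le> d"
      using that c by (simp add: f_def ultraspherical_def d_def abs_mult field_simps)
    then show "ennreal (f s) * indicator {0<..} s = ennreal (f s) * indicator {d<..} s"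
      using d by (auto simp: indicator_def)
  qed
  also have "\<dots> = (\<integral>\<^sup>+r\<in>{0<..}. ennreal (f (d * sqrt (1 + r))) * ennreal (?J r) \<partial>lborel)"
    by (rule nn_integral_subst_incr[OF _ _ _ _ _ _ image_scale_sqrt[OF d]])
       (use d in \<open>auto intro!: derivative_eq_intros continuous_intros simp: divide_simps\<close>)
  also have "\<dots> = (\<integral>\<^sup>+r\<in>{0<..}. ennreal M * ennreal (?Q r) \<partial>lborel)"
  proof (rule nn_integral_pos_cong)
    fix r :: real assume r: "0 < r"
    define s where "s = d * sqrt (1 + r)"
    have s: "0 < s" using d r by (simp add: s_def)
    have xs: "\<bar>x / (c * s)\<bar> = 1 / sqrt (1 + r)" using d r c x by (simp add: s_def d_def abs_mult)
    then have xs2: "(x / (c * s))\<^sup>2 = 1 / (1 + r)"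
      using r by (metis (no_types, lifting) add_nonneg_nonneg less_imp_le power2_abs power_divide power_one real_sqrt_pow2 zero_le_one)
    have lt: "\<bar>x / (c * s)\<bar> < 1" unfolding xs using r by simp
    have 1: "1 - 1 / (1 + r) = r / (1 + r)" using r by (simp add: field_simps)
    have us: "ultraspherical v (x / (c * s)) = K * (r powr (v - 1/2) * (1 + r) powr (1/2 - v))"
      unfolding ultraspherical_def xs2 1 using lt r
      by (simp add: K_def A_def powr_divide powr_minus_divide[of _ "v - 1/2", simplified])
    have sp: "sqrt (1 + r) = (1 + r) powr (1/2)" using r by (simp add: powr_half_sqrt)
    have sa: "s powr (a - 1) = d powr (a - 1) * (1 + r) powr ((a - 1)/2)"
      unfolding s_def sp using d r by (simp add: powr_mult powr_powr)
    have sd: "?J r / s = 1/2 * (1 + r) powr (-1)"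
      using d r by (simp add: s_def powr_minus_divide)
    have rr: "(1 + r) powr (- \<gamma>) = (1 + r) powr ((a - 1)/2) * (1 + r) powr (1/2 - v) * (1 + r) powr (-1)"
      unfolding powr_add[symmetric] by (rule arg_cong[where f="\<lambda>e. (1 + r) powr e"]) (simp add: \<gamma>_def field_simps)
    have bs: "b * s = b * \<bar>x\<bar> / c * sqrt (1 + r)" by (simp add: s_def d_def)
    have rA: "r powr (v - 1/2) = r powr (A - 1)" by (simp add: A_def)
    have "f s * (?J r) = b powr a / Gamma a * s powr (a - 1) * exp (- (b * s)) * (ultraspherical v (x / (c * s)) / c) * (?J r / s)"
      using s by (simp add: f_def gamma_density_def)
    also have "\<dots> = b powr a / Gamma a * d powr (a - 1) * K / (2 * c) * (R r * exp (- (b * \<bar>x\<bar> / c * sqrt (1 + r))))"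
      unfolding sa us sd R_def rr bs rA by (simp add: ac_simps)
    \<comment> \<open>The duplication formula at a/2 replaces Gamma a by Gamma (a/2) Gamma ((a +
      1)/2), up to a power of 2 absorbed by \<open>rate\<close>. This is where the constant Gamma
      ((a + 1)/2) Beta (a/2, v - a/2 + 1) comes from; the Beta function collects Gamma (a/2), Gamma
      (v - a/2 + 1) and Gamma (v + 1).\<close>
    also have "b powr a / Gamma a * d powr (a - 1) * K / (2 * c) = M * (L * sqrt pi)"
    proof -
      have rate: "rate powr ((a - 1)/2) = (b powr (a - 1) * d powr (a - 1)) * 2 powr (1 - a)"
      proof -
        have "rate = (b * d / 2)\<^sup>2" by (simp add: rate_def d_def power_mult_distrib power_divide)
        then have "rate = (b * d / 2) powr 2" using b d by simp
        then have "rate powr ((a - 1)/2) = (b * d / 2) powr (2 * ((a - 1)/2))" by (simp only: powr_powr)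
        also have "2 * ((a - 1)/2) = a - 1" by simp
        finally have "rate powr ((a - 1)/2) = (b * d / 2) powr (a - 1)" .
        then show ?thesis using b d powr_minus_divide[of 2 "a - 1"] by (simp add: powr_mult powr_divide)
      qed
      have dup: "2 powr (1 - a) * sqrt pi * Gamma a = Gamma (a/2) * Gamma ((a + 1)/2)"
        using Gamma_duplication_real[of "a/2"] a by (simp add: add_divide_distrib)
      have pos: "0 < Gamma a" "0 < Gamma (a/2)" "0 < Gamma ((a + 1)/2)" "0 < Gamma (v + 1)" using a v0 by auto
      have ba: "b powr a = b * b powr (a - 1)" using b powr_mult_base[of b "a - 1"] by simp
      have "M * (L * sqrt pi) = b / (2 * c) * (Gamma (v + 1) / Gamma A) * (2 powr (1 - a) / (Gamma (a/2) * Gamma ((a + 1)/2))) * (b powr (a - 1) * d powr (a - 1))"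
        unfolding M_def L_def rate Beta_def \<gamma>_def[symmetric] using pos GA by (simp add: \<gamma>_def ac_simps)
      also have "2 powr (1 - a) / (Gamma (a/2) * Gamma ((a + 1)/2)) = 1 / (sqrt pi * Gamma a)"
        unfolding dup[symmetric] using pos by simp
      finally show ?thesis unfolding ba K_def by (simp add: ac_simps)
    qed
    finally have eq: "f s * (?J r) = M * (?Q r)"
      by simp
    show "ennreal (f (d * sqrt (1 + r))) * ennreal (?J r) = ennreal M * ennreal (?Q r)"
      unfolding s_def[symmetric] ennreal_mult'[OF M0, symmetric] eq[symmetric] using d r
      by (subst ennreal_mult''[symmetric]) auto
  qed
  also have "\<dots> = ennreal M * ennreal (H_fun c a v x b)"
    unfolding H by (rule set_nn_integral_cmult) auto
  finally show ?thesis
    unfolding f_def M_def[symmetric] ennreal_mult'[OF M0, symmetric] .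
qed

end

section \<open>Convolutions in light-cone coordinates\<close>

lemma nn_integral_shift:
  fixes f :: "real \<Rightarrow> ennreal"
  assumes [measurable]: "f \<in> borel_measurable borel"
  shows "(\<integral>\<^sup>+x. f (x + t) \<partial>lborel) = (\<integral>\<^sup>+x. f x \<partial>lborel)"
  using nn_integral_real_affine[of f 1 t] by (simp add: add.commute)

text \<open>Testing against arbitrary h lets the identity be applied inside iterated integrals
  without any further change of variables.\<close>

definition is_convolution :: "(real \<Rightarrow> ennreal) \<Rightarrow> (real \<Rightarrow> ennreal) \<Rightarrow> (real \<Rightarrow> ennreal) \<Rightarrow> bool" where
  "is_convolution f g F \<longleftrightarrow> (\<forall>h\<in>borel_measurable borel.
     (\<integral>\<^sup>+p. (\<integral>\<^sup>+q. f p * g q * h (p + q) \<partial>lborel) \<partial>lborel) = (\<integral>\<^sup>+P. F P * h P \<partial>lborel))"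

lemma is_convolutionD:
  "is_convolution f g F \<Longrightarrow> h \<in> borel_measurable borel \<Longrightarrow>
    (\<integral>\<^sup>+p. (\<integral>\<^sup>+q. f p * g q * h (p + q) \<partial>lborel) \<partial>lborel) = (\<integral>\<^sup>+P. F P * h P \<partial>lborel)"
  by (simp add: is_convolution_def)

lemma is_convolutionI:
  assumes [measurable]: "f \<in> borel_measurable borel" "g \<in> borel_measurable borel"
    and F: "\<And>P. (\<integral>\<^sup>+p. f p * g (P - p) \<partial>lborel) = F P"
  shows "is_convolution f g F"
  unfolding is_convolution_def
proof
  fix h :: "real \<Rightarrow> ennreal" assume [measurable]: "h \<in> borel_measurable borel"
  have "(\<integral>\<^sup>+p. (\<integral>\<^sup>+q. f p * g q * h (p + q) \<partial>lborel) \<partial>lborel) = (\<integral>\<^sup>+p. (\<integral>\<^sup>+P. f p * g (P - p) * h P \<partial>lborel) \<partial>lborel)"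
  proof (rule nn_integral_cong)
    fix p :: real
    show "(\<integral>\<^sup>+q. f p * g q * h (p + q) \<partial>lborel) = (\<integral>\<^sup>+P. f p * g (P - p) * h P \<partial>lborel)"
      using nn_integral_shift[of "\<lambda>q. f p * g q * h (p + q)" "- p"] by simp
  qed
  also have "\<dots> = (\<integral>\<^sup>+P. (\<integral>\<^sup>+p. f p * g (P - p) * h P \<partial>lborel) \<partial>lborel)"
    by (rule lborel_pair.Fubini') simp
  also have "\<dots> = (\<integral>\<^sup>+P. F P * h P \<partial>lborel)"
    by (simp add: nn_integral_multc F)
  finally show "(\<integral>\<^sup>+p. (\<integral>\<^sup>+q. f p * g q * h (p + q) \<partial>lborel) \<partial>lborel) = (\<integral>\<^sup>+P. F P * h P \<partial>lborel)" .
qed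

text \<open>The coordinates do not interact: once the integrals over q and p' are exchanged, the
  one-dimensional identity applies first to the pair (q, q') and then to (p, p').\<close>

lemma is_convolution_product:
  fixes h :: "real \<Rightarrow> real \<Rightarrow> ennreal"
  assumes conv: "is_convolution f g F"
    and [measurable]: "f \<in> borel_measurable borel" "g \<in> borel_measurable borel" "F \<in> borel_measurable borel"
      "case_prod h \<in> borel_measurable (borel \<Otimes>\<^sub>M borel)"
  shows "(\<integral>\<^sup>+p. (\<integral>\<^sup>+q. f p * f q * (\<integral>\<^sup>+p'. (\<integral>\<^sup>+q'. g p' * g q' * h (p + p') (q + q') \<partial>lborel) \<partial>lborel) \<partial>lborel) \<partial>lborel)
    = (\<integral>\<^sup>+P. (\<integral>\<^sup>+Q. F P * F Q * h P Q \<partial>lborel) \<partial>lborel)"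
proof -
  have "(\<integral>\<^sup>+p. (\<integral>\<^sup>+q. f p * f q * (\<integral>\<^sup>+p'. (\<integral>\<^sup>+q'. g p' * g q' * h (p + p') (q + q') \<partial>lborel) \<partial>lborel) \<partial>lborel) \<partial>lborel)
    = (\<integral>\<^sup>+p. (\<integral>\<^sup>+q. (\<integral>\<^sup>+p'. (\<integral>\<^sup>+q'. f p * g p' * (f q * g q' * h (p + p') (q + q')) \<partial>lborel) \<partial>lborel) \<partial>lborel) \<partial>lborel)"
    by (simp add: nn_integral_cmult[symmetric] ac_simps)
  also have "\<dots> = (\<integral>\<^sup>+p. (\<integral>\<^sup>+p'. (\<integral>\<^sup>+q. (\<integral>\<^sup>+q'. f p * g p' * (f q * g q' * h (p + p') (q + q')) \<partial>lborel) \<partial>lborel) \<partial>lborel) \<partial>lborel)"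
    by (intro nn_integral_cong lborel_pair.Fubini') simp
  also have "\<dots> = (\<integral>\<^sup>+p. (\<integral>\<^sup>+p'. f p * g p' * (\<integral>\<^sup>+Q. F Q * h (p + p') Q \<partial>lborel) \<partial>lborel) \<partial>lborel)"
    by (simp add: nn_integral_cmult is_convolutionD[OF conv])
  also have "\<dots> = (\<integral>\<^sup>+P. F P * (\<integral>\<^sup>+Q. F Q * h P Q \<partial>lborel) \<partial>lborel)"
    by (rule is_convolutionD[OF conv]) simp
  also have "\<dots> = (\<integral>\<^sup>+P. (\<integral>\<^sup>+Q. F P * F Q * h P Q \<partial>lborel) \<partial>lborel)"
    by (simp add: nn_integral_cmult[symmetric] mult.assoc)
  finally show ?thesis .
qed

section \<open>Two convolution semigroups on the half-line\<close>

definition power_density :: "real \<Rightarrow> real \<Rightarrow> ennreal" where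
  "power_density a p = (if 0 < p then ennreal (p powr (a - 1) / Gamma a) else 0)"

text \<open>The one-sided stable density of index 1/2 with Laplace transform exp (- r sqrt z) in z;
  this is why the scales r add under convolution.\<close>

definition levy :: "real \<Rightarrow> real \<Rightarrow> ennreal" where
  "levy r p = (if 0 < p then ennreal (r / (2 * sqrt pi) * p powr (-3/2) * exp (- (r\<^sup>2 / (4 * p)))) else 0)"

lemma power_density_measurable[measurable]: "power_density a \<in> borel_measurable borel"
  unfolding power_density_def by measurable

lemma levy_measurable[measurable]: "case_prod levy \<in> borel_measurable (borel \<Otimes>\<^sub>M borel)"
  unfolding levy_def by measurable

text \<open>Scaling by P leaves the Beta integral. These kernels are Gamma densities with the
  exponential removed, so they have infinite mass; the exponential depends only on the total time
  and is restored later.\<close>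

lemma power_density_convolution:
  assumes a: "0 < a" and b: "0 < b"
  shows "is_convolution (power_density a) (power_density b) (power_density (a + b))"
proof (rule is_convolutionI)
  let ?b = "\<lambda>w. w powr (a - 1) * (1 - w) powr (b - 1)"
  fix P :: real
  show "(\<integral>\<^sup>+p. power_density a p * power_density b (P - p) \<partial>lborel) = power_density (a + b) P"
  proof (cases "0 < P")
    case False
    then have "power_density a p * power_density b (P - p) = 0" for p by (simp add: power_density_def)
    then show ?thesis using False by (simp only:) (simp add: power_density_def)
  next
    case P: True
    have G: "0 < Gamma a" "0 < Gamma b" "0 < Gamma (a + b)" using a b by auto
    define K where "K = P powr (a + b - 2) / (Gamma a * Gamma b)"
    have K0: "0 \<le> K" using G by (simp add: K_def)
    have "(\<integral>\<^sup>+p. power_density a p * power_density b (P - p) \<partial>lborel) = ennreal P * (\<integral>\<^sup>+w. power_density a (P * w) * power_density b (P - P * w) \<partial>lborel)"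
      using P by (subst nn_integral_real_affine[where c=P and t=0]) auto
    also have "(\<integral>\<^sup>+w. power_density a (P * w) * power_density b (P - P * w) \<partial>lborel)
       = (\<integral>\<^sup>+w\<in>{0..1}. ennreal K * ennreal (?b w) \<partial>lborel)"
    proof (rule nn_integral_cong)
      fix w :: real
      consider "0 < w \<and> w < 1" | "w \<le> 0" | "1 \<le> w" by linarith
      then show "power_density a (P * w) * power_density b (P - P * w) = ennreal K * ennreal (?b w) * indicator {0..1} w"
      proof cases
        case 1
        have e: "P - P * w = P * (1 - w)" by (simp add: algebra_simps)
        have e2: "P powr (a + b - 2) = P powr (a - 1) * P powr (b - 1)" by (simp add: powr_add[symmetric])
        have "(P * w) powr (a - 1) / Gamma a * ((P * (1 - w)) powr (b - 1) / Gamma b) = K * (?b w)"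
          using P 1 by (simp add: K_def powr_mult e2)
        moreover have "0 \<le> (P * w) powr (a - 1) / Gamma a" using G by simp
        ultimately show ?thesis using 1 P K0
          by (simp add: power_density_def e ennreal_mult'[symmetric])
      next
        case 2
        then have "\<not> 0 < P * w" using P by (simp add: mult_le_0_iff not_less)
        with 2 show ?thesis by (simp add: power_density_def indicator_def)
      next
        case 3
        then have "\<not> 0 < P - P * w" using P by simp
        with 3 show ?thesis by (simp add: power_density_def indicator_def)
      qed
    qed
    also have "\<dots> = ennreal K * (\<integral>\<^sup>+w\<in>{0..1}. ennreal (?b w) \<partial>lborel)"
      by (rule set_nn_integral_cmult) auto
    also have "(\<integral>\<^sup>+w\<in>{0..1}. ennreal (?b w) \<partial>lborel) = ennreal (Beta a b)"
      by (rule nn_integral_has_integral_lebesgue'[OF _ has_integral_Beta_real[OF a b]]) auto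
    also have "ennreal P * (ennreal K * ennreal (Beta a b)) = ennreal (P * K * Beta a b)"
      using P K0 by (simp add: ennreal_mult'[symmetric] mult.assoc)
    also have "P * K * Beta a b = P powr (a + b - 1) / Gamma (a + b)"
      using P G powr_mult_base[of P "a + b - 2"] by (simp add: K_def Beta_def)
    finally show ?thesis using P by (simp add: power_density_def)
  qed
qed auto

text \<open>The inversion \<open>z -> 1 / z\<close> turns the exponent -3/2 into -1/2 and exchanges
  A and B.\<close>

lemma nn_integral_cauchy_schloemilch':
  fixes A B :: real
  assumes A: "0 < A" and B: "0 < B"
  shows "(\<integral>\<^sup>+z\<in>{0<..}. ennreal (z powr (-3/2) * exp (- (A\<^sup>2 * z) - B\<^sup>2 / z)) \<partial>lborel)
    = ennreal (sqrt pi / B * exp (- 2 * A * B))"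
proof -
  have img: "(\<lambda>z::real. 1 / z) ` {0<..} = {0<..}"
  proof -
    have "y \<in> (\<lambda>z. 1 / z) ` {0<..}" if "0 < y" for y :: real
      using that by (intro image_eqI[of _ _ "1 / y"]) auto
    then show ?thesis by auto
  qed
  have "(\<integral>\<^sup>+z\<in>{0<..}. ennreal (z powr (-1/2) * exp (- (B\<^sup>2 * z) - A\<^sup>2 / z)) \<partial>lborel)
    = (\<integral>\<^sup>+z\<in>{0<..}. ennreal ((1 / z) powr (-1/2) * exp (- (B\<^sup>2 * (1 / z)) - A\<^sup>2 / (1 / z))) * ennreal (1 / z\<^sup>2) \<partial>lborel)"
    by (rule nn_integral_subst_decr[OF _ _ _ _ _ _ img])
       (auto intro!: derivative_eq_intros continuous_intros simp: power2_eq_square)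
  also have "\<dots> = (\<integral>\<^sup>+z\<in>{0<..}. ennreal (z powr (-3/2) * exp (- (A\<^sup>2 * z) - B\<^sup>2 / z)) \<partial>lborel)"
  proof (rule nn_integral_pos_cong)
    fix z :: real assume z: "0 < z"
    have "z powr (-3/2) = z powr (1/2) * z powr (-2)" by (simp add: powr_add[symmetric])
    then have k: "(1 / z) powr (-1/2) * (1 / z\<^sup>2) = z powr (-3/2)"
      using z by (simp add: powr_divide powr_minus_divide)
    have e: "- (B\<^sup>2 * (1 / z)) - A\<^sup>2 / (1 / z) = - (A\<^sup>2 * z) - B\<^sup>2 / z" by simp
    show "ennreal ((1 / z) powr (-1/2) * exp (- (B\<^sup>2 * (1 / z)) - A\<^sup>2 / (1 / z))) * ennreal (1 / z\<^sup>2)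
       = ennreal (z powr (-3/2) * exp (- (A\<^sup>2 * z) - B\<^sup>2 / z))"
      unfolding e k[symmetric] by (subst ennreal_mult''[symmetric], simp) (simp only: ac_simps)
  qed
  finally show ?thesis
    using nn_integral_cauchy_schloemilch[OF B A] by (simp add: ac_simps)
qed

text \<open>With p = P / (1 + z), A = a / (2 sqrt P) and B = b / (2 sqrt P), the exponent becomes -
  A^2 - B^2 - A^2 z - B^2 / z, and the powers combine to (1 + z) z^(-3/2). So both
  Cauchy-Schloemilch integrals occur, each with the factor exp (- 2 A B), which completes the square
  to (A + B)^2 = (a + b)^2 / (4 P).\<close>

lemma levy_convolution:
  assumes a: "0 < a" and b: "0 < b"
  shows "is_convolution (levy a) (levy b) (levy (a + b))"
proof (rule is_convolutionI)
  fix P :: real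
  show "(\<integral>\<^sup>+p. levy a p * levy b (P - p) \<partial>lborel) = levy (a + b) P"
  proof (cases "0 < P")
    case False
    then have "levy a p * levy b (P - p) = 0" for p by (simp add: levy_def)
    then show ?thesis using False by (simp only:) (simp add: levy_def)
  next
    case P: True
    define f where "f p = a / (2 * sqrt pi) * p powr (-3/2) * exp (- (a\<^sup>2 / (4 * p))) *
       (b / (2 * sqrt pi) * (P - p) powr (-3/2) * exp (- (b\<^sup>2 / (4 * (P - p)))))" for p
    define A B where "A = a / (2 * sqrt P)" and "B = b / (2 * sqrt P)"
    let ?e = "\<lambda>z. exp (- (A\<^sup>2 * z) - B\<^sup>2 / z)"
    let ?g = "\<lambda>z. ennreal (z powr (-3/2) * ?e z) + ennreal (z powr (-1/2) * ?e z)"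
    have AB: "0 < A" "0 < B" using a b P by (auto simp: A_def B_def)
    have A2: "a\<^sup>2 / (4 * P) = A\<^sup>2" "b\<^sup>2 / (4 * P) = B\<^sup>2" using P by (auto simp: A_def B_def power_divide power_mult_distrib)
    define K where "K = a * b / (4 * pi) * P powr (-2) * exp (- (A\<^sup>2 + B\<^sup>2))"
    have K0: "0 \<le> K" using a b by (simp add: K_def)
    have img: "(\<lambda>z. P / (1 + z)) ` {0<..} = {0<..<P}"
    proof -
      have "y \<in> (\<lambda>z. P / (1 + z)) ` {0<..}" if "0 < y" "y < P" for y :: real
        using that by (intro image_eqI[of _ _ "P / y - 1"]) (auto simp: field_simps)
      then show ?thesis using P by (auto simp: field_simps)
    qed
    have "(\<integral>\<^sup>+p. levy a p * levy b (P - p) \<partial>lborel) = (\<integral>\<^sup>+p\<in>{0<..<P}. ennreal (f p) \<partial>lborel)"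
      using a b by (intro nn_integral_cong) (auto simp: levy_def indicator_def f_def ennreal_mult'[symmetric])
    also have "\<dots> = (\<integral>\<^sup>+z\<in>{0<..}. ennreal (f (P / (1 + z))) * ennreal (P / (1 + z)\<^sup>2) \<partial>lborel)"
      by (rule nn_integral_subst_decr[OF _ _ _ _ _ _ img])
         (use P in \<open>auto simp: f_def power2_eq_square intro!: derivative_eq_intros continuous_intros\<close>)
    also have "\<dots> = (\<integral>\<^sup>+z\<in>{0<..}. ennreal K * (?g z) \<partial>lborel)"
    proof (rule nn_integral_pos_cong)
      fix z :: real assume z: "0 < z"
      have 1: "P - P / (1 + z) = P * z / (1 + z)" using z by (simp add: field_simps)
      have 2: "a\<^sup>2 / (4 * (P / (1 + z))) = A\<^sup>2 * (1 + z)" unfolding A2[symmetric] by simp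
      have 3: "b\<^sup>2 / (4 * (P * z / (1 + z))) = B\<^sup>2 * (1 + z) / z" unfolding A2[symmetric] by simp
      have 4: "(P / (1 + z)) powr (-3/2) = P powr (-3/2) * (1 + z) powr (3/2)"
        "(P * z / (1 + z)) powr (-3/2) = P powr (-3/2) * z powr (-3/2) * (1 + z) powr (3/2)"
        using P z by (simp_all add: powr_divide powr_mult powr_minus_divide)
      have 5: "P / (1 + z)\<^sup>2 = P powr 1 * (1 + z) powr (-2)" using P z by (simp add: powr_minus_divide)
      have 6: "P powr (-2) = P powr (-3/2) * P powr (-3/2) * P powr 1" unfolding powr_add[symmetric] by simp
      have 7: "(1 + z) powr (3/2) * (1 + z) powr (3/2) * (1 + z) powr (-2) = 1 + z"
        using z unfolding powr_add[symmetric] by simp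
      have 8: "z powr (-1/2) = z powr (-3/2) * z" using powr_mult_base[of z "-3/2"] z by (simp add: mult.commute)
      have 9: "exp (- (A\<^sup>2 * (1 + z))) * exp (- (B\<^sup>2 * (1 + z) / z)) = exp (- (A\<^sup>2 + B\<^sup>2)) * ?e z"
        unfolding exp_add[symmetric] using z by (simp add: field_simps)
      have "f (P / (1 + z)) * (P / (1 + z)\<^sup>2) = a * b / (4 * pi) * (P powr (-3/2) * P powr (-3/2) * P powr 1) * z powr (-3/2) *
          ((1 + z) powr (3/2) * (1 + z) powr (3/2) * (1 + z) powr (-2)) * (exp (- (A\<^sup>2 * (1 + z))) * exp (- (B\<^sup>2 * (1 + z) / z)))"
        unfolding f_def 1 2 3 4 5 by simp
      also have "\<dots> = K * ((z powr (-3/2) + z powr (-1/2)) * ?e z)"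
        unfolding 7 8 9 6[symmetric] K_def by (simp add: algebra_simps add_divide_distrib)
      finally have "f (P / (1 + z)) * (P / (1 + z)\<^sup>2) = K * (z powr (-3/2) * ?e z + z powr (-1/2) * ?e z)"
        by (simp add: distrib_right)
      then show "ennreal (f (P / (1 + z))) * ennreal (P / (1 + z)\<^sup>2)
        = ennreal K * (?g z)"
        using P K0 by (subst ennreal_mult''[symmetric], simp, subst ennreal_plus[symmetric], simp, simp, subst ennreal_mult'[symmetric]) auto
    qed
    also have "\<dots> = ennreal K * (\<integral>\<^sup>+z\<in>{0<..}. ?g z \<partial>lborel)"
      by (rule set_nn_integral_cmult) auto
    also have "(\<integral>\<^sup>+z\<in>{0<..}. ?g z \<partial>lborel)
       = ennreal (sqrt pi / B * exp (- 2 * A * B)) + ennreal (sqrt pi / A * exp (- 2 * A * B))"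
      unfolding distrib_right nn_integral_cauchy_schloemilch[OF AB, symmetric] nn_integral_cauchy_schloemilch'[OF AB, symmetric]
      by (rule nn_integral_add) auto
    also have "\<dots> = ennreal (sqrt pi / B * exp (- 2 * A * B) + sqrt pi / A * exp (- 2 * A * B))"
      using AB by (subst ennreal_plus) auto
    also have "ennreal K * \<dots> = ennreal ((a + b) / (2 * sqrt pi) * P powr (-3/2) * exp (- ((a + b)\<^sup>2 / (4 * P))))"
      unfolding ennreal_mult'[OF K0, symmetric]
    proof (rule arg_cong[where f=ennreal])
      have e: "exp (- ((a + b)\<^sup>2 / (4 * P))) = exp (- (A\<^sup>2 + B\<^sup>2)) * exp (- 2 * A * B)"
        unfolding exp_add[symmetric] A2[symmetric] using P
        by (simp add: A_def B_def power2_eq_square field_simps)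
      have "P powr (-2) = P powr (-3/2) * P powr (-1/2)" by (simp add: powr_add[symmetric])
      also have "P powr (-1/2) = 1 / sqrt P" using P by (simp add: powr_minus_divide powr_half_sqrt)
      finally have p: "P powr (-2) * sqrt P = P powr (-3/2)" using P by simp
      have "a * b / (4 * pi) * (sqrt pi / B + sqrt pi / A) = (a + b) / (2 * sqrt pi) * sqrt P"
      proof -
        have "a * b / (4 * pi) * (sqrt pi / B + sqrt pi / A) = a * b * (2 * sqrt P / b + 2 * sqrt P / a) / (4 * (pi / sqrt pi))"
          by (simp add: A_def B_def field_simps)
        also have "pi / sqrt pi = sqrt pi" by (simp add: real_div_sqrt)
        also have "a * b * (2 * sqrt P / b + 2 * sqrt P / a) = 2 * (a + b) * sqrt P" using a b by (simp add: field_simps)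
        also have "2 * (a + b) * sqrt P / (4 * sqrt pi) = (a + b) / (2 * sqrt pi) * sqrt P" by (simp add: field_simps)
        finally show ?thesis .
      qed
      note w = this
      have "K * (sqrt pi / B * exp (- 2 * A * B) + sqrt pi / A * exp (- 2 * A * B))
        = (a * b / (4 * pi) * (sqrt pi / B + sqrt pi / A)) * P powr (-2) * (exp (- (A\<^sup>2 + B\<^sup>2)) * exp (- 2 * A * B))"
        unfolding K_def distrib_right[symmetric] by (simp only: ac_simps)
      then show "K * (sqrt pi / B * exp (- 2 * A * B) + sqrt pi / A * exp (- 2 * A * B))
         = (a + b) / (2 * sqrt pi) * P powr (-3/2) * exp (- ((a + b)\<^sup>2 / (4 * P)))"
        unfolding w e p[symmetric] by (simp only: ac_simps)
    qed
    finally show ?thesis using P by (simp add: levy_def)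
  qed
qed auto

text \<open>For n = 0 this is, up to a constant, the step density sqrt (p q) / (p + q)^2 of the case
  m = 1. Each step contributes order 2 to the mixing kernel, whence the order 2 n + 2 for n + 1
  steps.\<close>

definition levy_mixture :: "nat \<Rightarrow> real \<Rightarrow> real \<Rightarrow> ennreal" where
  "levy_mixture n p q = (\<integral>\<^sup>+r. power_density (2 * real n + 2) r * (levy r p * levy r q) \<partial>lborel)"

lemma levy_mixture_measurable[measurable]: "case_prod (levy_mixture n) \<in> borel_measurable (borel \<Otimes>\<^sub>M borel)"
  unfolding levy_mixture_def by measurable

text \<open>In the variable u = r^2 this is a Gamma integral with rate (1/p + 1/q) / 4.\<close>

lemma levy_mixture_eq:
  assumes p: "0 < p" and q: "0 < q"
  shows "levy_mixture n p q = ennreal (4 ^ (n + 1) * Gamma (real n + 2) / (2 * pi * Gamma (2 * real n + 2)) *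
    ((p * q) powr (real n + 1/2) / (p + q) powr (real n + 2)))"
proof -
  let ?N = "real n + 2 - 1" and ?M = "2 * real n + 2" and ?K = "real n + 2"
  define D where "D = (p + q) / (4 * (p * q))"
  have D: "0 < D" using p q by (simp add: D_def)
  define K where "K = (p * q) powr (-3/2) / (8 * pi * Gamma ?M)"
  have K0: "0 \<le> K" by (simp add: K_def)
  have "levy_mixture n p q = (\<integral>\<^sup>+r\<in>{0<..}. ennreal (K * ((r\<^sup>2) powr ?N * exp (- (D * r\<^sup>2)))) * ennreal (2 * r) \<partial>lborel)"
    unfolding levy_mixture_def
  proof (rule nn_integral_cong)
    fix r :: real
    show "power_density ?M r * (levy r p * levy r q)
      = ennreal (K * ((r\<^sup>2) powr ?N * exp (- (D * r\<^sup>2)))) * ennreal (2 * r) * indicator {0<..} r"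
    proof (cases "0 < r")
      case r: True
      have "r\<^sup>2 / (4 * p) + r\<^sup>2 / (4 * q) = D * r\<^sup>2" using p q by (simp add: D_def field_simps)
      then have e: "exp (- (r\<^sup>2 / (4 * p))) * exp (- (r\<^sup>2 / (4 * q))) = exp (- (D * r\<^sup>2))"
        unfolding exp_add[symmetric] by simp
      have r2: "(r\<^sup>2) powr ?N = r powr (2 * real n + 1) * r"
      proof -
        have "(r\<^sup>2) powr ?N = (r powr 2) powr (real n + 1)" using r by (simp add: add.commute)
        also have "\<dots> = r powr (1 + (2 * real n + 1))" unfolding powr_powr by (simp add: algebra_simps)
        also have "\<dots> = r powr (2 * real n + 1) * r" unfolding powr_add using r by simp
        finally show ?thesis .
      qed
      have "r powr (2 * real n + 2 - 1) / Gamma ?M * (r / (2 * sqrt pi) * p powr (-3/2) * exp (- (r\<^sup>2 / (4 * p))) *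
          (r / (2 * sqrt pi) * q powr (-3/2) * exp (- (r\<^sup>2 / (4 * q)))))
        = r powr (2 * real n + 1) * r * r / (4 * pi * Gamma ?M) * (p powr (-3/2) * q powr (-3/2)) * (exp (- (r\<^sup>2 / (4 * p))) * exp (- (r\<^sup>2 / (4 * q))))"
        by (simp add: ac_simps)
      also have "\<dots> = K * ((r\<^sup>2) powr ?N * exp (- (D * r\<^sup>2))) * (2 * r)"
        unfolding e r2 K_def using p q by (simp add: powr_mult ac_simps)
      finally show ?thesis using r p q K0
        by (simp add: power_density_def levy_def ennreal_mult'[symmetric])
    qed (simp add: power_density_def)
  qed
  also have "\<dots> = (\<integral>\<^sup>+u\<in>{0<..}. ennreal (K * (u powr ?N * exp (- (D * u)))) \<partial>lborel)"
    by (rule nn_integral_subst_incr[OF _ _ _ _ _ _ image_square, symmetric])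
       (auto intro!: derivative_eq_intros continuous_intros)
  also have "\<dots> = (\<integral>\<^sup>+u\<in>{0<..}. ennreal K * ennreal (u powr ?N * exp (- (D * u))) \<partial>lborel)"
    using K0 by (simp add: ennreal_mult')
  also have "\<dots> = ennreal K * ennreal (Gamma ?K / D powr ?K)"
    using D by (subst set_nn_integral_cmult, simp, simp, subst nn_integral_Gamma) auto
  also have "\<dots> = ennreal (K * (Gamma ?K / D powr ?K))"
    by (rule ennreal_mult'[OF K0, symmetric])
  also have "K * (Gamma ?K / D powr ?K) = 4 ^ (n + 1) * Gamma ?K / (2 * pi * Gamma ?M) *
    ((p * q) powr (real n + 1/2) / (p + q) powr ?K)"
  proof -
    have D': "D powr ?K = (p + q) powr ?K / (4 ^ (n + 2) * (p * q) powr ?K)"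
    proof -
      have "(4::real) powr ?K = 4 powr (real (n + 2))" by (simp add: add.commute)
      also have "\<dots> = 4 ^ (n + 2)" by (subst powr_realpow) auto
      finally show ?thesis unfolding D_def using p q by (simp add: powr_divide powr_mult)
    qed
    have pq: "(p * q) powr (real n + 1/2) = (p * q) powr (-3/2) * (p * q) powr ?K"
      unfolding powr_add[symmetric] by (simp add: add.commute)
    show ?thesis unfolding D' pq K_def by simp
  qed
  finally show ?thesis .
qed

lemma power_density_neg: "p \<le> 0 \<Longrightarrow> power_density a p = 0"
  by (simp add: power_density_def)

lemma levy_neg: "p \<le> 0 \<Longrightarrow> levy r p = 0"
  by (simp add: levy_def)

text \<open>Both semigroups act one after the other. For fixed scales r and r' the Levy products
  convolve to the product at scale r + r'; the remaining integral over r and r' depends on the sum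
  only, and the mixing kernels convolve from orders 2 n + 2 and 2 to 2 n + 4.\<close>

lemma levy_mixture_convolution:
  fixes h :: "real \<Rightarrow> real \<Rightarrow> ennreal"
  assumes [measurable]: "case_prod h \<in> borel_measurable (borel \<Otimes>\<^sub>M borel)"
  shows "(\<integral>\<^sup>+p. (\<integral>\<^sup>+q. levy_mixture n p q * (\<integral>\<^sup>+p'. (\<integral>\<^sup>+q'. levy_mixture 0 p' q' * h (p + p') (q + q') \<partial>lborel) \<partial>lborel) \<partial>lborel) \<partial>lborel)
    = (\<integral>\<^sup>+p. (\<integral>\<^sup>+q. levy_mixture (Suc n) p q * h p q \<partial>lborel) \<partial>lborel)"
proof -
  have pull: "(\<integral>\<^sup>+p. (\<integral>\<^sup>+q. levy_mixture k p q * g p q \<partial>lborel) \<partial>lborel)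
     = (\<integral>\<^sup>+r. power_density (2 * real k + 2) r * (\<integral>\<^sup>+p. (\<integral>\<^sup>+q. levy r p * levy r q * g p q \<partial>lborel) \<partial>lborel) \<partial>lborel)"
    if [measurable]: "case_prod g \<in> borel_measurable (borel \<Otimes>\<^sub>M borel)" for k and g :: "real \<Rightarrow> real \<Rightarrow> ennreal"
  proof -
    have "(\<integral>\<^sup>+p. (\<integral>\<^sup>+q. levy_mixture k p q * g p q \<partial>lborel) \<partial>lborel)
      = (\<integral>\<^sup>+p. (\<integral>\<^sup>+q. (\<integral>\<^sup>+r. power_density (2 * real k + 2) r * (levy r p * levy r q * g p q) \<partial>lborel) \<partial>lborel) \<partial>lborel)"
      unfolding levy_mixture_def by (simp add: nn_integral_multc[symmetric] mult.assoc)
    also have "\<dots> = (\<integral>\<^sup>+p. (\<integral>\<^sup>+r. (\<integral>\<^sup>+q. power_density (2 * real k + 2) r * (levy r p * levy r q * g p q) \<partial>lborel) \<partial>lborel) \<partial>lborel)"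
      by (intro nn_integral_cong lborel_pair.Fubini') simp
    also have "\<dots> = (\<integral>\<^sup>+r. (\<integral>\<^sup>+p. (\<integral>\<^sup>+q. power_density (2 * real k + 2) r * (levy r p * levy r q * g p q) \<partial>lborel) \<partial>lborel) \<partial>lborel)"
      by (rule lborel_pair.Fubini') simp
    finally show ?thesis by (simp add: nn_integral_cmult)
  qed
  define E where "E R = (\<integral>\<^sup>+p. (\<integral>\<^sup>+q. levy R p * levy R q * h p q \<partial>lborel) \<partial>lborel)" for R
  have [measurable]: "E \<in> borel_measurable borel" unfolding E_def by measurable
  let ?w = "\<lambda>k. power_density (2 * real k + 2)"
  let ?l = levy
  let ?I = "\<lambda>p q r'. \<integral>\<^sup>+p'. (\<integral>\<^sup>+q'. ?l r' p' * ?l r' q' * h (p + p') (q + q') \<partial>lborel) \<partial>lborel"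
  have "(\<integral>\<^sup>+p. (\<integral>\<^sup>+q. levy_mixture n p q * (\<integral>\<^sup>+p'. (\<integral>\<^sup>+q'. levy_mixture 0 p' q' * h (p + p') (q + q') \<partial>lborel) \<partial>lborel) \<partial>lborel) \<partial>lborel)
    = (\<integral>\<^sup>+r. ?w n r * (\<integral>\<^sup>+p. (\<integral>\<^sup>+q. ?l r p * ?l r q *
         (\<integral>\<^sup>+r'. ?w 0 r' * (?I p q r') \<partial>lborel) \<partial>lborel) \<partial>lborel) \<partial>lborel)"
    by (subst pull, simp) (subst pull, simp_all)
  also have "\<dots> = (\<integral>\<^sup>+r. ?w n r * (\<integral>\<^sup>+p. (\<integral>\<^sup>+q. (\<integral>\<^sup>+r'. ?l r p * ?l r q *
         (?w 0 r' * (?I p q r')) \<partial>lborel) \<partial>lborel) \<partial>lborel) \<partial>lborel)"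
    by (simp add: nn_integral_cmult)
  also have "\<dots> = (\<integral>\<^sup>+r. ?w n r * (\<integral>\<^sup>+p. (\<integral>\<^sup>+r'. (\<integral>\<^sup>+q. ?l r p * ?l r q *
         (?w 0 r' * (?I p q r')) \<partial>lborel) \<partial>lborel) \<partial>lborel) \<partial>lborel)"
    by (intro nn_integral_cong arg_cong2[where f="(*)"] refl lborel_pair.Fubini') simp
  also have "\<dots> = (\<integral>\<^sup>+r. ?w n r * (\<integral>\<^sup>+r'. (\<integral>\<^sup>+p. (\<integral>\<^sup>+q. ?l r p * ?l r q *
         (?w 0 r' * (?I p q r')) \<partial>lborel) \<partial>lborel) \<partial>lborel) \<partial>lborel)"
    by (intro nn_integral_cong arg_cong2[where f="(*)"] refl lborel_pair.Fubini') simp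
  also have "\<dots> = (\<integral>\<^sup>+r. (\<integral>\<^sup>+r'. ?w n r * ?w 0 r' * (\<integral>\<^sup>+p. (\<integral>\<^sup>+q. ?l r p * ?l r q *
         (?I p q r') \<partial>lborel) \<partial>lborel) \<partial>lborel) \<partial>lborel)"
    by (simp add: nn_integral_cmult[symmetric] ac_simps)
  also have "\<dots> = (\<integral>\<^sup>+r. (\<integral>\<^sup>+r'. ?w n r * ?w 0 r' * E (r + r') \<partial>lborel) \<partial>lborel)"
  proof (intro nn_integral_cong)
    fix r r' :: real
    show "?w n r * ?w 0 r' * (\<integral>\<^sup>+p. (\<integral>\<^sup>+q. ?l r p * ?l r q *
         (?I p q r') \<partial>lborel) \<partial>lborel)
       = ?w n r * ?w 0 r' * E (r + r')"
    \<comment> \<open>The Levy convolution is available for positive scales; at all others one of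
      the mixing weights vanishes.\<close>
    proof (cases "0 < r \<and> 0 < r'")
      case True
      then show ?thesis
        unfolding E_def by (subst is_convolution_product[OF levy_convolution]) auto
    qed (auto simp: power_density_neg not_less)
  qed
  also have "\<dots> = (\<integral>\<^sup>+R. power_density (2 * real n + 2 + (2 * real 0 + 2)) R * E R \<partial>lborel)"
    by (rule is_convolutionD[OF power_density_convolution]) auto
  also have "2 * real n + 2 + (2 * real 0 + 2) = 2 * real (Suc n) + 2" by simp
  also have "(\<integral>\<^sup>+R. ?w (Suc n) R * E R \<partial>lborel) = (\<integral>\<^sup>+p. (\<integral>\<^sup>+q. levy_mixture (Suc n) p q * h p q \<partial>lborel) \<partial>lborel)"
    unfolding E_def by (subst pull) auto
  finally show ?thesis .
qed

text \<open>The density of the endpoint of \<open>n + 1\<close> steps with Lebesgue-distributed lengths \<open>s\<close>, in the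
  light-cone coordinates \<open>p = s + x\<close>, \<open>q = s - x\<close>, in which it splits into (mixtures of) products.\<close>
definition cone_density :: "nat \<Rightarrow> nat \<Rightarrow> real \<Rightarrow> real \<Rightarrow> ennreal" where
  "cone_density m n p q =
     (if m = 0 then ennreal ((1/2) ^ (n + 1)) * (power_density ((real n + 1) / 2) p * power_density ((real n + 1) / 2) q)
      else ennreal (2 ^ (n + 1)) * levy_mixture n p q)"

lemma cone_density_measurable[measurable]: "case_prod (cone_density m n) \<in> borel_measurable (borel \<Otimes>\<^sub>M borel)"
  unfolding cone_density_def by measurable

lemma cone_density_neg: "p \<le> 0 \<or> q \<le> 0 \<Longrightarrow> cone_density m n p q = 0"
  by (auto simp: cone_density_def levy_mixture_def power_density_neg levy_neg)

text \<open>The constants are geometric in the number of steps, so they multiply correctly, and each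
  case is one of the two semigroup laws.\<close>

lemma cone_density_convolution:
  fixes h :: "real \<Rightarrow> real \<Rightarrow> ennreal"
  assumes [measurable]: "case_prod h \<in> borel_measurable (borel \<Otimes>\<^sub>M borel)"
  shows "(\<integral>\<^sup>+p. (\<integral>\<^sup>+q. cone_density m n p q * (\<integral>\<^sup>+p'. (\<integral>\<^sup>+q'. cone_density m 0 p' q' * h (p + p') (q + q') \<partial>lborel) \<partial>lborel) \<partial>lborel) \<partial>lborel)
    = (\<integral>\<^sup>+p. (\<integral>\<^sup>+q. cone_density m (Suc n) p q * h p q \<partial>lborel) \<partial>lborel)"
proof -
  have c: "(\<integral>\<^sup>+p. (\<integral>\<^sup>+q. ennreal C * f p q * (\<integral>\<^sup>+p'. (\<integral>\<^sup>+q'. ennreal C' * f' p' q' * h (p + p') (q + q') \<partial>lborel) \<partial>lborel) \<partial>lborel) \<partial>lborel)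
    = ennreal C * ennreal C' * (\<integral>\<^sup>+p. (\<integral>\<^sup>+q. f p q * (\<integral>\<^sup>+p'. (\<integral>\<^sup>+q'. f' p' q' * h (p + p') (q + q') \<partial>lborel) \<partial>lborel) \<partial>lborel) \<partial>lborel)"
    if [measurable]: "case_prod f \<in> borel_measurable (borel \<Otimes>\<^sub>M borel)" "case_prod f' \<in> borel_measurable (borel \<Otimes>\<^sub>M borel)"
      for C C' f f'
    by (simp add: nn_integral_cmult[symmetric] ac_simps)
  have c': "(\<integral>\<^sup>+p. (\<integral>\<^sup>+q. ennreal C * f p q * h p q \<partial>lborel) \<partial>lborel) = ennreal C * (\<integral>\<^sup>+p. (\<integral>\<^sup>+q. f p q * h p q \<partial>lborel) \<partial>lborel)"
    if [measurable]: "case_prod f \<in> borel_measurable (borel \<Otimes>\<^sub>M borel)" for C f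
    by (simp add: nn_integral_cmult[symmetric] ac_simps)
  show ?thesis
  proof (cases "m = 0")
    case True
    have e: "(real n + 1) / 2 + (real 0 + 1) / 2 = (real (Suc n) + 1) / 2" by (simp add: field_simps)
    have e2: "ennreal ((1/2) ^ (n + 1)) * ennreal ((1/2) ^ (0 + 1)) = ennreal ((1/2) ^ (Suc n + 1))"
      unfolding ennreal_mult'[OF zero_le_power[OF zero_le_divide_1_iff[THEN iffD2, OF zero_le_numeral]], symmetric] by simp
    show ?thesis
      unfolding cone_density_def if_P[OF True]
      by (subst c, measurable) (subst c', measurable,
        subst is_convolution_product[OF power_density_convolution], simp_all only: e e2, auto)
  next
    case False
    have e2: "ennreal (2 ^ (n + 1)) * ennreal (2 ^ (0 + 1)) = ennreal (2 ^ (Suc n + 1))"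
      by (subst ennreal_mult'[symmetric]) (auto simp: ac_simps)
    show ?thesis
      unfolding cone_density_def if_not_P[OF False]
      by (subst c, measurable) (subst c', measurable, simp only: e2 levy_mixture_convolution[OF assms])
  qed
qed


section \<open>Light-cone coordinates and the addition of one step\<close>

lemma nn_integral_light_cone:
  fixes f :: "real \<Rightarrow> real \<Rightarrow> ennreal"
  assumes [measurable]: "case_prod f \<in> borel_measurable (borel \<Otimes>\<^sub>M borel)"
  shows "(\<integral>\<^sup>+p. (\<integral>\<^sup>+q. f ((p + q) / 2) ((p - q) / 2) \<partial>lborel) \<partial>lborel) = 2 * (\<integral>\<^sup>+s. (\<integral>\<^sup>+x. f s x \<partial>lborel) \<partial>lborel)"
proof -
  have "(\<integral>\<^sup>+p. (\<integral>\<^sup>+q. f ((p + q) / 2) ((p - q) / 2) \<partial>lborel) \<partial>lborel) = (\<integral>\<^sup>+p. 2 * (\<integral>\<^sup>+s. f s (p - s) \<partial>lborel) \<partial>lborel)"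
  proof (rule nn_integral_cong)
    fix p :: real
    have "(\<integral>\<^sup>+q. f ((p + q) / 2) ((p - q) / 2) \<partial>lborel)
        = ennreal \<bar>2\<bar> * (\<integral>\<^sup>+s. f ((p + (- p + 2 * s)) / 2) ((p - (- p + 2 * s)) / 2) \<partial>lborel)"
      by (rule nn_integral_real_affine) auto
    moreover have "(p + (- p + 2 * s)) / 2 = s" "(p - (- p + 2 * s)) / 2 = p - s" for s
      by (simp_all add: field_simps)
    ultimately show "(\<integral>\<^sup>+q. f ((p + q) / 2) ((p - q) / 2) \<partial>lborel) = 2 * (\<integral>\<^sup>+s. f s (p - s) \<partial>lborel)"
      by (simp only:) simp
  qed
  also have "\<dots> = 2 * (\<integral>\<^sup>+p. (\<integral>\<^sup>+s. f s (p - s) \<partial>lborel) \<partial>lborel)"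
    by (rule nn_integral_cmult) simp
  also have "(\<integral>\<^sup>+p. (\<integral>\<^sup>+s. f s (p - s) \<partial>lborel) \<partial>lborel) = (\<integral>\<^sup>+s. (\<integral>\<^sup>+p. f s (p - s) \<partial>lborel) \<partial>lborel)"
    by (rule lborel_pair.Fubini') simp
  also have "\<dots> = (\<integral>\<^sup>+s. (\<integral>\<^sup>+x. f s x \<partial>lborel) \<partial>lborel)"
  proof (rule nn_integral_cong)
    fix s :: real
    show "(\<integral>\<^sup>+p. f s (p - s) \<partial>lborel) = (\<integral>\<^sup>+x. f s x \<partial>lborel)"
      using nn_integral_shift[of "f s" "- s"] by simp
  qed
  finally show ?thesis .
qed

text \<open>The factor \<open>2 * s\<close> is the Jacobian of p = s (1 + y), q = s (1 - y). On the
  right, s^n / n! is the density of the sum of n + 1 Lebesgue-distributed lengths, and the rest is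
  the density of the normalised position. The constants agree by the duplication formula, at (n +
  1)/2 for m = 0 and at n + 1 for m = 1.\<close>

lemma cone_density_eq:
  assumes m: "m \<in> {0, 1}" and s: "0 < s"
  shows "ennreal (2 * s) * cone_density m n (s * (1 + y)) (s * (1 - y))
    = ennreal (s ^ n / fact n * ultraspherical (v_param m n) y)"
proof -
  let ?p = "s * (1 + y)" and ?q = "s * (1 - y)" and ?U = "ultraspherical (v_param m n) y"
  show ?thesis
  proof (cases "\<bar>y\<bar> < 1")
    case False
    then have "1 + y \<le> 0 \<or> 1 - y \<le> 0" by linarith
    then have "?p \<le> 0 \<or> ?q \<le> 0" using s by (auto simp: mult_le_0_iff)
    with False show ?thesis by (simp add: cone_density_neg ultraspherical_def)
  next
    case y: True
    have pos: "0 < ?p" "0 < ?q" using s y by auto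
    have yy: "(1 + y) * (1 - y) = 1 - y\<^sup>2" by (simp add: power2_eq_square algebra_simps)
    have y2: "0 < 1 - y\<^sup>2" unfolding yy[symmetric] using y by (intro mult_pos_pos) auto
    have pq: "?p * ?q = s powr 2 * (1 - y\<^sup>2)"
      using s unfolding yy[symmetric] by (simp add: power2_eq_square ac_simps)
    have fact_G: "fact n = Gamma (real n + 1)" using Gamma_fact[of n, where 'a=real] by (simp add: add.commute)
    show ?thesis
    proof (cases "m = 0")
      case True
      define a where "a = (real n + 1) / 2"
      have G: "0 < Gamma a" "0 < Gamma (real n + 1)" by (auto simp: a_def)
      have sn: "s * s powr (2 * (a - 1)) = s ^ n"
      proof -
        have "s * s powr (2 * (a - 1)) = s powr real n"
        proof -
          have "1 + 2 * (a - 1) = real n" by (simp add: a_def field_simps)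
          then show ?thesis using powr_mult_base[of s "2 * (a - 1)"] s by simp
        qed
        then show ?thesis using s by (simp add: powr_realpow)
      qed
      have dup: "Gamma a * Gamma (a + 1/2) = 2 * (1/2) ^ (n + 1) * sqrt pi * Gamma (real n + 1)"
      proof -
        have "1 - 2 * a = - real n" by (simp add: a_def field_simps)
        then have "(2::real) powr (1 - 2 * a) = 2 powr (- real n)" by simp
        also have "\<dots> = 2 * (1/2) ^ (n + 1)" by (simp add: powr_minus powr_realpow power_one_over inverse_eq_divide)
        finally have pw: "(2::real) powr (1 - 2 * a) = 2 * (1/2) ^ (n + 1)" .
        have "2 * a = real n + 1" by (simp add: a_def)
        moreover have "Gamma a * Gamma (a + 1/2) = 2 powr (1 - 2 * a) * sqrt pi * Gamma (2 * a)"
          by (rule Gamma_duplication_real) (simp add: a_def)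
        ultimately show ?thesis unfolding pw by simp
      qed
      have "2 * s * ((1/2) ^ (n + 1) * (?p powr (a - 1) / Gamma a * (?q powr (a - 1) / Gamma a)))
        = 2 * (1/2) ^ (n + 1) / (Gamma a * Gamma a) * (s * (?p * ?q) powr (a - 1))"
        using pos by (simp add: powr_mult)
      also have "(?p * ?q) powr (a - 1) = s powr (2 * (a - 1)) * (1 - y\<^sup>2) powr (a - 1)"
        unfolding pq using y2 by (simp only: powr_mult powr_ge_zero less_imp_le powr_powr)
      also have "s * (s powr (2 * (a - 1)) * (1 - y\<^sup>2) powr (a - 1)) = s ^ n * (1 - y\<^sup>2) powr (a - 1)"
        unfolding sn[symmetric] by simp
      also have "2 * (1/2) ^ (n + 1) / (Gamma a * Gamma a) = Gamma (a + 1/2) / (sqrt pi * Gamma a) / Gamma (real n + 1)"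
      proof -
        have "Gamma (a + 1/2) = 2 * (1/2) ^ (n + 1) * sqrt pi * Gamma (real n + 1) / Gamma a"
          using dup G by (metis less_irrefl nonzero_mult_div_cancel_left)
        moreover have "Gamma a \<noteq> 0" "Gamma (real n + 1) \<noteq> 0" using G by linarith+
        ultimately show ?thesis by simp
      qed
      also have "Gamma (a + 1/2) / (sqrt pi * Gamma a) / Gamma (real n + 1) * (s ^ n * (1 - y\<^sup>2) powr (a - 1))
        = s ^ n / fact n * ?U"
      proof -
        have v: "v_param m n + 1 = a + 1/2" "v_param m n + 1/2 = a" "v_param m n - 1/2 = a - 1"
          using True by (auto simp: v_param_def a_def field_simps)
        have "?U = Gamma (a + 1/2) / (sqrt pi * Gamma a) * (1 - y\<^sup>2) powr (a - 1)"
          unfolding ultraspherical_def v using y by simp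
        then show ?thesis by (simp add: fact_G ac_simps)
      qed
      finally have "2 * s * ((1/2) ^ (n + 1) * (?p powr (a - 1) / Gamma a * (?q powr (a - 1) / Gamma a)))
        = s ^ n / fact n * ?U" .
      then show ?thesis
        using pos s G True by (simp add: cone_density_def power_density_def a_def[symmetric] ennreal_mult'[symmetric])
    next
      case False
      with m have m1: "m = 1" by simp
      define C where "C = 4 ^ (n + 1) * Gamma (real n + 2) / (2 * pi * Gamma (2 * real n + 2))"
      have G: "0 < Gamma (real n + 1)" "0 < Gamma (real n + 3/2)" "0 < Gamma (2 * real n + 2)" "0 < Gamma (real n + 2)" by auto
      have C0: "0 \<le> C" using G by (simp add: C_def)
      have pq2: "(?p * ?q) powr (real n + 1/2) = s powr (2 * real n + 1) * (1 - y\<^sup>2) powr (real n + 1/2)"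
      proof -
        have "2 * (real n + 1/2) = 2 * real n + 1" by simp
        then show ?thesis unfolding pq using y2 by (simp only: powr_mult powr_ge_zero less_imp_le powr_powr)
      qed
      have sum: "?p + ?q = 2 * s" by (simp add: algebra_simps)
      have "s * s powr (2 * real n + 1) / s powr (real n + 2) = s powr (1 + (2 * real n + 1) - (real n + 2))"
        using s by (simp only: powr_add powr_diff powr_one)
      also have "1 + (2 * real n + 1) - (real n + 2) = real n" by simp
      finally have sn: "s * s powr (2 * real n + 1) / s powr (real n + 2) = s ^ n" using s by (simp add: powr_realpow)
      have 2: "(2::real) powr (real n + 2) = 2 ^ (n + 1) * 2"
      proof -
        have "(2::real) powr (real n + 2) = 2 powr (real (n + 2))" by (simp add: add.commute)
        also have "\<dots> = 2 ^ (n + 2)" by (subst powr_realpow) auto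
        finally show ?thesis by simp
      qed
      have CG: "C = Gamma (real n + 2) / (sqrt pi * Gamma (real n + 3/2)) / Gamma (real n + 1)"
      proof -
        have "(2::real) powr (1 - 2 * (real n + 1)) = 2 / 4 ^ (n + 1)"
        proof -
          have "(2::real) powr (1 - 2 * (real n + 1)) = 2 powr 1 / (2 powr 2) powr (real (n + 1))"
            unfolding powr_powr powr_diff[symmetric] by simp
          also have "\<dots> = 2 / 4 ^ (n + 1)" by (subst powr_realpow) auto
          finally show ?thesis .
        qed
        then have "Gamma (real n + 1) * Gamma (real n + 3/2) = 2 / 4 ^ (n + 1) * sqrt pi * Gamma (2 * real n + 2)"
          using Gamma_duplication_real[of "real n + 1"] by (simp add: algebra_simps)
        then have "Gamma (2 * real n + 2) = Gamma (real n + 1) * Gamma (real n + 3/2) * 4 ^ (n + 1) / (2 * sqrt pi)"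
          by (simp add: field_simps)
        then have "C = Gamma (real n + 2) / ((pi / sqrt pi) * Gamma (real n + 3/2)) / Gamma (real n + 1)"
          by (simp add: C_def)
        also have "pi / sqrt pi = sqrt pi" by (simp add: real_div_sqrt)
        finally show ?thesis .
      qed
      have "2 * s * (2 ^ (n + 1) * (C * ((?p * ?q) powr (real n + 1/2) / (?p + ?q) powr (real n + 2))))
         = C * (s * s powr (2 * real n + 1) / s powr (real n + 2)) * (1 - y\<^sup>2) powr (real n + 1/2)"
        unfolding pq2 sum using s by (simp add: powr_mult 2)
      also have "\<dots> = s ^ n / fact n * ?U"
      proof -
        have v: "v_param m n + 1 = real n + 2" "v_param m n + 1/2 = real n + 3/2" "v_param m n - 1/2 = real n + 1/2"
          using m1 by (auto simp: v_param_def)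
        have "?U = Gamma (real n + 2) / (sqrt pi * Gamma (real n + 3/2)) * (1 - y\<^sup>2) powr (real n + 1/2)"
          unfolding ultraspherical_def v using y by simp
        then show ?thesis unfolding sn CG by (simp add: fact_G ac_simps)
      qed
      finally have eq: "2 * s * (2 ^ (n + 1) * (C * ((?p * ?q) powr (real n + 1/2) / (?p + ?q) powr (real n + 2))))
         = s ^ n / fact n * ?U" .
      have lm: "levy_mixture n ?p ?q = ennreal (C * ((?p * ?q) powr (real n + 1/2) / (?p + ?q) powr (real n + 2)))"
        unfolding C_def by (rule levy_mixture_eq[OF pos])
      show ?thesis
        unfolding eq[symmetric] cone_density_def lm using s C0 False by (simp add: ennreal_mult'[symmetric])
    qed
  qed
qed

lemma nn_integral_cone_density:
  fixes h :: "real \<Rightarrow> real \<Rightarrow> ennreal"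
  assumes [measurable]: "case_prod h \<in> borel_measurable (borel \<Otimes>\<^sub>M borel)" and m: "m \<in> {0, 1}"
  shows "(\<integral>\<^sup>+p. (\<integral>\<^sup>+q. cone_density m n p q * h ((p + q) / 2) ((p - q) / 2) \<partial>lborel) \<partial>lborel)
    = (\<integral>\<^sup>+s\<in>{0<..}. (\<integral>\<^sup>+y. ennreal (s ^ n / fact n * ultraspherical (v_param m n) y) * h s (s * y) \<partial>lborel) \<partial>lborel)"
proof -
  let ?c = "cone_density m n" and ?U = "\<lambda>s y. ennreal (s ^ n / fact n * ultraspherical (v_param m n) y)"
  have e: "(p + q) / 2 + (p - q) / 2 = p" "(p + q) / 2 - (p - q) / 2 = q" for p q :: real
    by (simp_all add: field_simps)
  have "(\<integral>\<^sup>+p. (\<integral>\<^sup>+q. ?c p q * h ((p + q) / 2) ((p - q) / 2) \<partial>lborel) \<partial>lborel)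
    = 2 * (\<integral>\<^sup>+s. (\<integral>\<^sup>+x. ?c (s + x) (s - x) * h s x \<partial>lborel) \<partial>lborel)"
    using nn_integral_light_cone[of "\<lambda>s x. ?c (s + x) (s - x) * h s x"] by (simp add: e)
  also have "\<dots> = (\<integral>\<^sup>+s. 2 * (\<integral>\<^sup>+x. ?c (s + x) (s - x) * h s x \<partial>lborel) \<partial>lborel)"
    by (rule nn_integral_cmult[symmetric]) simp
  also have "\<dots> = (\<integral>\<^sup>+s\<in>{0<..}. (\<integral>\<^sup>+y. ?U s y * h s (s * y) \<partial>lborel) \<partial>lborel)"
  proof (rule nn_integral_cong)
    fix s :: real
    show "2 * (\<integral>\<^sup>+x. ?c (s + x) (s - x) * h s x \<partial>lborel)
      = (\<integral>\<^sup>+y. ?U s y * h s (s * y) \<partial>lborel) * indicator {0<..} s"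
    proof (cases "0 < s")
      case False
      have z: "?c (s + x) (s - x) = 0" for x
        using False by (intro cone_density_neg) linarith
      show ?thesis using False by (simp add: z)
    next
      case s: True
      have e: "s + s * y = s * (1 + y)" "s - s * y = s * (1 - y)" for y by (auto simp: algebra_simps)
      have "2 * (\<integral>\<^sup>+x. ?c (s + x) (s - x) * h s x \<partial>lborel)
        = ennreal (2 * s) * (\<integral>\<^sup>+y. ?c (s * (1 + y)) (s * (1 - y)) * h s (s * y) \<partial>lborel)"
        using s by (subst nn_integral_real_affine[where c=s and t=0]) (simp_all add: e ennreal_mult' mult.assoc)
      also have "\<dots> = (\<integral>\<^sup>+y. ennreal (2 * s) * ?c (s * (1 + y)) (s * (1 - y)) * h s (s * y) \<partial>lborel)"
        by (simp add: nn_integral_cmult[symmetric] mult.assoc)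
      finally show ?thesis using s by (simp add: cone_density_eq[OF m s])
    qed
  qed
  finally show ?thesis .
qed

lemma angle_density_measurable[measurable]: "angle_density m \<in> borel_measurable borel"
  unfolding angle_density_def by measurable

text \<open>The substitution y = cos t, preceded by a reflection so that the substituted function -
  cos is increasing. Its Jacobian sin t accounts for the difference between sin^(2 m) t and (1 -
  y^2)^(m - 1/2).\<close>

lemma nn_integral_angle:
  fixes k :: "real \<Rightarrow> ennreal"
  assumes [measurable]: "k \<in> borel_measurable borel"
  shows "(\<integral>\<^sup>+\<theta>. ennreal (angle_density m \<theta>) * k (cos \<theta>) \<partial>lborel) = (\<integral>\<^sup>+y. ennreal (ultraspherical (real m) y) * k y \<partial>lborel)"
proof -
  let ?u = "ultraspherical (real m)"
  have "(\<integral>\<^sup>+y. ennreal (?u y) * k y \<partial>lborel) = (\<integral>\<^sup>+y. ennreal (?u (- y)) * k (- y) \<partial>lborel)"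
    by (rule nn_integral_reflect[symmetric]) simp
  also have "\<dots> = (\<integral>\<^sup>+y. ennreal (?u (- y)) * k (- y) * indicator {- cos 0..- cos pi} y \<partial>lborel)"
    by (intro nn_integral_cong) (auto simp: ultraspherical_def indicator_def)
  also have "\<dots> = (\<integral>\<^sup>+\<theta>. ennreal (?u (- (- cos \<theta>))) * k (- (- cos \<theta>)) * ennreal (sin \<theta>) * indicator {0..pi} \<theta> \<partial>lborel)"
    by (rule nn_integral_substitution_aux)
       (auto intro!: derivative_eq_intros continuous_intros sin_ge_zero)
  also have "\<dots> = (\<integral>\<^sup>+\<theta>. ennreal (angle_density m \<theta>) * k (cos \<theta>) \<partial>lborel)"
  proof (rule nn_integral_cong)
    fix \<theta> :: real
    consider "0 < \<theta> \<and> \<theta> < pi" | "\<theta> = 0 \<or> \<theta> = pi" | "\<theta> < 0 \<or> pi < \<theta>" by linarith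
    then show "ennreal (?u (- (- cos \<theta>))) * k (- (- cos \<theta>)) * ennreal (sin \<theta>) * indicator {0..pi} \<theta> = ennreal (angle_density m \<theta>) * k (cos \<theta>)"
    proof cases
      case 1
      then have sn: "0 < sin \<theta>" by (simp add: sin_gt_zero)
      have c: "1 - (cos \<theta>)\<^sup>2 = sin \<theta> powr 2" using sn by (simp add: sin_squared_eq)
      have "(cos \<theta>)\<^sup>2 < 1" using sn sin_squared_eq[of \<theta>] by (metis diff_gt_0_iff_gt zero_less_power)
      then have c1: "\<bar>cos \<theta>\<bar> < 1" by (simp add: abs_square_less_1)
      have "(1 - (cos \<theta>)\<^sup>2) powr (real m - 1/2) * sin \<theta> = sin \<theta> powr (2 * real m - 1) * sin \<theta>"
        unfolding c powr_powr by (simp add: algebra_simps)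
      also have "\<dots> = sin \<theta> powr (2 * real m)" using powr_mult_base[of "sin \<theta>" "2 * real m - 1"] sn by (simp add: mult.commute)
      also have "\<dots> = sin \<theta> ^ (2 * m)" using powr_realpow[OF sn, of "2 * m"] by simp
      finally have "?u (cos \<theta>) * sin \<theta> = angle_density m \<theta>"
        using 1 c1 by (simp add: ultraspherical_def angle_density_def mult.assoc)
      then have "ennreal (?u (cos \<theta>)) * ennreal (sin \<theta>) = ennreal (angle_density m \<theta>)"
        using sn by (simp add: ennreal_mult''[symmetric])
      note eq = this
      have "ennreal (?u (cos \<theta>)) * k (cos \<theta>) * ennreal (sin \<theta>) = ennreal (angle_density m \<theta>) * k (cos \<theta>)"
        unfolding eq[symmetric] by (simp only: ac_simps)
      then show ?thesis using 1 by simp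
    qed (auto simp: angle_density_def ultraspherical_def)
  qed
  finally show ?thesis by simp
qed

text \<open>The pair (length, displacement) of a step enters additively, and p and q are linear in
  it. So both the old endpoint and the new step are rewritten in light-cone coordinates, where the
  semigroup law applies, and the result is translated back. For a single step the parameter
  \<open>v_param m 0\<close> equals m.\<close>

lemma nn_integral_add_step:
  fixes h :: "real \<Rightarrow> real \<Rightarrow> ennreal"
  assumes [measurable]: "case_prod h \<in> borel_measurable (borel \<Otimes>\<^sub>M borel)" and m: "m \<in> {0, 1}"
  shows "(\<integral>\<^sup>+s\<in>{0<..}. (\<integral>\<^sup>+y. ennreal (s ^ n / fact n * ultraspherical (v_param m n) y) *
      (\<integral>\<^sup>+e\<in>{0<..}. (\<integral>\<^sup>+\<theta>. ennreal (angle_density m \<theta>) * h (s + e) (s * y + e * cos \<theta>) \<partial>lborel) \<partial>lborel) \<partial>lborel) \<partial>lborel)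
    = (\<integral>\<^sup>+s\<in>{0<..}. (\<integral>\<^sup>+y. ennreal (s ^ Suc n / fact (Suc n) * ultraspherical (v_param m (Suc n)) y) * h s (s * y) \<partial>lborel) \<partial>lborel)"
proof -
  have step: "(\<integral>\<^sup>+e\<in>{0<..}. (\<integral>\<^sup>+\<theta>. ennreal (angle_density m \<theta>) * g e (e * cos \<theta>) \<partial>lborel) \<partial>lborel)
     = (\<integral>\<^sup>+p. (\<integral>\<^sup>+q. cone_density m 0 p q * g ((p + q) / 2) ((p - q) / 2) \<partial>lborel) \<partial>lborel)"
    if [measurable]: "case_prod g \<in> borel_measurable (borel \<Otimes>\<^sub>M borel)" for g :: "real \<Rightarrow> real \<Rightarrow> ennreal"
  proof -
    have v: "v_param m 0 = real m" using m by (auto simp: v_param_def)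
    show ?thesis
      unfolding nn_integral_cone_density[OF that m] v
      by (rule set_nn_integral_cong[OF refl refl], subst nn_integral_angle) auto
  qed
  have "(\<integral>\<^sup>+s\<in>{0<..}. (\<integral>\<^sup>+y. ennreal (s ^ n / fact n * ultraspherical (v_param m n) y) *
      (\<integral>\<^sup>+e\<in>{0<..}. (\<integral>\<^sup>+\<theta>. ennreal (angle_density m \<theta>) * h (s + e) (s * y + e * cos \<theta>) \<partial>lborel) \<partial>lborel) \<partial>lborel) \<partial>lborel)
    = (\<integral>\<^sup>+p. (\<integral>\<^sup>+q. cone_density m n p q * (\<integral>\<^sup>+e\<in>{0<..}. (\<integral>\<^sup>+\<theta>. ennreal (angle_density m \<theta>) * h ((p + q) / 2 + e) ((p - q) / 2 + e * cos \<theta>) \<partial>lborel) \<partial>lborel) \<partial>lborel) \<partial>lborel)"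
    by (subst nn_integral_cone_density[OF _ m]) auto
  also have "\<dots> = (\<integral>\<^sup>+p. (\<integral>\<^sup>+q. cone_density m n p q * (\<integral>\<^sup>+p'. (\<integral>\<^sup>+q'. cone_density m 0 p' q' *
       h ((p + q) / 2 + (p' + q') / 2) ((p - q) / 2 + (p' - q') / 2) \<partial>lborel) \<partial>lborel) \<partial>lborel) \<partial>lborel)"
    by (subst step) auto
  also have "\<dots> = (\<integral>\<^sup>+p. (\<integral>\<^sup>+q. cone_density m n p q * (\<integral>\<^sup>+p'. (\<integral>\<^sup>+q'. cone_density m 0 p' q' *
       h (((p + p') + (q + q')) / 2) (((p + p') - (q + q')) / 2) \<partial>lborel) \<partial>lborel) \<partial>lborel) \<partial>lborel)"
    by (intro nn_integral_cong arg_cong2[where f="(*)"] refl arg_cong2[where f=h]) (simp_all add: field_simps)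
  also have "\<dots> = (\<integral>\<^sup>+p. (\<integral>\<^sup>+q. cone_density m (Suc n) p q * h ((p + q) / 2) ((p - q) / 2) \<partial>lborel) \<partial>lborel)"
    by (rule cone_density_convolution[where h="\<lambda>p q. h ((p + q) / 2) ((p - q) / 2)"]) simp
  finally show ?thesis by (simp only: nn_integral_cone_density[OF assms])
qed

section \<open>The flight at a fixed time\<close>

lemma space_process_sigma[simp]: "space (process_sigma M I Y) = space M"
  by (simp add: process_sigma_def)

lemma measurable_process_sigma:
  assumes "i \<in> I"
  shows "Y i \<in> borel_measurable (process_sigma M I Y)"
proof -
  have "(\<lambda>\<omega>. \<lambda>i\<in>I. Y i \<omega>) \<in> process_sigma M I Y \<rightarrow>\<^sub>M (\<Pi>\<^sub>M i\<in>I. borel)"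
    unfolding process_sigma_def by (rule measurable_vimage_algebra1) (auto simp: space_PiM)
  then have "(\<lambda>\<omega>. (\<lambda>i\<in>I. Y i \<omega>) i) \<in> borel_measurable (process_sigma M I Y)"
    by (rule measurable_compose) (rule measurable_component_singleton[OF assms])
  then show ?thesis using assms by simp
qed

section \<open>Independence as replacement by an independent copy\<close>

lemma (in prob_space) nn_integral_indep_var:
  assumes "indep_var N X N' Y" and [measurable]: "f \<in> borel_measurable (N \<Otimes>\<^sub>M N')"
  shows "(\<integral>\<^sup>+\<omega>. f (X \<omega>, Y \<omega>) \<partial>M) = (\<integral>\<^sup>+\<omega>. (\<integral>\<^sup>+\<omega>'. f (X \<omega>, Y \<omega>') \<partial>M) \<partial>M)"
proof -
  from assms(1) have [measurable]: "X \<in> M \<rightarrow>\<^sub>M N" "Y \<in> M \<rightarrow>\<^sub>M N'"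
    and d: "distr M N X \<Otimes>\<^sub>M distr M N' Y = distr M (N \<Otimes>\<^sub>M N') (\<lambda>\<omega>. (X \<omega>, Y \<omega>))"
    by (auto simp: indep_var_distribution_eq)
  interpret Y: prob_space "distr M N' Y" by (rule prob_space_distr) simp
  have "(\<integral>\<^sup>+\<omega>. f (X \<omega>, Y \<omega>) \<partial>M) = (\<integral>\<^sup>+z. f z \<partial>(distr M N X \<Otimes>\<^sub>M distr M N' Y))"
    unfolding d by (simp add: nn_integral_distr)
  also have "\<dots> = (\<integral>\<^sup>+x. (\<integral>\<^sup>+y. f (x, y) \<partial>distr M N' Y) \<partial>distr M N X)"
    by (rule Y.nn_integral_fst[symmetric]) simp
  also have "\<dots> = (\<integral>\<^sup>+x. (\<integral>\<^sup>+\<omega>'. f (x, Y \<omega>') \<partial>M) \<partial>distr M N X)"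
    by (intro nn_integral_cong) (simp add: nn_integral_distr)
  also have "\<dots> = (\<integral>\<^sup>+\<omega>. (\<integral>\<^sup>+\<omega>'. f (X \<omega>, Y \<omega>') \<partial>M) \<partial>M)"
    by (subst nn_integral_distr) simp_all
  finally show ?thesis .
qed

text \<open>The measurability of f refers to the product of the two sub-sigma-algebras, since
  independence is known only for them. For random times this is what joint measurability with
  respect to the generated sigma-algebra provides.\<close>

lemma (in prob_space) nn_integral_indep_set:
  assumes ind: "indep_set (sets A) (sets B)" and sp: "space A = space M" "space B = space M"
    and f: "f \<in> borel_measurable (A \<Otimes>\<^sub>M B)"
  shows "(\<integral>\<^sup>+\<omega>. f (\<omega>, \<omega>) \<partial>M) = (\<integral>\<^sup>+\<omega>. (\<integral>\<^sup>+\<omega>'. f (\<omega>, \<omega>') \<partial>M) \<partial>M)"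
proof -
  have sub: "sets A \<subseteq> events" "sets B \<subseteq> events" using ind by (auto simp: indep_sets2_eq)
  \<comment> \<open>The identity map is regarded as two random elements, with values in the
    measurable spaces \<open>A\<close> and \<open>B\<close>.\<close>
  have "(\<lambda>\<omega>. \<omega>) \<in> M \<rightarrow>\<^sub>M A" "(\<lambda>\<omega>. \<omega>) \<in> M \<rightarrow>\<^sub>M B"
    using sub sp sets.sets_into_space by (auto simp: measurable_def Int_absorb2 subset_iff)
  moreover have "sigma_sets (space M) {(\<lambda>\<omega>. \<omega>) -` C \<inter> space M |C. C \<in> sets A} \<subseteq> sets A"
    unfolding sp(1)[symmetric] by (rule sets.sigma_sets_subset) auto
  moreover have "sigma_sets (space M) {(\<lambda>\<omega>. \<omega>) -` C \<inter> space M |C. C \<in> sets B} \<subseteq> sets B"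
    unfolding sp(2)[symmetric] by (rule sets.sigma_sets_subset) auto
  ultimately have "indep_var A (\<lambda>\<omega>. \<omega>) B (\<lambda>\<omega>. \<omega>)"
    using ind unfolding indep_var_eq indep_sets2_eq by blast
  then show ?thesis using f by (rule nn_integral_indep_var)
qed

lemma (in prob_space) nn_integral_indep_vars_last:
  assumes ind: "indep_vars (\<lambda>_. borel) X I" and i: "i \<in> I" "i \<notin> J" "J \<subseteq> I"
    and f: "(\<lambda>(v, e). f v e) \<in> borel_measurable ((\<Pi>\<^sub>M j\<in>J. borel) \<Otimes>\<^sub>M borel)"
  shows "(\<integral>\<^sup>+\<omega>. f (\<lambda>j\<in>J. X j \<omega>) (X i \<omega>) \<partial>M) = (\<integral>\<^sup>+\<omega>. (\<integral>\<^sup>+\<omega>'. f (\<lambda>j\<in>J. X j \<omega>) (X i \<omega>') \<partial>M) \<partial>M)"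
proof -
  have "indep_var (\<Pi>\<^sub>M j\<in>J. borel) (\<lambda>\<omega>. \<lambda>j\<in>J. X j \<omega>) (\<Pi>\<^sub>M j\<in>{i}. borel) (\<lambda>\<omega>. \<lambda>j\<in>{i}. X j \<omega>)"
    using i by (intro indep_var_restrict[OF ind]) auto
  moreover have "(\<lambda>(v, w). (\<lambda>(v, e). f v e) (v, w i)) \<in> borel_measurable ((\<Pi>\<^sub>M j\<in>J. borel) \<Otimes>\<^sub>M (\<Pi>\<^sub>M j\<in>{i}. borel))"
    unfolding case_prod_beta
    by (rule measurable_compose[OF _ f[unfolded case_prod_beta]], rule measurable_Pair)
       (auto intro!: measurable_compose[OF measurable_snd measurable_component_singleton])
  ultimately show ?thesis
    by (auto dest!: nn_integral_indep_var)
qed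

lemma (in prob_space) nn_integral_distributed:
  assumes "distributed M lborel X (\<lambda>x. ennreal (d x))" and [measurable]: "f \<in> borel_measurable borel"
  shows "(\<integral>\<^sup>+\<omega>. f (X \<omega>) \<partial>M) = (\<integral>\<^sup>+x. ennreal (d x) * f x \<partial>lborel)"
  using distributed_nn_integral[OF assms(1), of f] by simp

section \<open>The endpoint of n + 1 complete steps\<close>

locale poisson_angles = prob_space M for M :: "'a measure" +
  fixes lam :: real and m :: nat and S \<theta> :: "nat \<Rightarrow> 'a \<Rightarrow> real"
  assumes lam: "0 < lam" and m: "m \<in> {0, 1}"
    and poisson: "poisson_event_times M lam S" and angles: "iid_angles M m \<theta>"
    and indep: "indep_set (sets (process_sigma M UNIV S)) (sets (process_sigma M {1..} \<theta>))"
begin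

text \<open>Steps are numbered from 0 and angles from 1, so \<open>step j\<close> belongs to the
  angle with index \<open>Suc j\<close>. Positions are taken at unit speed; the factor c is applied
  at the very end.\<close>

definition "step j \<omega> = S (Suc j) \<omega> - S j \<omega>"
definition "position n \<omega> = (\<Sum>j<n. step j \<omega> * cos (\<theta> (Suc j) \<omega>))"

lemma S_0: "\<omega> \<in> space M \<Longrightarrow> S 0 \<omega> = 0"
  and step_indep: "indep_vars (\<lambda>_. borel) step UNIV"
  and step_distributed: "distributed M lborel (step j) (exponential_density lam)"
  using poisson unfolding poisson_event_times_def step_def[abs_def] by auto

lemma angle_indep: "indep_vars (\<lambda>_. borel) \<theta> {1..}"
  and angle_distributed: "1 \<le> j \<Longrightarrow> distributed M lborel (\<theta> j) (angle_density m)"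
  using angles unfolding iid_angles_def by auto

lemma S_eq_sum: "\<omega> \<in> space M \<Longrightarrow> S n \<omega> = (\<Sum>j<n. step j \<omega>)"
  by (induction n) (auto simp: S_0 step_def)

lemma step_measurable[measurable]: "step j \<in> borel_measurable M"
  using distributed_measurable[OF step_distributed] by simp

lemma angle_measurable: "1 \<le> j \<Longrightarrow> \<theta> j \<in> borel_measurable M"
  using distributed_measurable[OF angle_distributed] by simp

lemma angle_Suc_measurable[measurable]: "\<theta> (Suc j) \<in> borel_measurable M"
  by (rule angle_measurable) simp

lemma S_measurable[measurable]: "S n \<in> borel_measurable M"
  by (subst measurable_cong[OF S_eq_sum]) auto

lemma position_measurable[measurable]: "position n \<in> borel_measurable M"
  unfolding position_def by measurable

text \<open>The pair of the new step and its angle must be separated from the past, although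
  \<open>position n\<close> mixes both sequences, while independence is given only between the
  sequences and within each. The remedy is to let the event times depend on one sample point and the
  angles on another: then the last angle can be replaced with the event times frozen, and the last
  step with the angles frozen.\<close>

lemma nn_integral_last_step:
  fixes h :: "real \<Rightarrow> real \<Rightarrow> real \<Rightarrow> real \<Rightarrow> ennreal"
  assumes h: "(\<lambda>(s, x, e, t). h s x e t) \<in> borel_measurable (borel \<Otimes>\<^sub>M borel \<Otimes>\<^sub>M borel \<Otimes>\<^sub>M borel)"
  shows "(\<integral>\<^sup>+\<omega>. h (S n \<omega>) (position n \<omega>) (step n \<omega>) (\<theta> (Suc n) \<omega>) \<partial>M)
    = (\<integral>\<^sup>+\<omega>. (\<integral>\<^sup>+e. (\<integral>\<^sup>+t. ennreal (exponential_density lam e) * (ennreal (angle_density m t) * h (S n \<omega>) (position n \<omega>) e t) \<partial>lborel) \<partial>lborel) \<partial>M)"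
proof -
  let ?PA = "(\<Pi>\<^sub>M j\<in>{Suc 0..<Suc n}. borel) \<Otimes>\<^sub>M (borel :: real measure)"
  let ?PE = "(\<Pi>\<^sub>M j\<in>{..<n}. borel :: real measure) \<Otimes>\<^sub>M (borel :: real measure)"
  let ?d = "\<lambda>e. ennreal (exponential_density lam e)"
  have hm[measurable (raw)]: "(\<lambda>p. h (a p) (b p) (c p) (d p)) \<in> borel_measurable N"
    if [measurable]: "a \<in> borel_measurable N" "b \<in> borel_measurable N" "c \<in> borel_measurable N" "d \<in> borel_measurable N"
    for a b c d :: "'b \<Rightarrow> real" and N
    using measurable_compose[OF _ h, of "\<lambda>p. (a p, b p, c p, d p)" N] by simp
  define A where "A = process_sigma M UNIV S"
  define B where "B = process_sigma M {1..} \<theta>"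
  have ind: "indep_set (sets A) (sets B)" using indep by (simp add: A_def B_def)
  have sp: "space A = space M" "space B = space M" by (auto simp: A_def B_def)
  have [measurable]: "step j \<in> borel_measurable A" for j
    unfolding step_def[abs_def] A_def by (intro borel_measurable_diff measurable_process_sigma) auto
  have [measurable]: "\<theta> (Suc j) \<in> borel_measurable B" for j
    unfolding B_def by (intro measurable_process_sigma) auto
  interpret MM: pair_sigma_finite M M ..
  define s where "s \<omega> = (\<Sum>j<n. step j \<omega>)" for \<omega>
  define x where "x \<omega> \<omega>' = (\<Sum>j<n. step j \<omega> * cos (\<theta> (Suc j) \<omega>'))" for \<omega> \<omega>'
  let ?A = "\<lambda>\<omega> \<omega>' e. \<integral>\<^sup>+t. ennreal (angle_density m t) * h (s \<omega>) (x \<omega> \<omega>') e t \<partial>lborel"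
  have sm[measurable]: "s \<in> borel_measurable M" "s \<in> borel_measurable A" unfolding s_def by measurable
  have xm[measurable]: "(\<lambda>(\<omega>, \<omega>'). x \<omega> \<omega>') \<in> borel_measurable (M \<Otimes>\<^sub>M M)" "(\<lambda>(\<omega>, \<omega>'). x \<omega> \<omega>') \<in> borel_measurable (A \<Otimes>\<^sub>M B)"
    unfolding x_def by measurable
  note ang = nn_integral_distributed[OF angle_distributed[of "Suc n"]]
  note ste = nn_integral_distributed[OF step_distributed[of n]]
  have S: "S n \<omega> = s \<omega>" and X: "position n \<omega> = x \<omega> \<omega>" if "\<omega> \<in> space M" for \<omega>
    using that by (simp_all add: S_eq_sum s_def position_def x_def)
  have "(\<integral>\<^sup>+\<omega>. h (S n \<omega>) (position n \<omega>) (step n \<omega>) (\<theta> (Suc n) \<omega>) \<partial>M)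
     = (\<integral>\<^sup>+\<omega>. (\<lambda>(\<omega>, \<omega>'). h (s \<omega>) (x \<omega> \<omega>') (step n \<omega>) (\<theta> (Suc n) \<omega>')) (\<omega>, \<omega>) \<partial>M)"
    by (intro nn_integral_cong) (simp add: S X)
  also have "\<dots> = (\<integral>\<^sup>+\<omega>. (\<integral>\<^sup>+\<omega>'. h (s \<omega>) (x \<omega> \<omega>') (step n \<omega>) (\<theta> (Suc n) \<omega>') \<partial>M) \<partial>M)"
  proof (subst nn_integral_indep_set[OF ind sp])
    have [measurable]: "(\<lambda>p. s (fst p)) \<in> borel_measurable (A \<Otimes>\<^sub>M B)" "(\<lambda>p. step n (fst p)) \<in> borel_measurable (A \<Otimes>\<^sub>M B)"
      "(\<lambda>p. \<theta> (Suc n) (snd p)) \<in> borel_measurable (A \<Otimes>\<^sub>M B)" "(\<lambda>p. x (fst p) (snd p)) \<in> borel_measurable (A \<Otimes>\<^sub>M B)"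
      using xm by (auto simp: case_prod_beta intro!: measurable_compose[OF measurable_fst] measurable_compose[OF measurable_snd])
    show "(\<lambda>(\<omega>, \<omega>'). h (s \<omega>) (x \<omega> \<omega>') (step n \<omega>) (\<theta> (Suc n) \<omega>')) \<in> borel_measurable (A \<Otimes>\<^sub>M B)"
      unfolding case_prod_beta by measurable
  qed simp
  also have "\<dots> = (\<integral>\<^sup>+\<omega>. (\<integral>\<^sup>+\<omega>'. (?A \<omega> \<omega>' (step n \<omega>)) \<partial>M) \<partial>M)"
  proof (rule nn_integral_cong)
    fix \<omega> assume "\<omega> \<in> space M"
    define f where "f w t = h (s \<omega>) (\<Sum>j<n. step j \<omega> * cos (w (Suc j))) (step n \<omega>) t" for w t
    have [measurable]: "(\<lambda>(w, t). f w t) \<in> borel_measurable ((\<Pi>\<^sub>M j\<in>{Suc 0..<Suc n}. borel) \<Otimes>\<^sub>M borel)"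
    proof -
      have [measurable]: "(\<lambda>p. \<Sum>j<n. step j \<omega> * cos (fst p (Suc j))) \<in> borel_measurable (?PA)"
      proof (rule borel_measurable_sum)
        fix j assume "j \<in> {..<n}"
        then have [measurable]: "(\<lambda>p. fst p (Suc j)) \<in> borel_measurable (?PA)"
          by (intro measurable_compose[OF measurable_fst measurable_component_singleton]) auto
        show "(\<lambda>p. step j \<omega> * cos (fst p (Suc j))) \<in> borel_measurable (?PA)"
          by measurable
      qed
      show ?thesis unfolding f_def case_prod_beta by measurable
    qed
    have "x \<omega> \<omega>' = (\<Sum>j<n. step j \<omega> * cos ((\<lambda>j\<in>{Suc 0..<Suc n}. \<theta> j \<omega>') (Suc j)))" for \<omega>'
      by (simp add: x_def)
    then have f: "h (s \<omega>) (x \<omega> \<omega>') (step n \<omega>) t = f (\<lambda>j\<in>{Suc 0..<Suc n}. \<theta> j \<omega>') t" for \<omega>' t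
      by (simp add: f_def)
    have [measurable]: "f w \<in> borel_measurable borel" for w
      unfolding f_def by measurable
    show "(\<integral>\<^sup>+\<omega>'. h (s \<omega>) (x \<omega> \<omega>') (step n \<omega>) (\<theta> (Suc n) \<omega>') \<partial>M)
       = (\<integral>\<^sup>+\<omega>'. (?A \<omega> \<omega>' (step n \<omega>)) \<partial>M)"
      unfolding f by (subst nn_integral_indep_vars_last[OF angle_indep]) (auto simp: ang)
  qed
  \<comment> \<open>Now the angles are to be frozen, so the sample point of the event times becomes
    the inner variable.\<close>
  also have "\<dots> = (\<integral>\<^sup>+\<omega>'. (\<integral>\<^sup>+\<omega>. (?A \<omega> \<omega>' (step n \<omega>)) \<partial>M) \<partial>M)"
    by (rule MM.Fubini') simp
  also have "\<dots> = (\<integral>\<^sup>+\<omega>'. (\<integral>\<^sup>+\<omega>. (\<integral>\<^sup>+e. ?d e * (?A \<omega> \<omega>' e) \<partial>lborel) \<partial>M) \<partial>M)"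
  proof (rule nn_integral_cong)
    fix \<omega>' assume "\<omega>' \<in> space M"
    define f where "f v e = (\<integral>\<^sup>+t. ennreal (angle_density m t) * h (\<Sum>j<n. v j) (\<Sum>j<n. v j * cos (\<theta> (Suc j) \<omega>')) e t \<partial>lborel)" for v e
    have [measurable]: "(\<lambda>(v, e). f v e) \<in> borel_measurable ((\<Pi>\<^sub>M j\<in>{..<n}. borel) \<Otimes>\<^sub>M borel)"
    proof -
      have j: "(\<lambda>p. fst p j) \<in> borel_measurable (?PE)" if "j \<in> {..<n}" for j
        using that by (intro measurable_compose[OF measurable_fst measurable_component_singleton])
      have [measurable]: "(\<lambda>p. \<Sum>j<n. fst p j) \<in> borel_measurable (?PE)"
        by (rule borel_measurable_sum[of "{..<n}" "\<lambda>j p. fst p j", OF j])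
      have [measurable]: "(\<lambda>p. \<Sum>j<n. fst p j * cos (\<theta> (Suc j) \<omega>')) \<in> borel_measurable (?PE)"
        by (intro borel_measurable_sum borel_measurable_times j) simp_all
      show ?thesis unfolding f_def case_prod_beta by measurable
    qed
    have "x \<omega> \<omega>' = (\<Sum>j<n. (\<lambda>j\<in>{..<n}. step j \<omega>) j * cos (\<theta> (Suc j) \<omega>'))" "s \<omega> = (\<Sum>j<n. (\<lambda>j\<in>{..<n}. step j \<omega>) j)" for \<omega>
      by (simp_all add: x_def s_def)
    then have f: "(?A \<omega> \<omega>' e) = f (\<lambda>j\<in>{..<n}. step j \<omega>) e" for \<omega> e
      by (simp only: f_def)
    have [measurable]: "f v \<in> borel_measurable borel" for v
      unfolding f_def by measurable
    show "(\<integral>\<^sup>+\<omega>. (?A \<omega> \<omega>' (step n \<omega>)) \<partial>M)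
       = (\<integral>\<^sup>+\<omega>. (\<integral>\<^sup>+e. ?d e * (?A \<omega> \<omega>' e) \<partial>lborel) \<partial>M)"
      unfolding f by (subst nn_integral_indep_vars_last[OF step_indep]) (simp_all add: ste)
  qed
  also have "\<dots> = (\<integral>\<^sup>+\<omega>. (\<integral>\<^sup>+\<omega>'. (\<integral>\<^sup>+e. ?d e * (?A \<omega> \<omega>' e) \<partial>lborel) \<partial>M) \<partial>M)"
    by (rule MM.Fubini') simp
  \<comment> \<open>The two sample points are identified again: independence of the two sequences is
    used in the reverse direction.\<close>
  also have "\<dots> = (\<integral>\<^sup>+\<omega>. (\<lambda>(\<omega>, \<omega>'). \<integral>\<^sup>+e. ?d e * (?A \<omega> \<omega>' e) \<partial>lborel) (\<omega>, \<omega>) \<partial>M)"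
    by (subst nn_integral_indep_set[OF ind sp]) simp_all
  also have "\<dots> = (\<integral>\<^sup>+\<omega>. (\<integral>\<^sup>+e. (\<integral>\<^sup>+t. ennreal (exponential_density lam e) * (ennreal (angle_density m t) * h (S n \<omega>) (position n \<omega>) e t) \<partial>lborel) \<partial>lborel) \<partial>M)"
    by (intro nn_integral_cong) (simp add: S X nn_integral_cmult)
  finally show ?thesis .
qed

text \<open>The product of the exponential densities of the steps depends on their total length
  only. It can therefore be moved into the test function, and what remains is the addition of steps
  with Lebesgue-distributed lengths.\<close>

lemma nn_integral_endpoint:
  fixes h :: "real \<Rightarrow> real \<Rightarrow> ennreal"
  assumes h: "case_prod h \<in> borel_measurable (borel \<Otimes>\<^sub>M borel)"
  shows "(\<integral>\<^sup>+\<omega>. h (S (Suc n) \<omega>) (position (Suc n) \<omega>) \<partial>M)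
    = (\<integral>\<^sup>+s\<in>{0<..}. (\<integral>\<^sup>+y. ennreal (s ^ n / fact n * ultraspherical (v_param m n) y) *
        (ennreal (lam ^ Suc n * exp (- (lam * s))) * h s (s * y)) \<partial>lborel) \<partial>lborel)"
  using h
proof (induction n arbitrary: h)
  case (0 h)
  let ?d = "\<lambda>e. ennreal (exponential_density lam e)" and ?a = "\<lambda>t. ennreal (angle_density m t)"
  note [measurable] = 0
  have v: "v_param m 0 = real m" using m by (auto simp: v_param_def)
  have "(\<integral>\<^sup>+\<omega>. h (S (Suc 0) \<omega>) (position (Suc 0) \<omega>) \<partial>M) = (\<integral>\<^sup>+\<omega>. h (step 0 \<omega>) (step 0 \<omega> * cos (\<theta> (Suc 0) \<omega>)) \<partial>M)"
    by (intro nn_integral_cong) (simp add: S_eq_sum position_def)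
  also have "\<dots> = (\<integral>\<^sup>+e. (\<integral>\<^sup>+t. ?d e * (?a t * h e (e * cos t)) \<partial>lborel) \<partial>lborel)"
    by (subst nn_integral_last_step[where h="\<lambda>s x e t. h e (e * cos t)"]) (simp_all add: emeasure_space_1)
  also have "\<dots> = (\<integral>\<^sup>+e. ?d e * (\<integral>\<^sup>+t. ?a t * h e (e * cos t) \<partial>lborel) \<partial>lborel)"
    by (simp add: nn_integral_cmult)
  also have "\<dots> = (\<integral>\<^sup>+e. ?d e * (\<integral>\<^sup>+y. ennreal (ultraspherical (real m) y) * h e (e * y) \<partial>lborel) \<partial>lborel)"
    by (subst nn_integral_angle[where k="\<lambda>y. h e (e * y)" for e]) simp_all
  also have "\<dots> = (\<integral>\<^sup>+s\<in>{0<..}. (\<integral>\<^sup>+y. ennreal (s ^ 0 / fact 0 * ultraspherical (v_param m 0) y) *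
        (ennreal (lam ^ Suc 0 * exp (- (lam * s))) * h s (s * y)) \<partial>lborel) \<partial>lborel)"
    unfolding v
  proof (rule nn_integral_cong_AE)
    have "AE s in lborel. s \<noteq> (0::real)" by (rule AE_lborel_singleton)
    then show "AE s in lborel. ?d s * (\<integral>\<^sup>+y. ennreal (ultraspherical (real m) y) * h s (s * y) \<partial>lborel)
       = (\<integral>\<^sup>+y. ennreal (s ^ 0 / fact 0 * ultraspherical (real m) y) *
        (ennreal (lam ^ Suc 0 * exp (- (lam * s))) * h s (s * y)) \<partial>lborel) * indicator {0<..} s"
    proof eventually_elim
      case (elim s)
      then show ?case
        by (cases "0 < s")
           (simp_all add: exponential_density_def nn_integral_cmult[symmetric] mult.commute mult.left_commute)
    qed
  qed
  finally show ?case .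
next
  case (Suc n h)
  let ?d = "\<lambda>e. ennreal (exponential_density lam e)" and ?a = "\<lambda>t. ennreal (angle_density m t)"
  let ?U = "\<lambda>n. ultraspherical (v_param m n)"
  note [measurable] = Suc.prems
  let ?E = "\<lambda>k s. ennreal (lam ^ k * exp (- (lam * s)))"
  define g where "g s x = (\<integral>\<^sup>+e. (\<integral>\<^sup>+t. ?d e * (?a t * h (s + e) (x + e * cos t)) \<partial>lborel) \<partial>lborel)" for s x
  have [measurable]: "case_prod g \<in> borel_measurable (borel \<Otimes>\<^sub>M borel)" unfolding g_def by measurable
  have "(\<integral>\<^sup>+\<omega>. h (S (Suc (Suc n)) \<omega>) (position (Suc (Suc n)) \<omega>) \<partial>M)
     = (\<integral>\<^sup>+\<omega>. h (S (Suc n) \<omega> + step (Suc n) \<omega>) (position (Suc n) \<omega> + step (Suc n) \<omega> * cos (\<theta> (Suc (Suc n)) \<omega>)) \<partial>M)"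
    by (intro nn_integral_cong) (simp add: S_eq_sum position_def)
  also have "\<dots> = (\<integral>\<^sup>+\<omega>. g (S (Suc n) \<omega>) (position (Suc n) \<omega>) \<partial>M)"
    unfolding g_def by (subst nn_integral_last_step[where h="\<lambda>s x e t. h (s + e) (x + e * cos t)"]) simp_all
  also have "\<dots> = (\<integral>\<^sup>+s\<in>{0<..}. (\<integral>\<^sup>+y. ennreal (s ^ n / fact n * ?U n y) * (?E (Suc n) s * g s (s * y)) \<partial>lborel) \<partial>lborel)"
    by (rule Suc.IH) simp
  also have "\<dots> = (\<integral>\<^sup>+s\<in>{0<..}. (\<integral>\<^sup>+y. ennreal (s ^ n / fact n * ?U n y) *
      (\<integral>\<^sup>+e\<in>{0<..}. (\<integral>\<^sup>+\<theta>. ?a \<theta> * (?E (Suc (Suc n)) (s + e) * h (s + e) (s * y + e * cos \<theta>)) \<partial>lborel) \<partial>lborel) \<partial>lborel) \<partial>lborel)"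
  proof -
    let ?B = "\<lambda>s x. \<integral>\<^sup>+e\<in>{0<..}. \<integral>\<^sup>+\<theta>. ?a \<theta> * (?E (Suc (Suc n)) (s + e) * h (s + e) (x + e * cos \<theta>)) \<partial>lborel \<partial>lborel"
    have "?E (Suc n) s * g s x = ?B s x" for s x
    proof -
      have "?E (Suc n) s * g s x = (\<integral>\<^sup>+e. ?E (Suc n) s * (\<integral>\<^sup>+t. ?d e * (?a t * h (s + e) (x + e * cos t)) \<partial>lborel) \<partial>lborel)"
        unfolding g_def by (rule nn_integral_cmult[symmetric]) simp
      also have "\<dots> = ?B s x"
      proof (rule nn_integral_cong_AE)
        have "AE e in lborel. e \<noteq> (0::real)" by (rule AE_lborel_singleton)
        then show "AE e in lborel. ?E (Suc n) s * (\<integral>\<^sup>+t. ?d e * (?a t * h (s + e) (x + e * cos t)) \<partial>lborel)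
          = (\<integral>\<^sup>+\<theta>. ?a \<theta> * (?E (Suc (Suc n)) (s + e) * h (s + e) (x + e * cos \<theta>)) \<partial>lborel) * indicator {0<..} e"
        proof eventually_elim
          case (elim e)
          show ?case
          proof (cases "0 < e")
            case True
            \<comment> \<open>One more factor \<open>lam\<close> and the additivity of the exponent:
              the weight of the past times the density of the new step is the weight at the new
              total time.\<close>
            have "?E (Suc n) s * ?d e = ?E (Suc (Suc n)) (s + e)"
              using True lam by (subst ennreal_mult'[symmetric])
                (auto simp: exponential_density_def algebra_simps exp_add[symmetric] exp_diff exp_minus field_simps)
            then have "?E (Suc n) s * (?d e * z) = ?E (Suc (Suc n)) (s + e) * z" for z
              by (simp only: mult.assoc[symmetric])
            then show ?thesis using True
              by (simp add: nn_integral_cmult[symmetric] del: power_Suc) (simp add: mult.left_commute del: power_Suc)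
          next
            case False
            with elim show ?thesis by (simp add: exponential_density_def)
          qed
        qed
      qed
      finally show ?thesis .
    qed
    then show ?thesis by (simp only:)
  qed
  also have "\<dots> = (\<integral>\<^sup>+s\<in>{0<..}. (\<integral>\<^sup>+y. ennreal (s ^ Suc n / fact (Suc n) * ?U (Suc n) y) *
        (?E (Suc (Suc n)) s * h s (s * y)) \<partial>lborel) \<partial>lborel)"
    by (rule nn_integral_add_step[OF _ m, where h="\<lambda>s x. ?E (Suc (Suc n)) s * h s x"]) simp
  finally show ?case .
qed

end

section \<open>From complete steps to the position at a fixed time\<close>

context poisson_angles begin

lemma AE_step_pos: "AE \<omega> in M. \<forall>j. 0 < step j \<omega>"
proof (subst AE_all_countable, intro allI)
  fix j
  have "prob {\<omega>\<in>space M. 0 < step j \<omega>} = exp (- 0 * lam)"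
    by (rule exponential_distributedD_gt[OF step_distributed]) (use lam in auto)
  then have "prob {\<omega>\<in>space M. 0 < step j \<omega>} = 1" by simp
  then show "AE \<omega> in M. 0 < step j \<omega>"
    by (rule prob_Collect_eq_1[THEN iffD1, rotated]) simp
qed

text \<open>If all event times stay below N, then so does every step; the first k + 1 steps do this
  with probability q^(k + 1), where q < 1. The lemma excludes the paths on which
  \<open>event_count\<close> would be the cardinality of an infinite set, that is 0.\<close>

lemma AE_S_unbounded: "AE \<omega> in M. \<forall>s. \<exists>j. s < S j \<omega>"
proof -
  have bounded: "AE \<omega> in M. \<exists>j. real N < S j \<omega>" for N :: nat
  proof -
    define q where "q = 1 - exp (- real N * lam)"
    have q: "0 \<le> q" "q < 1" using lam by (auto simp: q_def)
    define bad where "bad = {\<omega>\<in>space M. \<forall>j. S j \<omega> \<le> real N}"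
    have [measurable]: "bad \<in> events" unfolding bad_def by measurable
    have "prob bad \<le> q ^ Suc k" for k
    proof -
      have "prob bad \<le> prob (\<Inter>j\<in>{..k}. step j -` {..real N} \<inter> space M)"
      proof (rule finite_measure_mono_AE)
        show "AE \<omega> in M. \<omega> \<in> bad \<longrightarrow> \<omega> \<in> (\<Inter>j\<in>{..k}. step j -` {..real N} \<inter> space M)"
          using AE_step_pos
        proof eventually_elim
          case (elim \<omega>)
          show ?case
          proof
            assume "\<omega> \<in> bad"
            then have \<omega>: "\<omega> \<in> space M" "S (Suc j) \<omega> \<le> real N" for j by (auto simp: bad_def)
            have "step j \<omega> \<le> real N" for j
            proof -
              have "0 \<le> S j \<omega>" using elim \<omega>(1) by (simp add: S_eq_sum sum_nonneg less_imp_le)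
              then show ?thesis using \<omega>(2)[of j] by (simp add: step_def)
            qed
            then show "\<omega> \<in> (\<Inter>j\<in>{..k}. step j -` {..real N} \<inter> space M)" using \<omega>(1) by auto
          qed
        qed
        show "(\<Inter>j\<in>{..k}. step j -` {..real N} \<inter> space M) \<in> events"
          by (intro sets.finite_INT measurable_sets[OF step_measurable]) auto
      qed
      also have "\<dots> = (\<Prod>j\<in>{..k}. prob (step j -` {..real N} \<inter> space M))"
        by (rule indep_varsD[OF step_indep]) auto
      also have "\<dots> = (\<Prod>j\<in>{..k}. q)"
      proof (rule prod.cong[OF refl])
        fix j
        have "step j -` {..real N} \<inter> space M = {\<omega>\<in>space M. step j \<omega> \<le> real N}" by auto
        then show "prob (step j -` {..real N} \<inter> space M) = q"
          unfolding q_def using exponential_distributedD_le[OF step_distributed, of "real N" j] lam by simp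
      qed
      finally show ?thesis by simp
    qed
    moreover have "(\<lambda>k. q ^ Suc k) \<longlonglongrightarrow> 0"
      using q by (intro LIMSEQ_Suc LIMSEQ_realpow_zero) auto
    ultimately have "prob bad \<le> 0" by (intro LIMSEQ_le_const[of "\<lambda>k. q ^ Suc k"]) auto
    then have "prob bad = 0" by (simp add: measure_le_0_iff)
    then show ?thesis
      by (subst (asm) prob_eq_0) (auto simp: bad_def not_le elim!: eventually_mono)
  qed
  have "AE \<omega> in M. \<forall>N. \<exists>j. real N < S j \<omega>"
    by (subst AE_all_countable) (use bounded in blast)
  then show ?thesis
    by (rule eventually_mono) (meson less_trans reals_Archimedean2)
qed

definition "regular \<omega> \<longleftrightarrow> (\<forall>j. 0 < step j \<omega>) \<and> (\<forall>s. \<exists>j. s < S j \<omega>)"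

lemma event_count_eq_iff:
  assumes "\<omega> \<in> space M" and reg: "regular \<omega>" and s: "0 < s"
  shows "event_count S s \<omega> = n \<longleftrightarrow> S n \<omega> \<le> s \<and> s < S (Suc n) \<omega>"
proof -
  have mono: "strict_mono (\<lambda>j. S j \<omega>)"
    using reg by (intro strict_monoI_Suc) (auto simp: regular_def step_def)
  have ex: "\<exists>j. s < S j \<omega>" using reg by (auto simp: regular_def)
  \<comment> \<open>N is the first index whose event lies after s. Index 0 is not an event, so the
    number of events up to s is N - 1.\<close>
  define N where "N = (LEAST j. s < S j \<omega>)"
  have N: "s < S N \<omega>" unfolding N_def by (rule LeastI_ex[OF ex])
  have N0: "N \<noteq> 0" using N s S_0[OF assms(1)] by (cases "N = 0") auto
  have iff: "S j \<omega> \<le> s \<longleftrightarrow> j < N" for j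
  proof
    assume "S j \<omega> \<le> s"
    with N have "S j \<omega> < S N \<omega>" by simp
    then show "j < N" using strict_mono_less[OF mono] by blast
  next
    assume "j < N"
    then show "S j \<omega> \<le> s" using not_less_Least[of j "\<lambda>j. s < S j \<omega>"] by (simp add: N_def)
  qed
  have "{j. 1 \<le> j \<and> S j \<omega> \<le> s} = {1..<N}" unfolding iff by auto
  then have "event_count S s \<omega> = N - 1" by (simp add: event_count_def)
  moreover have "S n \<omega> \<le> s \<and> s < S (Suc n) \<omega> \<longleftrightarrow> N = Suc n"
    using iff[of n] iff[of "Suc n"] by auto
  ultimately show ?thesis using N0 by auto
qed

lemma flight_eq:
  assumes "event_count S s \<omega> = n"
  shows "flight c S \<theta> s \<omega> = c * (position n \<omega> + (s - S n \<omega>) * cos (\<theta> (Suc n) \<omega>))"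
proof -
  have "(\<Sum>j=1..n + 1. ((if j = n + 1 then s else S j \<omega>) - (if j - 1 = n + 1 then s else S (j - 1) \<omega>)) * cos (\<theta> j \<omega>))
    = (\<Sum>j<Suc n. ((if Suc j = n + 1 then s else S (Suc j) \<omega>) - (if j = n + 1 then s else S j \<omega>)) * cos (\<theta> (Suc j) \<omega>))"
    by (rule sum.reindex_bij_witness[of _ Suc "\<lambda>j. j - 1"]) auto
  also have "\<dots> = position n \<omega> + (s - S n \<omega>) * cos (\<theta> (Suc n) \<omega>)"
    by (simp add: position_def step_def)
  finally show ?thesis unfolding flight_def Let_def assms by (rule arg_cong[where f="(*) c"])
qed

lemma event_count_measurable[measurable]:
  "(\<lambda>(s, \<omega>). event_count S s \<omega>) \<in> borel \<Otimes>\<^sub>M M \<rightarrow>\<^sub>M count_space UNIV"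
  unfolding event_count_def case_prod_beta by measurable

lemma flight_measurable[measurable]:
  "(\<lambda>(s, \<omega>). flight c S \<theta> s \<omega>) \<in> borel_measurable (borel \<Otimes>\<^sub>M M)"
proof -
  have "(\<lambda>p. c * (position (event_count S (fst p) (snd p)) (snd p) + (fst p - S (event_count S (fst p) (snd p)) (snd p)) *
      cos (\<theta> (Suc (event_count S (fst p) (snd p))) (snd p)))) \<in> borel_measurable (borel \<Otimes>\<^sub>M M)"
    by (rule measurable_compose_countable[where g="\<lambda>p. event_count S (fst p) (snd p)"]) measurable
  then show ?thesis by (simp add: flight_eq[OF refl] case_prod_beta)
qed

definition flight_event :: "real \<Rightarrow> nat \<Rightarrow> real set \<Rightarrow> real \<Rightarrow> 'a set" where
  "flight_event c n A s = {\<omega>\<in>space M. flight c S \<theta> s \<omega> \<in> A \<and> event_count S s \<omega> = n}"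

lemma flight_event_sets[measurable]: 
  assumes [measurable]: "A \<in> sets borel"
  shows "flight_event c n A s \<in> sets M"
proof -
  have [measurable]: "(\<lambda>\<omega>. flight c S \<theta> s \<omega>) \<in> borel_measurable M" "(\<lambda>\<omega>. event_count S s \<omega>) \<in> M \<rightarrow>\<^sub>M count_space UNIV"
    by measurable
  show ?thesis unfolding flight_event_def by measurable
qed

lemma emeasure_flight_event_measurable:
  assumes [measurable]: "A \<in> sets borel"
  shows "(\<lambda>s. emeasure M (flight_event c n A s)) \<in> borel_measurable borel"
  unfolding flight_event_def by measurable

text \<open>The next event time is written as \<open>S n + step n\<close>, so that the integrand is
  a function of the past, the current step and its angle, as \<open>nn_integral_last_step\<close>
  requires.\<close>

lemma emeasure_flight_event:
  assumes [measurable]: "A \<in> sets borel" and s: "0 < s"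
  shows "emeasure M (flight_event c n A s)
    = (\<integral>\<^sup>+\<omega>. (if S n \<omega> \<le> s \<and> s < S n \<omega> + step n \<omega> then 1 else 0) * indicator A (c * (position n \<omega> + (s - S n \<omega>) * cos (\<theta> (Suc n) \<omega>))) \<partial>M)"
proof -
  have "emeasure M (flight_event c n A s) = (\<integral>\<^sup>+\<omega>. indicator (flight_event c n A s) \<omega> \<partial>M)"
    by simp
  also have "\<dots> = (\<integral>\<^sup>+\<omega>. (if S n \<omega> \<le> s \<and> s < S n \<omega> + step n \<omega> then 1 else 0) * indicator A (c * (position n \<omega> + (s - S n \<omega>) * cos (\<theta> (Suc n) \<omega>))) \<partial>M)"
  proof (rule nn_integral_cong_AE)
    show "AE \<omega> in M. indicator (flight_event c n A s) \<omega> =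
      ((if S n \<omega> \<le> s \<and> s < S n \<omega> + step n \<omega> then 1 else 0) * indicator A (c * (position n \<omega> + (s - S n \<omega>) * cos (\<theta> (Suc n) \<omega>))) :: ennreal)"
      using AE_step_pos AE_S_unbounded AE_space
    proof eventually_elim
      case (elim \<omega>)
      then have "event_count S s \<omega> = n \<longleftrightarrow> S n \<omega> \<le> s \<and> s < S n \<omega> + step n \<omega>"
        using event_count_eq_iff[of \<omega> s n] s by (simp add: regular_def step_def)
      then show ?case
        using elim(3) flight_eq[of s \<omega> n c] by (auto simp: flight_event_def indicator_def)
    qed
  qed
  finally show ?thesis .
qed

text \<open>The age \<open>u = s - S n\<close> at time \<open>s\<close> is weighted by the tail \<open>exp (- lam u)\<close> of the current
  step, which is \<open>1 / lam\<close> times the density of a complete step: integrating over \<open>s\<close> turns the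
  position at a fixed time into the endpoint of \<open>n + 1\<close> complete steps.\<close>
lemma nn_integral_flight_event:
  fixes g :: "real \<Rightarrow> ennreal"
  assumes [measurable]: "A \<in> sets borel" "g \<in> borel_measurable borel"
  shows "(\<integral>\<^sup>+s\<in>{0<..}. g s * emeasure M (flight_event c n A s) \<partial>lborel)
    = (\<integral>\<^sup>+s\<in>{0<..}. g s * (ennreal (lam ^ n * exp (- (lam * s)) * (s ^ n / fact n)) *
        (\<integral>\<^sup>+y. ennreal (ultraspherical (v_param m n) y) * indicator A (c * (s * y)) \<partial>lborel)) \<partial>lborel)"
proof -
  let ?d = "\<lambda>e. ennreal (exponential_density lam e)" and ?a = "\<lambda>t. ennreal (angle_density m t)"
  let ?U = "ultraspherical (v_param m n)"
  interpret P: pair_sigma_finite M lborel ..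
  define k where "k s x u t = g (s + u) * indicator {0<..} (s + u) * indicator {0..} u * indicator A (c * (x + u * cos t))"
    for s x u t :: real
  let ?k = "\<lambda>\<omega>. k (S n \<omega>) (position n \<omega>)"
  have k_meas: "(\<lambda>(s, x, e, t). k s x e t) \<in> borel_measurable (borel \<Otimes>\<^sub>M borel \<Otimes>\<^sub>M borel \<Otimes>\<^sub>M borel)"
    unfolding k_def by measurable
  let ?ind = "\<lambda>\<omega> s. (if S n \<omega> \<le> s \<and> s < S n \<omega> + step n \<omega> then 1 else 0) * indicator A (c * (position n \<omega> + (s - S n \<omega>) * cos (\<theta> (Suc n) \<omega>))) :: ennreal"
  have [measurable]: "(\<lambda>(s, \<omega>). ?ind \<omega> s) \<in> borel_measurable (borel \<Otimes>\<^sub>M M)" "(\<lambda>(\<omega>, s). ?ind \<omega> s) \<in> borel_measurable (M \<Otimes>\<^sub>M borel)"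
    by measurable
  have "(\<integral>\<^sup>+s\<in>{0<..}. g s * emeasure M (flight_event c n A s) \<partial>lborel)
     = (\<integral>\<^sup>+s. (\<integral>\<^sup>+\<omega>. g s * indicator {0<..} s * ?ind \<omega> s \<partial>M) \<partial>lborel)"
  proof (rule nn_integral_cong)
    fix s :: real
    show "g s * emeasure M (flight_event c n A s) * indicator {0<..} s = (\<integral>\<^sup>+\<omega>. g s * indicator {0<..} s * ?ind \<omega> s \<partial>M)"
      by (cases "0 < s") (simp_all add: emeasure_flight_event nn_integral_cmult)
  qed
  also have "\<dots> = (\<integral>\<^sup>+\<omega>. (\<integral>\<^sup>+s. g s * indicator {0<..} s * ?ind \<omega> s \<partial>lborel) \<partial>M)"
    by (rule P.Fubini') simp
  also have "\<dots> = (\<integral>\<^sup>+\<omega>. (\<integral>\<^sup>+u. ?k \<omega> u (\<theta> (Suc n) \<omega>) * (if u < step n \<omega> then 1 else 0) \<partial>lborel) \<partial>M)"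
  proof (rule nn_integral_cong)
    fix \<omega> assume \<omega>: "\<omega> \<in> space M"
    have "(\<integral>\<^sup>+s. g s * indicator {0<..} s * ?ind \<omega> s \<partial>lborel) = (\<integral>\<^sup>+u. g (u + S n \<omega>) * indicator {0<..} (u + S n \<omega>) * ?ind \<omega> (u + S n \<omega>) \<partial>lborel)"
      by (rule nn_integral_shift[symmetric]) measurable
    also have "\<dots> = (\<integral>\<^sup>+u. ?k \<omega> u (\<theta> (Suc n) \<omega>) * (if u < step n \<omega> then 1 else 0) \<partial>lborel)"
      by (intro nn_integral_cong) (auto simp: k_def indicator_def add.commute)
    finally show "(\<integral>\<^sup>+s. g s * indicator {0<..} s * ?ind \<omega> s \<partial>lborel)
       = (\<integral>\<^sup>+u. ?k \<omega> u (\<theta> (Suc n) \<omega>) * (if u < step n \<omega> then 1 else 0) \<partial>lborel)" .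
  qed
  also have "\<dots> = (\<integral>\<^sup>+\<omega>. (\<integral>\<^sup>+e. (\<integral>\<^sup>+t. ?d e * (?a t *
      (\<integral>\<^sup>+u. ?k \<omega> u t * (if u < e then 1 else 0) \<partial>lborel)) \<partial>lborel) \<partial>lborel) \<partial>M)"
    by (rule nn_integral_last_step[where h="\<lambda>s x e t. \<integral>\<^sup>+u. k s x u t * (if u < e then 1 else 0) \<partial>lborel"])
       (unfold k_def, measurable)
  also have "\<dots> = (\<integral>\<^sup>+\<omega>. (\<integral>\<^sup>+u. (\<integral>\<^sup>+t. ennreal (1 / lam) * (?d u * (?a t *
      ?k \<omega> u t)) \<partial>lborel) \<partial>lborel) \<partial>M)"
  proof (rule nn_integral_cong)
    fix \<omega> assume \<omega>: "\<omega> \<in> space M"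
    define kk where "kk u t = ?k \<omega> u t" for u t
    have [measurable]: "case_prod kk \<in> borel_measurable (borel \<Otimes>\<^sub>M borel)"
      unfolding kk_def k_def by measurable
    \<comment> \<open>The current step e enters only through the condition u < e on the age u, so it
      integrates to its tail probability exp (- lam u), which is the density at u divided by
      \<open>lam\<close>.\<close>
    have tail: "(\<integral>\<^sup>+e. ?d e * (if u < e then 1 else 0) \<partial>lborel) = ennreal (1 / lam) * ?d u"
      if "0 \<le> u" for u
    proof -
      have "(\<integral>\<^sup>+e. ?d e * (if u < e then 1 else 0) \<partial>lborel) = (\<integral>\<^sup>+\<omega>. indicator {u<..} (step n \<omega>) \<partial>M)"
        by (subst nn_integral_distributed[OF step_distributed[of n]]) (auto simp: indicator_def intro!: nn_integral_cong)
      also have "\<dots> = (\<integral>\<^sup>+\<omega>. indicator {\<omega>\<in>space M. u < step n \<omega>} \<omega> \<partial>M)"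
        by (intro nn_integral_cong) (auto simp: indicator_def)
      also have "\<dots> = emeasure M {\<omega>\<in>space M. u < step n \<omega>}"
        by (rule nn_integral_indicator) simp
      also have "\<dots> = ennreal (exp (- u * lam))"
        using exponential_distributedD_gt[OF step_distributed[of n] that lam] by (simp add: emeasure_eq_measure)
      also have "\<dots> = ennreal (1 / lam) * ?d u"
        using that lam by (subst ennreal_mult'[symmetric]) (auto simp: exponential_density_def)
      finally show ?thesis .
    qed
    have "(\<integral>\<^sup>+e. (\<integral>\<^sup>+t. ?d e * (?a t *
        (\<integral>\<^sup>+u. kk u t * (if u < e then 1 else 0) \<partial>lborel)) \<partial>lborel) \<partial>lborel)
      = (\<integral>\<^sup>+e. (\<integral>\<^sup>+t. (\<integral>\<^sup>+u. ?a t * kk u t * (?d e * (if u < e then 1 else 0)) \<partial>lborel) \<partial>lborel) \<partial>lborel)"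
      by (simp add: nn_integral_cmult[symmetric] ac_simps)
    also have "\<dots> = (\<integral>\<^sup>+e. (\<integral>\<^sup>+u. (\<integral>\<^sup>+t. ?a t * kk u t * (?d e * (if u < e then 1 else 0)) \<partial>lborel) \<partial>lborel) \<partial>lborel)"
      by (intro nn_integral_cong lborel_pair.Fubini') simp
    also have "\<dots> = (\<integral>\<^sup>+e. (\<integral>\<^sup>+u. (\<integral>\<^sup>+t. ?a t * kk u t \<partial>lborel) * (?d e * (if u < e then 1 else 0)) \<partial>lborel) \<partial>lborel)"
      by (simp add: nn_integral_multc)
    also have "\<dots> = (\<integral>\<^sup>+u. (\<integral>\<^sup>+e. (\<integral>\<^sup>+t. ?a t * kk u t \<partial>lborel) * (?d e * (if u < e then 1 else 0)) \<partial>lborel) \<partial>lborel)"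
      by (rule lborel_pair.Fubini') simp
    also have "\<dots> = (\<integral>\<^sup>+u. (\<integral>\<^sup>+t. ennreal (1 / lam) * (?d u * (?a t * kk u t)) \<partial>lborel) \<partial>lborel)"
    proof (rule nn_integral_cong)
      fix u :: real
      show "(\<integral>\<^sup>+e. (\<integral>\<^sup>+t. ?a t * kk u t \<partial>lborel) * (?d e * (if u < e then 1 else 0)) \<partial>lborel)
        = (\<integral>\<^sup>+t. ennreal (1 / lam) * (?d u * (?a t * kk u t)) \<partial>lborel)"
      proof (cases "0 \<le> u")
        case True
        have "(\<integral>\<^sup>+e. (\<integral>\<^sup>+t. ?a t * kk u t \<partial>lborel) * (?d e * (if u < e then 1 else 0)) \<partial>lborel)
          = (\<integral>\<^sup>+t. ?a t * kk u t \<partial>lborel) * (ennreal (1 / lam) * ?d u)"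
          unfolding tail[OF True, symmetric] by (rule nn_integral_cmult) measurable
        also have "\<dots> = (\<integral>\<^sup>+t. ennreal (1 / lam) * (?d u * (?a t * kk u t)) \<partial>lborel)"
          by (subst nn_integral_cmult, measurable, subst nn_integral_cmult, measurable, simp only: ac_simps)
        finally show ?thesis .
      next
        case False
        then have "kk u t = 0" for t by (simp add: kk_def k_def)
        then show ?thesis by simp
      qed
    qed
    finally show "(\<integral>\<^sup>+e. (\<integral>\<^sup>+t. ?d e * (?a t *
        (\<integral>\<^sup>+u. ?k \<omega> u t * (if u < e then 1 else 0) \<partial>lborel)) \<partial>lborel) \<partial>lborel)
      = (\<integral>\<^sup>+u. (\<integral>\<^sup>+t. ennreal (1 / lam) * (?d u * (?a t * ?k \<omega> u t)) \<partial>lborel) \<partial>lborel)" unfolding kk_def .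
  qed
  also have "\<dots> = ennreal (1 / lam) * (\<integral>\<^sup>+\<omega>. (\<integral>\<^sup>+u. (\<integral>\<^sup>+t. ?d u * (?a t *
      ?k \<omega> u t) \<partial>lborel) \<partial>lborel) \<partial>M)"
    unfolding k_def by (subst nn_integral_cmult, measurable)+
  \<comment> \<open>\<open>nn_integral_last_step\<close> is read from right to left: the age u, now
    weighted by the exponential density, becomes a complete step. Then s = S n + u turns into the
    event time \<open>S (Suc n)\<close>.\<close>
  also have "(\<integral>\<^sup>+\<omega>. (\<integral>\<^sup>+u. (\<integral>\<^sup>+t. ?d u * (?a t *
      ?k \<omega> u t) \<partial>lborel) \<partial>lborel) \<partial>M) = (\<integral>\<^sup>+\<omega>. ?k \<omega> (step n \<omega>) (\<theta> (Suc n) \<omega>) \<partial>M)"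
    by (rule nn_integral_last_step[OF k_meas, symmetric])
  also have "\<dots> = (\<integral>\<^sup>+\<omega>. (\<lambda>s x. g s * indicator {0<..} s * indicator A (c * x)) (S (Suc n) \<omega>) (position (Suc n) \<omega>) \<partial>M)"
  proof (rule nn_integral_cong_AE)
    show "AE \<omega> in M. ?k \<omega> (step n \<omega>) (\<theta> (Suc n) \<omega>) = (\<lambda>s x. g s * indicator {0<..} s * indicator A (c * x)) (S (Suc n) \<omega>) (position (Suc n) \<omega>)"
      using AE_step_pos AE_space
    proof eventually_elim
      case (elim \<omega>)
      then have "0 < step n \<omega>" by simp
      with elim(2) show ?case by (simp add: k_def S_eq_sum position_def)
    qed
  qed
  also have "\<dots> = (\<integral>\<^sup>+s\<in>{0<..}. (\<integral>\<^sup>+y. ennreal (s ^ n / fact n * ?U y) *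
        (ennreal (lam ^ Suc n * exp (- (lam * s))) * (g s * indicator {0<..} s * indicator A (c * (s * y)))) \<partial>lborel) \<partial>lborel)"
    by (rule nn_integral_endpoint) simp
  also have "ennreal (1 / lam) * \<dots> = (\<integral>\<^sup>+s\<in>{0<..}. ennreal (1 / lam) * (\<integral>\<^sup>+y. ennreal (s ^ n / fact n * ?U y) *
        (ennreal (lam ^ Suc n * exp (- (lam * s))) * (g s * indicator {0<..} s * indicator A (c * (s * y)))) \<partial>lborel) \<partial>lborel)"
    by (rule set_nn_integral_cmult[symmetric]) simp_all
  also have "\<dots> = (\<integral>\<^sup>+s\<in>{0<..}. g s * (ennreal (lam ^ n * exp (- (lam * s)) * (s ^ n / fact n)) *
        (\<integral>\<^sup>+y. ennreal (?U y) * indicator A (c * (s * y)) \<partial>lborel)) \<partial>lborel)"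
  proof (rule nn_integral_pos_cong)
    fix s :: real assume s: "0 < s"
    have "ennreal (1 / lam) * (\<integral>\<^sup>+y. ennreal (s ^ n / fact n * ?U y) *
        (ennreal (lam ^ Suc n * exp (- (lam * s))) * (g s * indicator {0<..} s * indicator A (c * (s * y)))) \<partial>lborel)
      = (\<integral>\<^sup>+y. g s * (ennreal (1 / lam) * ennreal (s ^ n / fact n) * ennreal (lam ^ Suc n * exp (- (lam * s)))) * (ennreal (?U y) * indicator A (c * (s * y))) \<partial>lborel)"
    proof -
      have us: "ennreal (s ^ n / fact n * U) = ennreal (s ^ n / fact n) * ennreal U" for U
        by (rule ennreal_mult') (use s in simp)
      show ?thesis
        unfolding us using s by (simp add: nn_integral_cmult[symmetric] ac_simps)
    qed
    also have "ennreal (1 / lam) * ennreal (s ^ n / fact n) * ennreal (lam ^ Suc n * exp (- (lam * s))) = ennreal (lam ^ n * exp (- (lam * s)) * (s ^ n / fact n))"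
      using s lam by (simp add: ennreal_mult'[symmetric])
    finally show "ennreal (1 / lam) * (\<integral>\<^sup>+y. ennreal (s ^ n / fact n * ?U y) *
        (ennreal (lam ^ Suc n * exp (- (lam * s))) * (g s * indicator {0<..} s * indicator A (c * (s * y)))) \<partial>lborel)
      = g s * (ennreal (lam ^ n * exp (- (lam * s)) * (s ^ n / fact n)) *
        (\<integral>\<^sup>+y. ennreal (?U y) * indicator A (c * (s * y)) \<partial>lborel))"
      by (simp add: nn_integral_cmult mult.assoc)
  qed
  finally show ?thesis .
qed

definition endpoint_law :: "real \<Rightarrow> nat \<Rightarrow> real set \<Rightarrow> real \<Rightarrow> ennreal" where
  "endpoint_law c n A s = (\<integral>\<^sup>+y. ennreal (ultraspherical (v_param m n) y) * indicator A (c * (s * y)) \<partial>lborel)"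

lemma v_param_nonneg: "0 \<le> v_param m n"
  by (simp add: v_param_def)

lemma endpoint_law_measurable[measurable]:
  assumes [measurable]: "A \<in> sets borel"
  shows "endpoint_law c n A \<in> borel_measurable borel"
  unfolding endpoint_law_def by measurable

text \<open>The integrated identity holds for every weight g; taking indicators of Borel sets
  identifies both sides as densities of the same measure, hence almost everywhere. The null set may
  depend on A and n.\<close>

lemma AE_emeasure_flight_event:
  assumes A[measurable]: "A \<in> sets borel"
  shows "AE s in lborel. 0 < s \<longrightarrow> emeasure M (flight_event c n A s) =
    ennreal (lam ^ n * exp (- (lam * s)) * (s ^ n / fact n)) * endpoint_law c n A s"
proof -
  let ?w = "\<lambda>s. ennreal (lam ^ n * exp (- (lam * s)) * (s ^ n / fact n))"
  define f where "f s = emeasure M (flight_event c n A s) * indicator {0<..} s" for s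
  define g where "g s = ?w s * endpoint_law c n A s * indicator {0<..} s" for s
  note [measurable] = emeasure_flight_event_measurable
  have [measurable]: "f \<in> borel_measurable lborel" "g \<in> borel_measurable lborel"
    unfolding f_def g_def by measurable
  have "density lborel f = density lborel g"
  proof (rule measure_eqI)
    fix B assume "B \<in> sets (density lborel f)"
    then have [measurable]: "B \<in> sets borel" by simp
    have "emeasure (density lborel f) B = (\<integral>\<^sup>+s\<in>{0<..}. indicator B s * emeasure M (flight_event c n A s) \<partial>lborel)"
      by (subst emeasure_density) (auto simp: f_def ac_simps)
    also have "\<dots> = (\<integral>\<^sup>+s\<in>{0<..}. indicator B s * (?w s * endpoint_law c n A s) \<partial>lborel)"
      unfolding endpoint_law_def by (rule nn_integral_flight_event) auto
    also have "\<dots> = emeasure (density lborel g) B"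
      by (subst emeasure_density) (auto simp: g_def ac_simps)
    finally show "emeasure (density lborel f) B = emeasure (density lborel g) B" .
  qed simp
  then have "AE s in lborel. f s = g s" by (intro sigma_finite_measure.density_unique[OF lborel.sigma_finite_measure_axioms]) auto
  then show ?thesis by eventually_elim (auto simp: f_def g_def)
qed

text \<open>With y = 2 w - 1 the mass becomes a symmetric Beta integral, evaluated by the
  duplication formula. It is needed because the probability of n events, the denominator of the
  conditional probability, is obtained as the case A = UNIV of the preceding lemma.\<close>

lemma endpoint_law_UNIV: "endpoint_law c n UNIV s = 1"
proof -
  define v where "v = v_param m n"
  have v0: "0 \<le> v" by (simp add: v_def v_param_nonneg)
  define A where "A = v + 1/2"
  let ?b = "\<lambda>w. w powr (A - 1) * (1 - w) powr (A - 1)"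
  have A: "0 < A" using v0 by (simp add: A_def)
  have G: "0 < Gamma A" "0 < Gamma (v + 1)" "0 < Gamma (2 * A)" using A v0 by auto
  define K where "K = Gamma (v + 1) / (sqrt pi * Gamma A) * 2 powr (2 * v - 1)"
  have K0: "0 \<le> K" using G by (simp add: K_def)
  have "endpoint_law c n UNIV s = (\<integral>\<^sup>+y. ennreal (ultraspherical v y) \<partial>lborel)"
    by (simp add: endpoint_law_def v_def)
  also have "\<dots> = ennreal 2 * (\<integral>\<^sup>+w. ennreal (ultraspherical v (- 1 + 2 * w)) \<partial>lborel)"
    by (subst nn_integral_real_affine[where c=2 and t="- 1"]) simp_all
  also have "(\<integral>\<^sup>+w. ennreal (ultraspherical v (- 1 + 2 * w)) \<partial>lborel) = (\<integral>\<^sup>+w\<in>{0..1}. ennreal K * ennreal (?b w) \<partial>lborel)"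
  proof (rule nn_integral_cong)
    fix w :: real
    consider "0 < w \<and> w < 1" | "w = 0" | "w = 1" | "w < 0 \<or> 1 < w" by linarith
    then show "ennreal (ultraspherical v (- 1 + 2 * w)) = ennreal K * ennreal (?b w) * indicator {0..1} w"
    proof cases
      case 1
      have "1 - (- 1 + 2 * w)\<^sup>2 = 2 powr 2 * (w * (1 - w))" by (simp add: power2_eq_square algebra_simps)
      then have "(1 - (- 1 + 2 * w)\<^sup>2) powr (v - 1/2) = 2 powr (2 * (v - 1/2)) * (w powr (v - 1/2) * (1 - w) powr (v - 1/2))"
        using 1 by (simp only: powr_mult powr_powr powr_ge_zero)
      moreover have "2 * (v - 1/2) = 2 * v - 1" "A - 1 = v - 1/2" by (auto simp: A_def)
      moreover have "\<bar>- 1 + 2 * w\<bar> < 1" using 1 by auto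
      ultimately have "ultraspherical v (- 1 + 2 * w) = K * (?b w)"
        by (simp add: ultraspherical_def K_def A_def)
      then show ?thesis using 1 K0 by (simp add: ennreal_mult'[symmetric])
    qed (auto simp: ultraspherical_def)
  qed
  also have "\<dots> = ennreal K * (\<integral>\<^sup>+w\<in>{0..1}. ennreal (?b w) \<partial>lborel)"
    by (rule set_nn_integral_cmult) auto
  also have "(\<integral>\<^sup>+w\<in>{0..1}. ennreal (?b w) \<partial>lborel) = ennreal (Beta A A)"
    by (rule nn_integral_has_integral_lebesgue'[OF _ has_integral_Beta_real[OF A A]]) auto
  also have "ennreal 2 * (ennreal K * ennreal (Beta A A)) = ennreal (2 * K * Beta A A)"
    unfolding ennreal_mult'[OF K0, symmetric] mult.assoc by (rule ennreal_mult'[symmetric]) simp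
  also have "2 * K * Beta A A = 1"
  proof -
    have "Gamma A * Gamma (v + 1) = 2 powr (1 - 2 * A) * sqrt pi * Gamma (2 * A)"
    proof -
      have "A + 1/2 = v + 1" by (simp add: A_def)
      then show ?thesis using Gamma_duplication_real[OF A] by simp
    qed
    then have "2 * K * Beta A A = 2 * 2 powr (2 * v - 1) * 2 powr (1 - 2 * A)"
      using G by (simp add: K_def Beta_def mult_2[symmetric] field_simps)
    also have "\<dots> = 2 powr (1 + (2 * v - 1) + (1 - 2 * A))"
      unfolding powr_add by simp
    also have "1 + (2 * v - 1) + (1 - 2 * A) = 0" by (simp add: A_def)
    finally show ?thesis by simp
  qed
  finally show ?thesis by simp
qed

text \<open>The quotient of the preceding identities for A and for UNIV: the Poisson weight cancels,
  and so the law no longer depends on the rate \<open>lam\<close>.\<close>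

lemma AE_cond_prob_flight:
  assumes [measurable]: "A \<in> sets borel"
  shows "AE s in lborel. 0 < s \<longrightarrow> ennreal (\<P>(\<omega> in M. flight c S \<theta> s \<omega> \<in> A \<bar> event_count S s \<omega> = n)) = endpoint_law c n A s"
  using AE_emeasure_flight_event[OF assms, of c n] AE_emeasure_flight_event[of UNIV c n, simplified]
proof eventually_elim
  let ?P = "\<lambda>s. \<P>(\<omega> in M. flight c S \<theta> s \<omega> \<in> A \<bar> event_count S s \<omega> = n)"
  case (elim s)
  show ?case
  proof
    assume s: "0 < s"
    define P where "P = lam ^ n * exp (- (lam * s)) * (s ^ n / fact n)"
    have P: "0 < P" using s lam by (simp add: P_def)
    have "emeasure M (flight_event c n UNIV s) = ennreal P"
      using elim(2) s by (simp add: P_def endpoint_law_UNIV)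
    then have 1: "prob {\<omega>\<in>space M. event_count S s \<omega> = n} = P"
      using P by (simp add: flight_event_def emeasure_eq_measure)
    have 2: "ennreal (prob {\<omega>\<in>space M. flight c S \<theta> s \<omega> \<in> A \<and> event_count S s \<omega> = n}) = ennreal P * endpoint_law c n A s"
      using elim(1) s by (simp add: P_def flight_event_def emeasure_eq_measure)
    have "ennreal (?P s)
       = ennreal (1 / P) * (ennreal P * endpoint_law c n A s)"
      unfolding cond_prob_def 1 2[symmetric] using P by (subst ennreal_mult'[symmetric]) auto
    also have "\<dots> = endpoint_law c n A s"
      using P by (simp add: mult.assoc[symmetric] ennreal_mult'[symmetric])
    finally show "ennreal (?P s) = endpoint_law c n A s" .
  qed
qed

lemma cond_prob_flight_measurable:
  assumes [measurable]: "A \<in> sets borel"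
  shows "(\<lambda>s. \<P>(\<omega> in M. flight c S \<theta> s \<omega> \<in> A \<bar> event_count S s \<omega> = n)) \<in> borel_measurable borel"
  unfolding cond_prob_def measure_def by measurable

end

section \<open>Iterated Gamma processes\<close>

text \<open>This will be the expectation of f at the k-fold iterated process started from t. The
  recursion splits off the process with the largest index, which acts on t first, exactly as in
  \<open>iterated\<close>.\<close>

primrec gamma_chain :: "(nat \<Rightarrow> real) \<Rightarrow> nat \<Rightarrow> (real \<Rightarrow> ennreal) \<Rightarrow> real \<Rightarrow> ennreal" where
  "gamma_chain \<alpha> 0 f t = f t"
| "gamma_chain \<alpha> (Suc k) f t = (\<integral>\<^sup>+s. ennreal (gamma_density (\<alpha> (Suc k)) t s) * gamma_chain \<alpha> k f s \<partial>lborel)"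

lemma gamma_chain_measurable_parameter:
  assumes [measurable]: "case_prod f \<in> borel_measurable (N \<Otimes>\<^sub>M borel)"
  shows "(\<lambda>(x, t). gamma_chain \<alpha> k (f x) t) \<in> borel_measurable (N \<Otimes>\<^sub>M borel)"
proof (induction k)
  case (Suc k)
  note [measurable] = Suc
  show ?case unfolding gamma_chain.simps by measurable
qed simp

lemma gamma_chain_measurable[measurable]:
  assumes [measurable]: "f \<in> borel_measurable borel"
  shows "gamma_chain \<alpha> k f \<in> borel_measurable borel"
proof (induction k)
  case (Suc k)
  note [measurable] = Suc
  show ?case unfolding gamma_chain.simps by measurable
qed (simp add: gamma_chain.simps(1)[abs_def])

lemma gamma_density_nonneg: "0 < a \<Longrightarrow> 0 \<le> gamma_density a t s"
  by (simp add: gamma_density_def)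

lemma gamma_density_nonpos: "s \<le> 0 \<Longrightarrow> gamma_density a t s = 0"
  by (simp add: gamma_density_def)

lemma gamma_chain_cong:
  assumes "\<And>s. 0 < s \<Longrightarrow> f s = g s" "0 < t"
  shows "gamma_chain \<alpha> k f t = gamma_chain \<alpha> k g t"
  using assms(2)
proof (induction k arbitrary: t)
  case (Suc k)
  have "ennreal (gamma_density (\<alpha> (Suc k)) t s) * gamma_chain \<alpha> k f s = ennreal (gamma_density (\<alpha> (Suc k)) t s) * gamma_chain \<alpha> k g s" for s
    by (cases "0 < s") (auto simp: Suc gamma_density_nonpos)
  then show ?case by simp
qed (simp add: assms)

text \<open>A single kernel with a density is enough to absorb a null set, hence
  \<open>1 \<le> k\<close>; for k = 0 the chain evaluates f at the point t itself.\<close>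

lemma gamma_chain_cong_AE:
  assumes "AE s in lborel. 0 < s \<longrightarrow> f s = g s" "1 \<le> k" "0 < t"
  shows "gamma_chain \<alpha> k f t = gamma_chain \<alpha> k g t"
  using assms(2,3)
proof (induction k arbitrary: t rule: nat_induct_at_least)
  case base
  have "AE s in lborel. ennreal (gamma_density (\<alpha> (Suc 0)) t s) * f s = ennreal (gamma_density (\<alpha> (Suc 0)) t s) * g s"
    using assms(1) by eventually_elim (auto simp: gamma_density_def)
  then show ?case unfolding One_nat_def gamma_chain.simps by (rule nn_integral_cong_AE)
next
  case (Suc k)
  have "ennreal (gamma_density (\<alpha> (Suc k)) t s) * gamma_chain \<alpha> k f s = ennreal (gamma_density (\<alpha> (Suc k)) t s) * gamma_chain \<alpha> k g s" for s
    by (cases "0 < s") (auto simp: Suc gamma_density_nonpos)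
  then show ?case by simp
qed

section \<open>The law of the iterated process\<close>

locale gamma_processes = prob_space M for M :: "'a measure" +
  fixes G :: "nat \<Rightarrow> real \<Rightarrow> 'a \<Rightarrow> real" and \<alpha> :: "nat \<Rightarrow> real" and K :: nat
  assumes processes: "i \<in> {1..K} \<Longrightarrow> gamma_process M (\<alpha> i) (G i)"
    and indep: "indep_sets (\<lambda>i. sets (process_sigma M {0<..} (G i))) {1..K}"
begin

lemma G_pos: "i \<in> {1..K} \<Longrightarrow> 0 < t \<Longrightarrow> \<omega> \<in> space M \<Longrightarrow> 0 < G i t \<omega>"
  and G_distributed: "i \<in> {1..K} \<Longrightarrow> 0 < t \<Longrightarrow> distributed M lborel (G i t) (gamma_density (\<alpha> i) t)"
  and G_jointly_measurable: "i \<in> {1..K} \<Longrightarrow> (\<lambda>(t, \<omega>). G i t \<omega>) \<in> borel_measurable (restrict_space borel {0<..} \<Otimes>\<^sub>M process_sigma M {0<..} (G i))"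
  using processes[of i] by (auto simp: gamma_process_def)

abbreviation "history i \<equiv> process_sigma M {0<..} (G i)"

text \<open>The sigma-algebra of the first k processes: \<open>iterated G k\<close> is measurable
  with respect to it at every time, and \<open>G (Suc k)\<close> is independent of it.\<close>

definition past :: "nat \<Rightarrow> 'a measure" where
  "past k = sigma (space M) (\<Union>i\<in>{1..k}. sets (history i))"

lemma process_sigma_sub: "i \<in> {1..K} \<Longrightarrow> sets (history i) \<subseteq> events"
  using indep by (auto simp: indep_sets_def)

lemma past_generator: "(\<Union>i\<in>{1..k}. sets (history i)) \<subseteq> Pow (space M)"
  using sets.space_closed[of "history _"] by (auto dest: sets.sets_into_space)

lemma space_past[simp]: "space (past k) = space M"
  unfolding past_def by (rule space_measure_of) (rule past_generator)

lemma sets_past: "sets (past k) = sigma_sets (space M) (\<Union>i\<in>{1..k}. sets (history i))"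
  unfolding past_def by (rule sets_measure_of) (rule past_generator)

lemma past_mono: "j \<le> k \<Longrightarrow> sets (past j) \<subseteq> sets (past k)"
  unfolding sets_past by (intro sigma_sets_mono' UN_mono) auto

lemma process_sigma_past: "i \<in> {1..k} \<Longrightarrow> sets (history i) \<subseteq> sets (past k)"
  unfolding sets_past by (intro subsetI sigma_sets.Basic UN_I)

lemma past_indep:
  assumes "Suc k \<le> K"
  shows "indep_set (sets (history (Suc k))) (sets (past k))"
proof -
  let ?E = "\<lambda>i. sets (history i)"
  let ?I = "case_bool {Suc k} {1..k}"
  have "indep_sets (\<lambda>j. sigma_sets (space M) (\<Union>i\<in>?I j. ?E i)) UNIV"
  proof (rule indep_sets_collect_sigma)
    show "indep_sets ?E (\<Union>j\<in>UNIV. ?I j)"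
      using assms by (intro indep_sets_mono_index[OF _ indep]) (auto simp: UNIV_bool)
    show "Int_stable (?E i)" for i by (rule sets.Int_stable)
    show "disjoint_family_on ?I UNIV" by (auto simp: disjoint_family_on_def split: bool.split)
  qed
  then show ?thesis
    unfolding indep_set_def
  proof (rule indep_sets_mono_sets)
    fix b :: bool
    show "(case b of True \<Rightarrow> ?E (Suc k) | False \<Rightarrow> sets (past k)) \<subseteq> sigma_sets (space M) (\<Union>i\<in>?I b. ?E i)"
      by (cases b) (auto simp: sets_past)
  qed
qed

text \<open>The processes are constrained at positive times only. Redirecting all other times to 1
  makes functions of a real time that are measurable on the whole line.\<close>

definition "pos s = (if 0 < s then s else 1 :: real)"

lemma pos_measurable: "pos \<in> borel \<rightarrow>\<^sub>M restrict_space borel {0<..}"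
  unfolding pos_def[abs_def] by (rule measurable_restrict_space2) auto

lemma G_measurable_past:
  assumes "Suc k \<le> K" "Suc k \<le> j"
  shows "(\<lambda>(s, \<omega>). G (Suc k) (pos s) \<omega>) \<in> borel_measurable (borel \<Otimes>\<^sub>M past j)"
proof -
  have "(\<lambda>\<omega>. \<omega>) \<in> past j \<rightarrow>\<^sub>M history (Suc k)"
    using process_sigma_past[of "Suc k" j] assms sets.sets_into_space[of _ "past j"]
    by (auto simp: measurable_def Int_absorb2)
  then have "(\<lambda>p. (pos (fst p), snd p)) \<in> borel \<Otimes>\<^sub>M past j \<rightarrow>\<^sub>M restrict_space borel {0<..} \<Otimes>\<^sub>M history (Suc k)"
    by (intro measurable_Pair measurable_compose[OF measurable_fst pos_measurable]) (rule measurable_compose[OF measurable_snd])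
  from measurable_compose[OF this G_jointly_measurable[of "Suc k"]] assms
  show ?thesis by (simp add: case_prod_beta)
qed

text \<open>Measurability must be joint in time and sample point, because the time inserted later is
  random. In the induction the map (s, w) to (G (Suc k) s w, w) is composed with the previous stage;
  the past grows by the history of \<open>G (Suc k)\<close>.\<close>

lemma iterated_measurable:
  "k \<le> K \<Longrightarrow> (\<lambda>(s, \<omega>). iterated G k (pos s) \<omega>) \<in> borel_measurable (borel \<Otimes>\<^sub>M past k)"
proof (induction k)
  case 0
  have "pos \<in> borel_measurable borel" unfolding pos_def[abs_def] by measurable
  then have "(\<lambda>p. pos (fst p)) \<in> borel_measurable (borel \<Otimes>\<^sub>M past 0)" by (rule measurable_compose[OF measurable_fst])
  then show ?case by (simp add: case_prod_beta)
next
  case (Suc k)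
  have 1: "(\<lambda>\<omega>. \<omega>) \<in> past (Suc k) \<rightarrow>\<^sub>M past k"
    using past_mono[of k "Suc k"] sets.sets_into_space[of _ "past (Suc k)"] by (auto simp: measurable_def Int_absorb2)
  have 2: "(\<lambda>p. G (Suc k) (pos (fst p)) (snd p)) \<in> borel_measurable (borel \<Otimes>\<^sub>M past (Suc k))"
    using G_measurable_past[of k "Suc k"] Suc.prems by (simp add: case_prod_beta)
  have "(\<lambda>p. (G (Suc k) (pos (fst p)) (snd p), snd p)) \<in> borel \<Otimes>\<^sub>M past (Suc k) \<rightarrow>\<^sub>M borel \<Otimes>\<^sub>M past k"
    by (intro measurable_Pair 2 measurable_compose[OF measurable_snd 1])
  from measurable_compose[OF this Suc.IH] Suc.prems
  have "(\<lambda>p. iterated G k (pos (G (Suc k) (pos (fst p)) (snd p))) (snd p)) \<in> borel_measurable (borel \<Otimes>\<^sub>M past (Suc k))"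
    by simp
  moreover have "pos (G (Suc k) (pos (fst p)) (snd p)) = G (Suc k) (pos (fst p)) (snd p)" if "p \<in> space (borel \<Otimes>\<^sub>M past (Suc k))" for p
  proof -
    have "0 < G (Suc k) (pos (fst p)) (snd p)"
      using that Suc.prems by (intro G_pos) (auto simp: pos_def space_pair_measure)
    then show ?thesis by (simp add: pos_def)
  qed
  ultimately show ?case by (subst measurable_cong[where g="\<lambda>p. iterated G k (pos (G (Suc k) (pos (fst p)) (snd p))) (snd p)"]) (auto simp: case_prod_beta)
qed

lemma past_sub: "k \<le> K \<Longrightarrow> sets (past k) \<subseteq> events"
  unfolding sets_past by (rule sets.sigma_sets_subset) (use process_sigma_sub in force)

lemma iterated_measurable_M:
  assumes "k \<le> K" "0 < t"
  shows "iterated G k t \<in> borel_measurable M"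
proof -
  have "(\<lambda>\<omega>. \<omega>) \<in> M \<rightarrow>\<^sub>M past k"
    using past_sub[OF assms(1)] sets.sets_into_space[of _ M] by (auto simp: measurable_def Int_absorb2)
  then have "(\<lambda>\<omega>. (t, \<omega>)) \<in> M \<rightarrow>\<^sub>M borel \<Otimes>\<^sub>M past k" by (intro measurable_Pair) auto
  from measurable_compose[OF this iterated_measurable[OF assms(1)]] show ?thesis
    using assms(2) by (simp add: pos_def)
qed

text \<open>The random time \<open>G (Suc k) t\<close> is independent of \<open>past k\<close>, so
  the remaining k processes may be evaluated on an independent copy, with that time frozen. The
  induction hypothesis applies for each frozen time, and the Gamma density then integrates it
  out.\<close>

lemma nn_integral_iterated:
  assumes [measurable]: "f \<in> borel_measurable borel"
  shows "k \<le> K \<Longrightarrow> 0 < t \<Longrightarrow> (\<integral>\<^sup>+\<omega>. f (iterated G k t \<omega>) \<partial>M) = gamma_chain \<alpha> k f t"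
proof (induction k arbitrary: t)
  case 0
  then show ?case by (simp add: emeasure_space_1)
next
  case (Suc k)
  let ?A = "history (Suc k)"
  have "G (Suc k) t \<in> borel_measurable ?A" using Suc.prems by (intro measurable_process_sigma) auto
  then have "(\<lambda>p. (G (Suc k) t (fst p), snd p)) \<in> ?A \<Otimes>\<^sub>M past k \<rightarrow>\<^sub>M borel \<Otimes>\<^sub>M past k"
    by (intro measurable_Pair measurable_compose[OF measurable_fst]) auto
  from measurable_compose[OF this iterated_measurable] Suc.prems
  have m: "(\<lambda>p. f (iterated G k (pos (G (Suc k) t (fst p))) (snd p))) \<in> borel_measurable (?A \<Otimes>\<^sub>M past k)"
    by simp
  have G0: "0 < G (Suc k) t \<omega>" if "\<omega> \<in> space M" for \<omega>
    using that Suc.prems by (intro G_pos) auto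
  have "(\<integral>\<^sup>+\<omega>. f (iterated G (Suc k) t \<omega>) \<partial>M) = (\<integral>\<^sup>+\<omega>. (\<lambda>p. f (iterated G k (pos (G (Suc k) t (fst p))) (snd p))) (\<omega>, \<omega>) \<partial>M)"
    using G0 by (intro nn_integral_cong) (simp add: pos_def)
  also have "\<dots> = (\<integral>\<^sup>+\<omega>. (\<integral>\<^sup>+\<omega>'. f (iterated G k (pos (G (Suc k) t \<omega>)) \<omega>') \<partial>M) \<partial>M)"
    using Suc.prems by (subst nn_integral_indep_set[OF past_indep _ _ m]) simp_all
  also have "\<dots> = (\<integral>\<^sup>+\<omega>. gamma_chain \<alpha> k f (G (Suc k) t \<omega>) \<partial>M)"
    using G0 Suc by (intro nn_integral_cong) (simp add: pos_def)
  also have "\<dots> = gamma_chain \<alpha> (Suc k) f t"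
    using Suc.prems by (subst nn_integral_distributed[OF G_distributed]) auto
  finally show ?case .
qed

end

text \<open>Splits the chain at the other end than the recursion: the kernel with parameter
  \<open>\<alpha> 1\<close> is merged into the function, and the remaining kernels are renumbered.
  It is this kernel that gets mixed with the ultraspherical law to give
  \<open>H_fun\<close>.\<close>

lemma gamma_chain_top:
  "gamma_chain \<alpha> (Suc k) f t = gamma_chain (\<lambda>j. \<alpha> (Suc j)) k (\<lambda>u. \<integral>\<^sup>+s. ennreal (gamma_density (\<alpha> 1) u s) * f s \<partial>lborel) t"
  by (induction k arbitrary: t) auto

lemma gamma_chain_nn_integral:
  fixes F :: "real \<Rightarrow> real \<Rightarrow> ennreal"
  assumes [measurable]: "case_prod F \<in> borel_measurable (borel \<Otimes>\<^sub>M (borel :: real measure))" "A \<in> sets borel"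
  shows "gamma_chain \<alpha> k (\<lambda>u. \<integral>\<^sup>+x\<in>A. F x u \<partial>lborel) t = (\<integral>\<^sup>+x\<in>A. gamma_chain \<alpha> k (F x) t \<partial>lborel)"
proof (induction k arbitrary: t)
  case (Suc k)
  note [measurable] = gamma_chain_measurable_parameter[OF assms(1), of \<alpha> k]
  have "gamma_chain \<alpha> (Suc k) (\<lambda>u. \<integral>\<^sup>+x\<in>A. F x u \<partial>lborel) t
     = (\<integral>\<^sup>+s\<in>UNIV. (\<integral>\<^sup>+x\<in>A. ennreal (gamma_density (\<alpha> (Suc k)) t s) * gamma_chain \<alpha> k (F x) s \<partial>lborel) \<partial>lborel)"
    by (simp add: Suc set_nn_integral_cmult)
  also have "\<dots> = (\<integral>\<^sup>+x\<in>A. (\<integral>\<^sup>+s\<in>UNIV. ennreal (gamma_density (\<alpha> (Suc k)) t s) * gamma_chain \<alpha> k (F x) s \<partial>lborel) \<partial>lborel)"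
    by (rule set_nn_integral_swap[where f="\<lambda>s x. ennreal (gamma_density (\<alpha> (Suc k)) t s) * gamma_chain \<alpha> k (F x) s"]) auto
  finally show ?case by simp
qed simp

text \<open>The coordinate j of \<open>\<tau>\<close> is the argument of the kernel j and coordinate
  j + 1 is its rate; the update at k + 1 supplies the starting rate t. For k = 0 the updated
  function is evaluated at 1 = k + 1, so the value is f t.\<close>

lemma gamma_chain_PiM:
  assumes f[measurable]: "f \<in> borel_measurable borel"
  shows "gamma_chain \<alpha> k f t = (\<integral>\<^sup>+\<tau>. (\<Prod>j=1..k. ennreal (gamma_density (\<alpha> j) ((\<tau>(k + 1 := t)) (j + 1)) ((\<tau>(k + 1 := t)) j))) *
     f ((\<tau>(k + 1 := t)) 1) \<partial>(\<Pi>\<^sub>M j\<in>{1..k}. lborel))"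
proof (induction k arbitrary: t)
  case 0
  interpret product_sigma_finite "\<lambda>_::nat. lborel :: real measure" ..
  show ?case by (simp add: PiM_empty nn_integral_count_space_finite)
next
  case (Suc k)
  interpret product_sigma_finite "\<lambda>_::nat. lborel :: real measure" ..
  have comp[measurable]: "(\<lambda>\<tau>. \<tau> i) \<in> borel_measurable (\<Pi>\<^sub>M j\<in>{1..k'}. lborel :: real measure)" if "i \<in> {1..k'}" for i k' :: nat
    using measurable_component_singleton[OF that, of "\<lambda>_. lborel :: real measure"] by simp
  have upd: "(\<lambda>\<tau>. (\<tau>(k' + 1 := t)) i) \<in> borel_measurable (\<Pi>\<^sub>M j\<in>{1..k'}. lborel)" if "i \<in> {1..k' + 1}" for i k' :: nat and t :: real
    using that comp[of i k'] by (cases "i = k' + 1") auto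
  let ?p = "\<lambda>k' t \<tau>. (\<Prod>j=1..k'. ennreal (gamma_density (\<alpha> j) ((\<tau>(k' + 1 := t)) (j + 1)) ((\<tau>(k' + 1 := t)) j))) *
     f ((\<tau>(k' + 1 := t)) 1)"
  have meas: "(\<lambda>\<tau>. ?p k' t \<tau>)
     \<in> borel_measurable (\<Pi>\<^sub>M j\<in>{1..k'}. lborel)" for k' t
  proof (intro borel_measurable_times_ennreal borel_measurable_prod_ennreal)
    fix j assume j: "j \<in> {1..k'}"
    have "(\<lambda>\<tau>. ((\<tau>(k' + 1 := t)) (j + 1), (\<tau>(k' + 1 := t)) j)) \<in> (\<Pi>\<^sub>M j\<in>{1..k'}. lborel) \<rightarrow>\<^sub>M borel \<Otimes>\<^sub>M borel"
      using j by (intro measurable_Pair upd) auto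
    from measurable_compose[OF this gamma_density_measurable[of "\<alpha> j"]]
    show "(\<lambda>\<tau>. ennreal (gamma_density (\<alpha> j) ((\<tau>(k' + 1 := t)) (j + 1)) ((\<tau>(k' + 1 := t)) j))) \<in> borel_measurable (\<Pi>\<^sub>M j\<in>{1..k'}. lborel)"
      by simp
  next
    show "(\<lambda>\<tau>. f ((\<tau>(k' + 1 := t)) 1)) \<in> borel_measurable (\<Pi>\<^sub>M j\<in>{1..k'}. lborel)"
      by (rule measurable_compose[OF upd f]) simp
  qed
  have ins: "{1..Suc k} = insert (Suc k) {1..k}" by auto
  have "gamma_chain \<alpha> (Suc k) f t = (\<integral>\<^sup>+s. (\<integral>\<^sup>+\<tau>. ennreal (gamma_density (\<alpha> (Suc k)) t s) *
      (?p k s \<tau>) \<partial>(\<Pi>\<^sub>M j\<in>{1..k}. lborel)) \<partial>lborel)"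
    unfolding gamma_chain.simps Suc by (intro nn_integral_cong nn_integral_cmult[symmetric] meas)
  also have "\<dots> = (\<integral>\<^sup>+s. (\<integral>\<^sup>+\<tau>. (\<lambda>\<tau>. ?p (Suc k) t \<tau>) (\<tau>(Suc k := s)) \<partial>(\<Pi>\<^sub>M j\<in>{1..k}. lborel)) \<partial>lborel)"
    by (intro nn_integral_cong) (simp add: ac_simps)
  also have "\<dots> = (\<integral>\<^sup>+\<tau>. ?p (Suc k) t \<tau> \<partial>(\<Pi>\<^sub>M j\<in>{1..Suc k}. lborel))"
    using meas[of "Suc k" t] unfolding ins
    by (subst product_nn_integral_insert_rev) auto
  finally show ?case .
qed

section \<open>Return to the Bochner integral over t_1, ..., t_l\<close>

lemma H_fun_measurable: "H_fun c a v x \<in> borel_measurable borel"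
  unfolding H_fun_def set_lebesgue_integral_def by measurable

text \<open>The chain has shifted parameters because t_j has a Gamma law with parameter
  \<open>\<alpha> (j + 1)\<close> and rate t_(j+1). The hypothesis \<open>fin\<close> excludes the
  case in which the Bochner integral would be 0 for lack of integrability while the nonnegative
  integral is infinite.\<close>

lemma iterated_flight_density_eq:
  fixes \<alpha> :: "nat \<Rightarrow> real" and l :: nat and c v x t :: real
  defines "C \<equiv> 1 / (Gamma ((\<alpha> 1 + 1) / 2) * Beta (\<alpha> 1 / 2) (v - \<alpha> 1 / 2 + 1))"
  defines "I \<equiv> gamma_chain (\<lambda>j. \<alpha> (Suc j)) l (\<lambda>u. ennreal (C * H_fun c (\<alpha> 1) v x u)) t"
  assumes c: "0 < c" and l: "1 \<le> l" and \<alpha>: "\<forall>i\<in>{1..l+1}. 0 < \<alpha> i" and v: "0 \<le> v" "\<alpha> 1 / 2 - 1 < v"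
    and x: "x \<noteq> 0" and fin: "I \<noteq> \<infinity>"
  shows "ennreal (iterated_flight_density c l \<alpha> t v x) = I"
proof -
  let ?P = "\<Pi>\<^sub>M j\<in>{1..l}. lborel :: real measure"
  let ?u = "\<lambda>\<tau>. \<tau>(l + 1 := t)"
  let ?p = "\<lambda>\<tau>. \<Prod>j=1..l. gamma_density (\<alpha> (j + 1)) (?u \<tau> (j + 1)) (?u \<tau> j)"
    and ?e = "\<lambda>\<tau>. \<Prod>j=1..l. ennreal (gamma_density (\<alpha> (Suc j)) (?u \<tau> (j + 1)) (?u \<tau> j))"
    and ?H = "\<lambda>\<tau>. H_fun c (\<alpha> 1) v x (?u \<tau> 1)"
  have a1: "0 < \<alpha> 1" using \<alpha> by auto
  have C: "0 < C" unfolding C_def Beta_def using a1 v by (simp add: divide_simps)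
  define D where "D \<tau> = (?p \<tau>) * ?H \<tau>" for \<tau>
  let ?I = "\<integral>\<^sup>+\<tau>. ennreal (D \<tau>) \<partial>?P"
  note [measurable] = H_fun_measurable
  have comp[measurable]: "(\<lambda>\<tau>. \<tau> i) \<in> borel_measurable ?P" if "i \<in> {1..l}" for i
    using measurable_component_singleton[OF that, of "\<lambda>_. lborel :: real measure"] by simp
  have upd: "(\<lambda>\<tau>. ?u \<tau> i) \<in> borel_measurable ?P" if "i \<in> {1..l + 1}" for i
    using that comp[of i] by (cases "i = l + 1") auto
  have [measurable]: "D \<in> borel_measurable ?P"
    unfolding D_def
  proof (intro borel_measurable_times borel_measurable_prod)
    fix j assume j: "j \<in> {1..l}"
    have "(\<lambda>\<tau>. (?u \<tau> (j + 1), ?u \<tau> j)) \<in> ?P \<rightarrow>\<^sub>M borel \<Otimes>\<^sub>M borel"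
      using j by (intro measurable_Pair upd) auto
    from measurable_compose[OF this gamma_density_measurable[of "\<alpha> (j + 1)"]]
    show "(\<lambda>\<tau>. gamma_density (\<alpha> (j + 1)) (?u \<tau> (j + 1)) (?u \<tau> j)) \<in> borel_measurable ?P" by simp
  next
    show "(\<lambda>\<tau>. ?H \<tau>) \<in> borel_measurable ?P"
      by (rule measurable_compose[OF upd H_fun_measurable]) simp
  qed
  \<comment> \<open>Outside the positive orthant some Gamma density vanishes, so the restriction of
    the integration domain is already built into the product.\<close>
  have zero: "(?p \<tau>) = 0" if "i \<in> {1..l}" "\<tau> i \<le> 0" for \<tau> i
    using that by (intro prod_zero) (auto intro!: bexI[of _ i] gamma_density_nonpos)
  have prod0: "0 \<le> (?p \<tau>)" for \<tau>
    using \<alpha> by (intro prod_nonneg gamma_density_nonneg) auto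
  \<comment> \<open>The sign of \<open>H_fun\<close> is controlled only at positive rates; elsewhere
    the product of densities is 0.\<close>
  have D0: "0 \<le> D \<tau>" for \<tau>
  proof (cases "0 < \<tau> 1")
    case True
    then have "0 \<le> ?H \<tau>" using l by (intro H_fun_nonneg[OF c a1 v x]) auto
    then show ?thesis unfolding D_def using prod0 by (intro mult_nonneg_nonneg)
  next
    case False
    then have z: "1 \<in> {1..l}" "\<tau> 1 \<le> 0" using l by auto
    show ?thesis unfolding D_def zero[of 1 \<tau>, OF z] by simp
  qed
  have "(LINT \<tau>:(\<Pi>\<^sub>E j\<in>{1..l}. {0<..})|?P. (let u = ?u \<tau> in
          (\<Prod>j=1..l. u (j+1) powr \<alpha> (j+1) / Gamma (\<alpha> (j+1)) * u j powr (\<alpha> (j+1) - 1) * exp (- u (j+1) * u j)) *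
          H_fun c (\<alpha> 1) v x (u 1))) = (LINT \<tau>|?P. D \<tau>)"
    unfolding set_lebesgue_integral_def
  proof (rule Bochner_Integration.integral_cong[OF refl])
    fix \<tau> assume "\<tau> \<in> space ?P"
    then have ext: "\<tau> \<in> extensional {1..l}" by (simp add: space_PiM PiE_def)
    show "indicat_real (\<Pi>\<^sub>E j\<in>{1..l}. {0<..}) \<tau> *\<^sub>R (let u = ?u \<tau> in
          (\<Prod>j=1..l. u (j+1) powr \<alpha> (j+1) / Gamma (\<alpha> (j+1)) * u j powr (\<alpha> (j+1) - 1) * exp (- u (j+1) * u j)) *
          H_fun c (\<alpha> 1) v x (u 1)) = D \<tau>"
    proof (cases "\<forall>i\<in>{1..l}. 0 < \<tau> i")
      case True
      then have "\<tau> \<in> (\<Pi>\<^sub>E j\<in>{1..l}. {0<..})" using ext by (auto simp: PiE_def)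
      moreover have "(\<Prod>j=1..l. ?u \<tau> (j+1) powr \<alpha> (j+1) / Gamma (\<alpha> (j+1)) * ?u \<tau> j powr (\<alpha> (j+1) - 1) * exp (- ?u \<tau> (j+1) * ?u \<tau> j))
        = (?p \<tau>)"
        using True by (intro prod.cong refl) (auto simp: gamma_density_def)
      ultimately show ?thesis by (simp only: Let_def D_def indicator_simps scaleR_one)
    next
      case False
      then obtain i where i: "i \<in> {1..l}" "\<tau> i \<le> 0" by (auto simp: not_less)
      then have "\<tau> \<notin> (\<Pi>\<^sub>E j\<in>{1..l}. {0<..})" by (auto simp: PiE_def Pi_def not_less intro!: bexI[of _ i])
      then show ?thesis using zero[of i \<tau>, OF i] by (simp add: D_def del: fun_upd_apply)
    qed
  qed
  also have "\<dots> = enn2real ?I"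
    by (rule integral_eq_nn_integral) (measurable, simp add: D0)
  finally have density: "iterated_flight_density c l \<alpha> t v x = C * enn2real ?I"
    unfolding iterated_flight_density_def C_def by simp
  have "I = (\<integral>\<^sup>+\<tau>. (?e \<tau>) * ennreal (C * ?H \<tau>) \<partial>?P)"
    unfolding I_def by (rule gamma_chain_PiM) measurable
  also have "\<dots> = (\<integral>\<^sup>+\<tau>. ennreal C * ennreal (D \<tau>) \<partial>?P)"
  proof (rule nn_integral_cong)
    fix \<tau>
    have "(?e \<tau>) = ennreal (?p \<tau>)"
      using \<alpha> by (subst prod_ennreal) (auto intro!: gamma_density_nonneg)
    then show "(?e \<tau>) * ennreal (C * ?H \<tau>) = ennreal C * ennreal (D \<tau>)"
      using C prod0[of \<tau>] by (simp only: ennreal_mult'[OF less_imp_le, symmetric] ennreal_mult'[symmetric] D_def mult.left_commute)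
  qed
  also have "\<dots> = ennreal C * ?I"
    by (rule nn_integral_cmult) measurable
  finally have I: "I = ennreal C * ?I" .
  \<comment> \<open>The positive constant C keeps an infinite integral infinite, so finiteness of I
    passes to the integral itself and \<open>enn2real\<close> can be undone.\<close>
  with fin C have "?I < \<infinity>" by (auto simp: ennreal_mult_eq_top_iff less_top)
  then show ?thesis unfolding density I using C by (simp add: ennreal_mult')
qed

section \<open>The law of the flight at the iterated Gamma time\<close>

theorem theorem4p7:
  fixes M :: "'a measure" and c lam t :: real and l m n :: nat and \<alpha> :: "nat \<Rightarrow> real"
    and S \<theta> :: "nat \<Rightarrow> 'a \<Rightarrow> real" and G :: "nat \<Rightarrow> real \<Rightarrow> 'a \<Rightarrow> real"
  assumes "prob_space M" and "c > 0" and "lam > 0" and "t > 0" and "l \<ge> 1"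
    and "\<forall>i\<in>{1..l+1}. \<alpha> i > 0" and "m \<in> {0, 1}"
    and "v_param m n > \<alpha> 1 / 2 - 1"
    and "poisson_event_times M lam S" and "iid_angles M m \<theta>"
    and "\<forall>i\<in>{1..l+1}. gamma_process M (\<alpha> i) (G i)"
    and "independent_model M S \<theta> G (l + 1)"
  shows "\<forall>A\<in>sets borel. flight_law_at M c S \<theta> n (iterated G (l + 1) t) A =
           (\<integral>\<^sup>+ x\<in>A. ennreal (iterated_flight_density c l \<alpha> t (v_param m n) x) \<partial>lborel)"
proof
  interpret prob_space M by fact
  interpret P: poisson_angles M lam m S \<theta>
    by unfold_locales (use assms in \<open>auto simp: independent_model_def\<close>)
  interpret Gp: gamma_processes M G \<alpha> "l + 1"
  proof unfold_locales
    show "gamma_process M (\<alpha> i) (G i)" if "i \<in> {1..l + 1}" for i using assms that by auto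
    have "indep_sets (\<lambda>i. if i = 0 then sets (process_sigma M (UNIV <+> {1..}) (case_sum S \<theta>))
            else sets (process_sigma M {0<..} (G i))) {1..l + 1}"
      using assms by (auto simp: independent_model_def intro: indep_sets_mono_index[rotated])
    then show "indep_sets (\<lambda>i. sets (process_sigma M {0<..} (G i))) {1..l + 1}"
      by (subst indep_sets_cong[OF refl]) auto
  qed
  define v where "v = v_param m n"
  have v: "0 \<le> v" "\<alpha> 1 / 2 - 1 < v" using assms by (auto simp: v_def P.v_param_nonneg)
  have a1: "0 < \<alpha> 1" using assms by auto
  define T where "T = iterated G (l + 1) t"
  define C where "C = 1 / (Gamma ((\<alpha> 1 + 1) / 2) * Beta (\<alpha> 1 / 2) (v - \<alpha> 1 / 2 + 1))"
  \<comment> \<open>The density at x of the flight at a Gamma time with rate u. It is measurable in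
    both variables and is kept in this form, for all x and u, until the identification with
    \<open>H_fun\<close> at nonzero x and positive u.\<close>
  define F where "F x u = (\<integral>\<^sup>+s\<in>{0<..}. ennreal (gamma_density (\<alpha> 1) u s * (ultraspherical v (x / (c * s)) / (c * s))) \<partial>lborel)" for x u
  have F_measurable[measurable]: "case_prod F \<in> borel_measurable (borel \<Otimes>\<^sub>M borel)"
    unfolding F_def by measurable
  let ?\<alpha> = "\<lambda>j. \<alpha> (Suc j)"
  have T[measurable]: "T \<in> borel_measurable M"
    unfolding T_def by (rule Gp.iterated_measurable_M) (use assms in auto)
  let ?X = "\<lambda>x. gamma_chain ?\<alpha> l (F x) t"
  have law: "flight_law_at M c S \<theta> n T A = (\<integral>\<^sup>+x\<in>A. ?X x \<partial>lborel)"
    if A[measurable]: "A \<in> sets borel" for A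
  proof -
    let ?e = "P.endpoint_law c n A"
    define \<psi> where "\<psi> s = ennreal (\<P>(\<omega> in M. flight c S \<theta> s \<omega> \<in> A \<bar> event_count S s \<omega> = n))" for s
    have [measurable]: "\<psi> \<in> borel_measurable borel"
      using P.cond_prob_flight_measurable[OF A, of c n] unfolding \<psi>_def by measurable
    have "flight_law_at M c S \<theta> n T A = (\<integral>\<^sup>+\<omega>. \<psi> (T \<omega>) \<partial>M)"
      unfolding flight_law_at_def \<psi>_def[symmetric] by (simp add: nn_integral_distr)
    also have "\<dots> = gamma_chain \<alpha> (l + 1) \<psi> t"
      unfolding T_def by (rule Gp.nn_integral_iterated) (use assms in auto)
    \<comment> \<open>There is at least one Gamma kernel, so the null set of times at which the
      conditional law is not identified has no effect.\<close>
    also have "\<dots> = gamma_chain \<alpha> (Suc l) (P.endpoint_law c n A) t"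
      using P.AE_cond_prob_flight[OF A, of c n] assms
      by (simp only: Suc_eq_plus1) (rule gamma_chain_cong_AE, auto simp: \<psi>_def)
    \<comment> \<open>The innermost kernel acts on the time s of the flight; integrating it against
      the law of c s Y produces a density in x, which can then be moved outside the remaining l
      kernels.\<close>
    also have "\<dots> = gamma_chain ?\<alpha> l (\<lambda>u. \<integral>\<^sup>+x\<in>A. F x u \<partial>lborel) t"
      unfolding gamma_chain_top
    proof (rule gamma_chain_cong[OF _ \<open>0 < t\<close>])
      fix u :: real assume "0 < u"
      let ?g = "\<lambda>x s. ultraspherical v (x / (c * s)) / (c * s)"
      let ?f = "\<lambda>x s. gamma_density (\<alpha> 1) u s * (?g x s)"
      have endpoint: "?e s = (\<integral>\<^sup>+x\<in>A. ennreal (?g x s) \<partial>lborel)"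
        if "0 < s" for s
      proof -
        have cs: "0 < c * s" using that assms by simp
        have "(\<integral>\<^sup>+x\<in>A. ennreal (?g x s) \<partial>lborel)
          = ennreal (c * s) * (\<integral>\<^sup>+y. ennreal (ultraspherical v y / (c * s)) * indicator A (c * s * y) \<partial>lborel)"
          using cs that \<open>0 < c\<close> by (subst nn_integral_real_affine[where c="c * s" and t=0]) auto
        also have "\<dots> = (\<integral>\<^sup>+y. ennreal (c * s) * (ennreal (ultraspherical v y / (c * s)) * indicator A (c * s * y)) \<partial>lborel)"
          by (rule nn_integral_cmult[symmetric]) measurable
        also have "\<dots> = ?e s"
          using cs that \<open>0 < c\<close> unfolding P.endpoint_law_def v_def[symmetric]
          by (intro nn_integral_cong) (simp add: mult.assoc[symmetric] ennreal_mult'[symmetric])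
        finally show ?thesis ..
      qed
      have "(\<integral>\<^sup>+s. ennreal (gamma_density (\<alpha> 1) u s) * ?e s \<partial>lborel)
        = (\<integral>\<^sup>+s\<in>{0<..}. (\<integral>\<^sup>+x\<in>A. ennreal (?f x s) \<partial>lborel) \<partial>lborel)"
      proof (rule nn_integral_cong)
        fix s :: real
        show "ennreal (gamma_density (\<alpha> 1) u s) * ?e s
          = (\<integral>\<^sup>+x\<in>A. ennreal (?f x s) \<partial>lborel) * indicator {0<..} s"
        proof (cases "0 < s")
          case True
          have "ennreal (gamma_density (\<alpha> 1) u s) * ?e s
            = (\<integral>\<^sup>+x\<in>A. ennreal (gamma_density (\<alpha> 1) u s) * ennreal (?g x s) \<partial>lborel)"
            unfolding endpoint[OF True] by (rule set_nn_integral_cmult[symmetric]) auto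
          then show ?thesis using True gamma_density_nonneg[OF a1] by (simp add: ennreal_mult'[symmetric])
        qed (simp add: gamma_density_nonpos)
      qed
      also have "\<dots> = (\<integral>\<^sup>+x\<in>A. F x u \<partial>lborel)"
        unfolding F_def by (rule set_nn_integral_swap) auto
      finally show "(\<integral>\<^sup>+s. ennreal (gamma_density (\<alpha> 1) u s) * ?e s \<partial>lborel) = (\<integral>\<^sup>+x\<in>A. F x u \<partial>lborel)" .
    qed
    also have "\<dots> = (\<integral>\<^sup>+x\<in>A. ?X x \<partial>lborel)"
      by (rule gamma_chain_nn_integral) auto
    finally show ?thesis .
  qed
  \<comment> \<open>The total integral averages conditional probabilities and is at most 1. This
    supplies the finiteness required for the Bochner integral, for almost every x.\<close>
  have "AE x in lborel. ?X x \<noteq> \<infinity>"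
  proof (rule nn_integral_noteq_infinite)
    show "(\<lambda>x. ?X x) \<in> borel_measurable lborel"
      using measurable_compose[OF measurable_Pair[OF measurable_ident measurable_const] gamma_chain_measurable_parameter[OF F_measurable], of t] by simp
    have "(\<integral>\<^sup>+x. ?X x \<partial>lborel) = flight_law_at M c S \<theta> n T UNIV"
      using law[of UNIV] by simp
    also have "\<dots> \<le> (\<integral>\<^sup>+s. 1 \<partial>distr M borel T)"
      unfolding flight_law_at_def by (intro nn_integral_mono) (auto simp: cond_prob_def)
    also have "\<dots> = 1" using prob_space.emeasure_space_1[OF prob_space_distr[OF T]] by simp
    finally show "(\<integral>\<^sup>+x. ?X x \<partial>lborel) \<noteq> \<infinity>" using top.extremum_uniqueI by fastforce
  qed
  \<comment> \<open>The evaluation of \<open>H_fun\<close> uses a positive \<open>rate\<close>, that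
    is x nonzero; one point does not affect a density.\<close>
  moreover have "AE x in lborel. x \<noteq> (0::real)" by (rule AE_lborel_singleton)
  ultimately have AE: "AE x in lborel. ?X x = ennreal (iterated_flight_density c l \<alpha> t v x)"
  proof eventually_elim
    case (elim x)
    have "?X x = gamma_chain ?\<alpha> l (\<lambda>u. ennreal (C * H_fun c (\<alpha> 1) v x u)) t"
      by (rule gamma_chain_cong[OF _ \<open>0 < t\<close>])
         (use gamma_ultraspherical_mixture[OF \<open>0 < c\<close> a1 v elim(2)] in \<open>simp add: F_def C_def\<close>)
    with elim iterated_flight_density_eq[of c l \<alpha> v x t] assms v show ?case
      by (simp add: C_def)
  qed
  fix A :: "real set" assume A: "A \<in> sets borel"
  show "flight_law_at M c S \<theta> n (iterated G (l + 1) t) A =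
           (\<integral>\<^sup>+ x\<in>A. ennreal (iterated_flight_density c l \<alpha> t (v_param m n) x) \<partial>lborel)"
    unfolding T_def[symmetric] law[OF A] v_def[symmetric]
    by (rule nn_integral_cong_AE) (use AE in eventually_elim, simp)
qed

end
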